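(* Let $M\subset\mathbb{C}^N$ be a smooth generic submanifold of codimension $d$ through the origin, let $\gamma$ be a Segre variety mapping of $M$ at $0$, let $v^j$, $j\ge1$, be the iterated Segre mappings of $M$ at $0$ relative to $\gamma$, and let $e=2N-d-\dim_{\mathbb{C}}\mathfrak{g}_M(0)$. Then there exist formal power series $f_1,\dots,f_e\in\mathbb{C}[[Z]]$, $Z=(Z_1,\dots,Z_N)$, such that (i) $df_1(0),\dots,df_e(0),dr_1(0),\dots,dr_d(0)$ are linearly independent (over $\mathbb{C}$), where $r_1,\dots,r_d$ are defining functions for $M$ near $0$; (ii) $f_k\circ v^j=0$ for $k=1,\dots,e$ and $j=1,2,\dots$.
   Context: Let $M\subset\mathbb{C}^N$ be a smooth ($C^\infty$) real submanifold of (real) codimension $d$ with $0\in M$, defined near $0$ by $r=0$, where $r=(r_1,\dots,r_d)$ are smooth real-valued functions with $dr_1,\dots,dr_d$ linearly independent at $0$. $M$ is generic (near the origin) if the complex differentials $\partial r_1,\dots,\partial r_d$ (the $dZ$-parts of the differentials) are also linearly independent at $0$. Put $n=N-d$. Let $\rho_j(Z,\bar Z)$ be the Taylor series of $r_j$ at $0$; regard $\rho_j(Z,\zeta)$ as a formal power series in $2N$ indeterminates $(Z,\zeta)$, and write $\rho=(\rho_1,\dots,\rho_d)$. A formal mapping $F\colon(\mathbb{C}^k,0)\to(\mathbb{C}^p,0)$ is a $p$-tuple $F(x)=(F_1(x),\dots,F_p(x))$, $x=(x_1,\dots,x_k)$, of formal power series $F_j\in\mathbb{C}[[x]]$ without constant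 terms. For a formal mapping $F$, $\bar F(x):=\overline{F(\bar x)}$, i.e. the coefficients are replaced by their complex conjugates. A Segre variety mapping of $M$ at $0$ is a formal mapping $\gamma(\zeta,t)\colon(\mathbb{C}^N\times\mathbb{C}^n,0)\to(\mathbb{C}^N,0)$ such that $\rho(\gamma(\zeta,t),\zeta)=0$ and the matrix $\frac{\partial\gamma}{\partial t}(0,0)$ has rank $n$. The iterated Segre mappings $v^j\colon(\mathbb{C}^{nj},0)\to(\mathbb{C}^N,0)$ relative to $\gamma$ are defined inductively, with $t^i=(t^i_1,\dots,t^i_n)$, by $$v^1(t^1):=\gamma(0,t^1),\qquad v^{j+1}(t^1,\dots,t^{j+1}):=\gamma(\bar v^{j}(t^1,\dots,t^j),t^{j+1}).$$ Let $\mathfrak{g}_M$ be the Lie algebra generated by the smooth $(1,0)$ and $(0,1)$ vector fields tangent to $M$ near $0$, and let $\mathfrak{g}_M(0)$ be the subspace of the complexified tangent space $\mathbb{C}T_0M$ obtained by evaluating the vector fields in $\mathfrak{g}_M$ at $0$. Differentials at $0$ are regarded as complex covectors in $\mathbb{C}T_0^*\mathbb{C}^N$ with basis $dZ_1,\dots,dZ_N,d\bar Z_1,\dots,d\bar Z_N$; for $f\in\mathbb{C}[[Z]]$, $df(0)=\sum_i \frac{\partial f}{\partial Z_i}(0)\,dZ_i$. *)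

theory Defs
  imports "HOL-Analysis.Analysis" "HOL-Library.Poly_Mapping"
begin

section \<open>Formal power series in several indeterminates\<close>

text \<open>A series assigns a coefficient to each exponent vector \<^typ>\<open>'x \<Rightarrow>\<^sub>0 nat\<close>. The type \<^typ>\<open>'x\<close> of
  indeterminates may be infinite; a ring of series in finitely many of them is cut out by
  \<open>mfps_vars_in\<close> below.\<close>

typedef ('x, 'a) mfps = "UNIV :: (('x \<Rightarrow>\<^sub>0 nat) \<Rightarrow> 'a) set"
  morphisms mfps_coeff Abs_mfps ..

setup_lifting type_definition_mfps

lemma mfps_eqI: "(\<And>m. mfps_coeff f m = mfps_coeff g m) \<Longrightarrow> f = g"
  by transfer auto

definition splits :: "('x \<Rightarrow>\<^sub>0 nat) \<Rightarrow> (('x \<Rightarrow>\<^sub>0 nat) \<times> ('x \<Rightarrow>\<^sub>0 nat)) set" where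
  "splits m = {(a, b). a + b = m}"

lemma finite_splits: "finite (splits m)"
proof -
  let ?s = "\<Sum>i\<in>Poly_Mapping.keys m. Poly_Mapping.lookup m i"
  let ?F = "{f :: 'a \<Rightarrow> nat. \<forall>i. (i \<in> Poly_Mapping.keys m \<longrightarrow> f i \<in> {..?s}) \<and> (i \<notin> Poly_Mapping.keys m \<longrightarrow> f i = 0)}"
  have F: "finite ?F"
    by (rule finite_set_of_finite_funs) auto
  have le: "a \<in> {a. Poly_Mapping.lookup a \<in> ?F}"
    if "\<And>i. Poly_Mapping.lookup a i \<le> Poly_Mapping.lookup m i" for a
  proof -
    have "Poly_Mapping.lookup a i \<le> ?s" if "i \<in> Poly_Mapping.keys m" for i
      using \<open>\<And>i. Poly_Mapping.lookup a i \<le> Poly_Mapping.lookup m i\<close>[of i] member_le_sum[OF that, of "Poly_Mapping.lookup m"] by auto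
    moreover have "Poly_Mapping.lookup a i = 0" if "i \<notin> Poly_Mapping.keys m" for i
      using \<open>\<And>i. Poly_Mapping.lookup a i \<le> Poly_Mapping.lookup m i\<close>[of i] that by (simp add: in_keys_iff)
    ultimately show ?thesis by auto
  qed
  let ?A = "{a. Poly_Mapping.lookup a \<in> ?F}"
  have "finite (Poly_Mapping.lookup -` ?F)"
    by (rule finite_vimageI[OF F]) (auto simp: inj_def intro: poly_mapping_eqI)
  then have "finite ?A" by (simp add: vimage_def)
  moreover have "splits m \<subseteq> ?A \<times> ?A"
  proof
    fix u assume "u \<in> splits m"
    then have m: "m = fst u + snd u" by (auto simp: splits_def)
    have "fst u \<in> ?A" by (rule le) (simp add: m Poly_Mapping.lookup_add)
    moreover have "snd u \<in> ?A" by (rule le) (simp add: m Poly_Mapping.lookup_add)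
    ultimately show "u \<in> ?A \<times> ?A" by (simp only: mem_Times_iff)
  qed
  ultimately show ?thesis
    by (meson finite_SigmaI finite_subset)
qed

instantiation mfps :: (type, comm_ring_1) comm_ring_1
begin

lift_definition zero_mfps :: "('a, 'b) mfps" is "\<lambda>_. 0" .
lift_definition one_mfps :: "('a, 'b) mfps" is "\<lambda>m. if m = 0 then 1 else 0" .
lift_definition plus_mfps :: "('a, 'b) mfps \<Rightarrow> ('a, 'b) mfps \<Rightarrow> ('a, 'b) mfps"
  is "\<lambda>f g m. f m + g m" .
lift_definition minus_mfps :: "('a, 'b) mfps \<Rightarrow> ('a, 'b) mfps \<Rightarrow> ('a, 'b) mfps"
  is "\<lambda>f g m. f m - g m" .
lift_definition uminus_mfps :: "('a, 'b) mfps \<Rightarrow> ('a, 'b) mfps"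
  is "\<lambda>f m. - f m" .
lift_definition times_mfps :: "('a, 'b) mfps \<Rightarrow> ('a, 'b) mfps \<Rightarrow> ('a, 'b) mfps"
  is "\<lambda>f g m. \<Sum>(a, b)\<in>splits m. f a * g b" .

instance
proof
  fix f g h :: "('a, 'b) mfps"
  show "f * g * h = f * (g * h)"
  proof (transfer, rule ext)
    fix f g h :: "('a \<Rightarrow>\<^sub>0 nat) \<Rightarrow> 'b" and m
    have "(\<Sum>(p, c)\<in>splits m. (\<Sum>(a, b)\<in>splits p. f a * g b) * h c)
        = (\<Sum>u\<in>splits m. \<Sum>v\<in>splits (fst u). f (fst v) * g (snd v) * h (snd u))"
      by (simp add: case_prod_unfold sum_distrib_right)
    also have "\<dots> = (\<Sum>(u, v)\<in>(SIGMA u:splits m. splits (fst u)). f (fst v) * g (snd v) * h (snd u))"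
      by (rule sum.Sigma) (auto simp: finite_splits)
    also have "\<dots> = (\<Sum>(u, v)\<in>(SIGMA u:splits m. splits (snd u)). f (fst u) * (g (fst v) * h (snd v)))"
      by (rule sum.reindex_bij_witness
          [where i = "\<lambda>(u, v). ((fst u + fst v, snd v), (fst u, fst v))"
             and j = "\<lambda>(u, v). ((fst v, snd v + snd u), (snd v, snd u))"])
         (auto simp: splits_def add.assoc mult.assoc)
    also have "\<dots> = (\<Sum>u\<in>splits m. \<Sum>v\<in>splits (snd u). f (fst u) * (g (fst v) * h (snd v)))"
      by (rule sum.Sigma[symmetric]) (auto simp: finite_splits)
    also have "\<dots> = (\<Sum>(a, q)\<in>splits m. f a * (\<Sum>(b, c)\<in>splits q. g b * h c))"
      by (simp add: case_prod_unfold sum_distrib_left)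
    finally show "(\<Sum>(p, c)\<in>splits m. (\<Sum>(a, b)\<in>splits p. f a * g b) * h c)
        = (\<Sum>(a, q)\<in>splits m. f a * (\<Sum>(b, c)\<in>splits q. g b * h c))" .
  qed
  show "f * g = g * f"
    by (transfer, rule ext,
        rule sum.reindex_bij_witness[where i = prod.swap and j = prod.swap])
       (auto simp: splits_def add.commute mult.commute)
  show "1 * f = f"
  proof (transfer, rule ext)
    fix f :: "('a \<Rightarrow>\<^sub>0 nat) \<Rightarrow> 'b" and m
    have "(\<Sum>(a, b)\<in>splits m. (if a = 0 then 1 else 0) * f b)
        = (\<Sum>(a, b)\<in>{(0 :: 'a \<Rightarrow>\<^sub>0 nat, m)}. (if a = 0 then 1 else 0) * f b)"
      by (rule sum.mono_neutral_right[OF finite_splits]) (auto simp: splits_def split: if_splits)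
    then show "(\<Sum>(a, b)\<in>splits m. (if a = 0 then 1 else 0) * f b) = f m" by simp
  qed
  show "(f + g) * h = f * h + g * h"
    by (transfer, rule ext) (simp add: case_prod_unfold distrib_right sum.distrib)
  show "(0 :: ('a, 'b) mfps) \<noteq> 1"
    by transfer (auto simp: fun_eq_iff)
qed (transfer, auto simp: algebra_simps)+

end

lift_definition mfps_var :: "'x \<Rightarrow> ('x, 'a::comm_ring_1) mfps"
  is "\<lambda>i m. if m = Poly_Mapping.single i 1 then 1 else 0" .

lift_definition mfps_pderiv :: "'x \<Rightarrow> ('x, 'a::comm_ring_1) mfps \<Rightarrow> ('x, 'a) mfps"
  is "\<lambda>i f m. of_nat (Poly_Mapping.lookup m i + 1) * f (m + Poly_Mapping.single i 1)" .

lift_definition mfps_cnj :: "('x, complex) mfps \<Rightarrow> ('x, complex) mfps"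
  is "\<lambda>f m. cnj (f m)" .

abbreviation mfps_const_coeff :: "('x, 'a) mfps \<Rightarrow> 'a" where
  "mfps_const_coeff f \<equiv> mfps_coeff f 0"

definition mfps_vars_in :: "'x set \<Rightarrow> ('x, 'a::zero) mfps \<Rightarrow> bool" where
  "mfps_vars_in X f \<longleftrightarrow> (\<forall>m. mfps_coeff f m \<noteq> 0 \<longrightarrow> Poly_Mapping.keys m \<subseteq> X)"

text \<open>Substitution \<open>f(g)\<close>. The sum defining a coefficient has only finitely many nonzero terms,
  so that \<^const>\<open>Sum_any\<close> is the actual sum, whenever \<open>f\<close> involves only finitely many
  indeterminates and all \<open>g i\<close> have zero constant term.\<close>

definition mfps_subst ::
  "('x, 'a::comm_ring_1) mfps \<Rightarrow> ('x \<Rightarrow> ('y, 'a) mfps) \<Rightarrow> ('y, 'a) mfps" where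
  "mfps_subst f g =
     Abs_mfps (\<lambda>m. Sum_any (\<lambda>a. mfps_coeff f a * mfps_coeff (\<Prod>i\<in>Poly_Mapping.keys a. g i ^ Poly_Mapping.lookup a i) m))"


section \<open>Smooth functions and Wirtinger derivatives\<close>

text \<open>Used for open sets \<open>S\<close> only.\<close>

fun Ck_on :: "nat \<Rightarrow> 'a::real_normed_vector set \<Rightarrow> ('a \<Rightarrow> 'b::real_normed_vector) \<Rightarrow> bool" where
  "Ck_on 0 S f \<longleftrightarrow> continuous_on S f"
| "Ck_on (Suc k) S f \<longleftrightarrow>
     (\<forall>x\<in>S. f differentiable at x) \<and> (\<forall>v. Ck_on k S (\<lambda>x. frechet_derivative f (at x) v))"

definition smooth_on :: "'a::real_normed_vector set \<Rightarrow> ('a \<Rightarrow> 'b::real_normed_vector) \<Rightarrow> bool" where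
  "smooth_on S f \<longleftrightarrow> (\<forall>k. Ck_on k S f)"

text \<open>Throughout, the index type \<^typ>\<open>'N + 'N\<close> labels the coordinates \<open>Z\<close> (\<^const>\<open>Inl\<close>)
  and \<open>\<zeta>\<close> or \<open>Z\<close>-bar (\<^const>\<open>Inr\<close>): \<open>wirtinger (Inl i)\<close> is \<open>\<partial>/\<partial>Z\<^sub>i\<close> and
  \<open>wirtinger (Inr i)\<close> is the derivative with respect to the conjugate of \<open>Z\<^sub>i\<close>.\<close>

fun wirtinger :: "'N::finite + 'N \<Rightarrow> (complex^'N \<Rightarrow> complex) \<Rightarrow> complex^'N \<Rightarrow> complex" where
  "wirtinger (Inl i) F p =
     (frechet_derivative F (at p) (axis i 1) - \<i> * frechet_derivative F (at p) (axis i \<i>)) / 2"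
| "wirtinger (Inr i) F p =
     (frechet_derivative F (at p) (axis i 1) + \<i> * frechet_derivative F (at p) (axis i \<i>)) / 2"

text \<open>The exponent vector \<open>m\<close> is realised by some list of directions containing each \<open>s\<close>
  exactly \<open>Poly_Mapping.lookup m s\<close> times; for \<open>F\<close> smooth near \<open>0\<close> the order of differentiation is
  irrelevant.\<close>

definition taylor0 :: "(complex^'N::finite \<Rightarrow> complex) \<Rightarrow> ('N + 'N, complex) mfps" where
  "taylor0 F = Abs_mfps (\<lambda>m.
     foldr wirtinger (SOME ss. \<forall>s. count_list ss s = Poly_Mapping.lookup m s) F 0
       / (\<Prod>s\<in>Poly_Mapping.keys m. fact (Poly_Mapping.lookup m s)))"

definition differential :: "(complex^'N::finite \<Rightarrow> real) \<Rightarrow> complex^'N \<Rightarrow> complex^('N + 'N)" where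
  "differential r p = (\<chi> s. wirtinger s (\<lambda>z. complex_of_real (r z)) p)"

definition complex_differential :: "(complex^'N::finite \<Rightarrow> real) \<Rightarrow> complex^'N \<Rightarrow> complex^'N" where
  "complex_differential r p = (\<chi> i. differential r p $ Inl i)"

definition formal_differential :: "('N::finite, complex) mfps \<Rightarrow> complex^('N + 'N)" where
  "formal_differential f =
     (\<chi> s. case s of Inl i \<Rightarrow> mfps_const_coeff (mfps_pderiv i f) | Inr i \<Rightarrow> 0)"

definition independent_family :: "'i set \<Rightarrow> ('i \<Rightarrow> 'a::field^'n) \<Rightarrow> bool" where
  "independent_family I v \<longleftrightarrow> inj_on v I \<and> vec.independent (v ` I)"


section \<open>Generic submanifolds\<close>

definition defining_functions_near_0 ::
  "(complex^'N::finite) set \<Rightarrow> nat \<Rightarrow> (nat \<Rightarrow> complex^'N \<Rightarrow> real) \<Rightarrow> bool" where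
  "defining_functions_near_0 M d r \<longleftrightarrow>
     (\<exists>U. open U \<and> 0 \<in> U \<and> (\<forall>k<d. smooth_on U (r k)) \<and>
          M \<inter> U = {z \<in> U. \<forall>k<d. r k z = 0}) \<and>
     independent_family {..<d} (\<lambda>k. differential (r k) 0)"

definition generic_at_0 :: "nat \<Rightarrow> (nat \<Rightarrow> complex^'N::finite \<Rightarrow> real) \<Rightarrow> bool" where
  "generic_at_0 d r \<longleftrightarrow> independent_family {..<d} (\<lambda>k. complex_differential (r k) 0)"


section \<open>The Lie algebra generated by the CR vector fields\<close>

text \<open>A complex vector field is given by its coefficients with respect to the
  \<open>\<partial>/\<partial>Z\<^sub>i\<close> and their conjugates. Fields live on a neighbourhood of \<open>0\<close> in the ambient
  space and are tangent to \<open>M\<close> along \<open>M\<close>; brackets of such fields are again tangent and, along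
  \<open>M\<close>, depend only on the restrictions to \<open>M\<close>.\<close>

type_synonym 'N cfield = "complex^'N \<Rightarrow> complex^('N + 'N)"

definition field_apply :: "'N::finite cfield \<Rightarrow> (complex^'N \<Rightarrow> complex) \<Rightarrow> complex^'N \<Rightarrow> complex" where
  "field_apply X F p = (\<Sum>s\<in>UNIV. X p $ s * wirtinger s F p)"

definition field_bracket :: "'N::finite cfield \<Rightarrow> 'N cfield \<Rightarrow> 'N cfield" where
  "field_bracket X Y p =
     (\<chi> s. field_apply X (\<lambda>z. Y z $ s) p - field_apply Y (\<lambda>z. X z $ s) p)"

definition tangent_near_0 ::
  "(complex^'N::finite) set \<Rightarrow> nat \<Rightarrow> (nat \<Rightarrow> complex^'N \<Rightarrow> real) \<Rightarrow> 'N cfield set" where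
  "tangent_near_0 M d r = {X. \<exists>U. open U \<and> 0 \<in> U \<and> smooth_on U X \<and>
     (\<forall>p\<in>M \<inter> U. \<forall>k<d. field_apply X (\<lambda>z. complex_of_real (r k z)) p = 0)}"

definition type_10_near_0 :: "'N::finite cfield set" where
  "type_10_near_0 = {X. \<forall>\<^sub>F p in nhds 0. \<forall>i. X p $ Inr i = 0}"

definition type_01_near_0 :: "'N::finite cfield set" where
  "type_01_near_0 = {X. \<forall>\<^sub>F p in nhds 0. \<forall>i. X p $ Inl i = 0}"

inductive_set lie_algebra_generated :: "'N::finite cfield set \<Rightarrow> 'N cfield set"
  for G :: "'N cfield set" where
  gen: "X \<in> G \<Longrightarrow> X \<in> lie_algebra_generated G"
| zero: "(\<lambda>p. 0) \<in> lie_algebra_generated G"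
| add: "X \<in> lie_algebra_generated G \<Longrightarrow> Y \<in> lie_algebra_generated G \<Longrightarrow>
    (\<lambda>p. X p + Y p) \<in> lie_algebra_generated G"
| scale: "X \<in> lie_algebra_generated G \<Longrightarrow> (\<lambda>p. c *s X p) \<in> lie_algebra_generated G"
| bracket: "X \<in> lie_algebra_generated G \<Longrightarrow> Y \<in> lie_algebra_generated G \<Longrightarrow>
    field_bracket X Y \<in> lie_algebra_generated G"

definition cr_lie_algebra ::
  "(complex^'N::finite) set \<Rightarrow> nat \<Rightarrow> (nat \<Rightarrow> complex^'N \<Rightarrow> real) \<Rightarrow> 'N cfield set" where
  "cr_lie_algebra M d r =
     lie_algebra_generated (tangent_near_0 M d r \<inter> (type_10_near_0 \<union> type_01_near_0))"

definition cr_lie_algebra_at_0 ::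
  "(complex^'N::finite) set \<Rightarrow> nat \<Rightarrow> (nat \<Rightarrow> complex^'N \<Rightarrow> real) \<Rightarrow> (complex^('N + 'N)) set" where
  "cr_lie_algebra_at_0 M d r = (\<lambda>X. X 0) ` cr_lie_algebra M d r"


section \<open>Segre mappings\<close>

text \<open>In \<open>\<gamma>(\<zeta>, t)\<close> the indeterminate \<open>Inl k\<close> is \<open>\<zeta>\<^sub>k\<close> and \<open>Inr l\<close>, for \<open>l < n\<close>, is the
  \<open>l\<close>-th component of \<open>t\<close>. The rank condition says that the column space of the matrix has
  dimension \<open>n\<close>.\<close>

definition segre_variety_mapping ::
  "nat \<Rightarrow> (nat \<Rightarrow> complex^'N::finite \<Rightarrow> real) \<Rightarrow> ('N \<Rightarrow> ('N + nat, complex) mfps) \<Rightarrow> bool" where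
  "segre_variety_mapping d r \<gamma> \<longleftrightarrow>
     (let n = CARD('N) - d in
        (\<forall>k. mfps_vars_in (UNIV <+> {..<n}) (\<gamma> k) \<and> mfps_const_coeff (\<gamma> k) = 0) \<and>
        (\<forall>j<d. mfps_subst (taylor0 (\<lambda>z. complex_of_real (r j z)))
                 (case_sum \<gamma> (\<lambda>k. mfps_var (Inl k))) = 0) \<and>
        vec.dim ((\<lambda>l. \<chi> k. mfps_const_coeff (mfps_pderiv (Inr l) (\<gamma> k))) ` {..<n}) = n)"

text \<open>\<open>iterated_segre \<gamma> j\<close> is \<open>v\<^sup>j\<close>, where the indeterminate \<open>(i, l)\<close> is the \<open>l\<close>-th component
  of \<open>t\<^sup>i\<close>, \<open>1 \<le> i \<le> j\<close>. The auxiliary value \<open>v\<^sup>0 = 0\<close> makes \<open>v\<^sup>1(t\<^sup>1) = \<gamma>(0, t\<^sup>1)\<close> an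
  instance of the recursion.\<close>

fun iterated_segre ::
  "('N::finite \<Rightarrow> ('N + nat, complex) mfps) \<Rightarrow> nat \<Rightarrow> 'N \<Rightarrow> (nat \<times> nat, complex) mfps" where
  "iterated_segre \<gamma> 0 = (\<lambda>k. 0)"
| "iterated_segre \<gamma> (Suc j) = (\<lambda>k. mfps_subst (\<gamma> k)
     (case_sum (\<lambda>i. mfps_cnj (iterated_segre \<gamma> j i)) (\<lambda>l. mfps_var (Suc j, l))))"

end

theory Submission
  imports Defs
begin

text \<open>Choose smooth \<open>(1,0)\<close> and \<open>(0,1)\<close> fields annihilating the \<open>r\<^sub>k\<close> near the origin and spanning
  the CR tangent space at the origin, and let \<open>H\<close> be the Lie algebra generated by their Taylor series.
  The series all of whose iterated \<open>H\<close>-derivatives vanish at the origin form the ideal of the formal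
  orbit of \<open>H\<close> (Nagano).

  Modulo shorter words, an iterated derivative at the origin is a symmetric multilinear function of
  the fields, it vanishes if one field vanishes at the origin, and on series in \<open>Z\<close> alone it vanishes
  if one field is of type \<open>(0,1)\<close>. Hence, if the \<open>Z\<close>-parts of the values of \<open>H\<close> at the origin form a
  graph over the coordinates in \<open>U\<close>, one can solve degree by degree for a series
  \<open>Z\<^sub>b - \<phi>(Z\<^sub>i : i \<in> U)\<close> in the orbit ideal, for every \<open>b \<notin> U\<close>; counting dimensions gives at least
  \<open>e\<close> such \<open>b\<close>. Their differentials are independent of the \<open>dr\<^sub>k\<close> because the \<open>(0,1)\<close>-parts of the
  latter are independent.

  Two formal points of the complexification with the same \<open>\<zeta>\<close> (or the same \<open>Z\<close>) lie on one leaf of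
  the \<open>(1,0)\<close> (or \<open>(0,1)\<close>) fields. Starting from the first and flowing along these fields, whose flows
  preserve the orbit ideal, approximates the second to any order, so the ideal vanishes at the second
  if it vanishes at the first. The iterated Segre mappings are reached from the origin by such steps.\<close>

section \<open>Orders of vanishing and derivatives of formal power series\<close>

text \<open>The data are smooth, not analytic, so neither the complexification nor the orbits of the
  Lie algebra are available as manifolds; only formal series are. Limits are therefore replaced by
  congruences modulo \<open>vanish k\<close>, the series of order at least k, and a series lying in
  all of these is zero. Flows make sense here because their time is itself a series without constant
  term, so that the i-th term of the exponential has order at least i.

  Passing from g_M to the algebra generated by the chosen fields costs nothing: it can only shrink
  the space of values at the origin, and the dimension count needs just the upper bound dim g_M(0)
  for that space. The count reads card U + (N - d) \<le> dim g_M(0), where N - d comes from the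
  (0,1) fields, whose values have zero Z-part; this leaves N - card U \<ge> 2N - d - dim g_M(0)
  equations.

  A formal point of the complexification is represented by the substitution it induces on series.
  After a truncated flow this is a ring homomorphism only modulo a power of the variables, and the
  transport along leaves is built on that weaker notion.\<close>

lemma mfps_coeff_zero [simp]: "mfps_coeff 0 m = 0"
  by transfer simp

lemma mfps_coeff_one: "mfps_coeff 1 m = (if m = 0 then 1 else 0)"
  by transfer simp

lemma mfps_coeff_add [simp]: "mfps_coeff (f + g) m = mfps_coeff f m + mfps_coeff g m"
  by transfer simp

lemma mfps_coeff_diff [simp]: "mfps_coeff (f - g) m = mfps_coeff f m - mfps_coeff g m"
  by transfer simp

lemma mfps_coeff_uminus [simp]: "mfps_coeff (- f) m = - mfps_coeff f m"
  by transfer simp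

lemma mfps_coeff_mult: "mfps_coeff (f * g) m = (\<Sum>(a, b)\<in>splits m. mfps_coeff f a * mfps_coeff g b)"
  by transfer simp

lemma mfps_coeff_sum [simp]: "mfps_coeff (sum f A) m = (\<Sum>i\<in>A. mfps_coeff (f i) m)"
  by (induction A rule: infinite_finite_induct) auto

lemma mfps_coeff_Abs [simp]: "mfps_coeff (Abs_mfps f) m = f m"
  by (simp add: Abs_mfps_inverse)

lemma mfps_coeff_var: "mfps_coeff (mfps_var i) m = (if m = Poly_Mapping.single i 1 then 1 else 0)"
  by transfer simp

lemma mfps_coeff_pderiv:
  "mfps_coeff (mfps_pderiv i f) m =
     of_nat (Poly_Mapping.lookup m i + 1) * mfps_coeff f (m + Poly_Mapping.single i 1)"
  by transfer simp

lemma mfps_coeff_cnj [simp]: "mfps_coeff (mfps_cnj f) m = cnj (mfps_coeff f m)"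
  by transfer simp

lift_definition mfps_const :: "'a \<Rightarrow> ('x, 'a::comm_ring_1) mfps"
  is "\<lambda>c m. if m = 0 then c else 0" .

lemma mfps_coeff_const: "mfps_coeff (mfps_const c) m = (if m = 0 then c else 0)"
  by transfer simp

lemma mfps_coeff_const_mult [simp]:
  fixes f :: "('x, 'a::comm_ring_1) mfps"
  shows "mfps_coeff (mfps_const c * f) m = c * mfps_coeff f m"
proof -
  have "mfps_coeff (mfps_const c * f) m = (\<Sum>(a, b)\<in>{(0 :: 'x \<Rightarrow>\<^sub>0 nat, m)}. mfps_coeff (mfps_const c) a * mfps_coeff f b)"
    unfolding mfps_coeff_mult
    by (rule sum.mono_neutral_right[OF finite_splits])
       (auto simp: splits_def mfps_coeff_const split: if_splits)
  then show ?thesis by (simp add: mfps_coeff_const)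
qed

lemma mfps_const_add: "mfps_const (a + b) = mfps_const a + mfps_const b"
  by (rule mfps_eqI) (simp add: mfps_coeff_const)

lemma mfps_const_mult: "mfps_const (a * b) = mfps_const a * mfps_const b"
  by (rule mfps_eqI) (simp add: mfps_coeff_const)

lemma mfps_const_0 [simp]: "mfps_const 0 = 0"
  by (rule mfps_eqI) (simp add: mfps_coeff_const)

lemma mfps_const_1 [simp]: "mfps_const 1 = 1"
  by (rule mfps_eqI) (simp add: mfps_coeff_const mfps_coeff_one)

lemma splits_0 [simp]: "splits 0 = {(0, 0 :: 'x \<Rightarrow>\<^sub>0 nat)}"
  unfolding splits_def
  by (auto simp: poly_mapping_eq_iff lookup_add fun_eq_iff)

lemma const_coeff_mult [simp]: "mfps_const_coeff (f * g) = mfps_const_coeff f * mfps_const_coeff g"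
  by (simp add: mfps_coeff_mult)

lemma const_coeff_var [simp]: "mfps_const_coeff (mfps_var i) = 0"
  by (auto simp: mfps_coeff_var poly_mapping_eq_iff fun_eq_iff lookup_single when_def)

lemma mfps_coeff_var_mult:
  "mfps_coeff (mfps_var i * f) m =
     (if Poly_Mapping.lookup m i = 0 then 0 else mfps_coeff f (m - Poly_Mapping.single i 1))"
proof -
  have "mfps_coeff (mfps_var i * f) m =
      (\<Sum>(a, b)\<in>(if Poly_Mapping.lookup m i = 0 then {} else {(Poly_Mapping.single i 1, m - Poly_Mapping.single i 1)}).
         mfps_coeff (mfps_var i) a * mfps_coeff f b)"
    unfolding mfps_coeff_mult
  proof (rule sum.mono_neutral_right[OF finite_splits])
    show "(if Poly_Mapping.lookup m i = 0 then {} else {(Poly_Mapping.single i 1, m - Poly_Mapping.single i 1)}) \<subseteq> splits m"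
      by (auto simp: splits_def poly_mapping_eq_iff fun_eq_iff lookup_add lookup_minus lookup_single when_def)
  qed (auto simp: splits_def mfps_coeff_var lookup_add split: if_splits)
  then show ?thesis by (simp add: mfps_coeff_var)
qed

text \<open>Total degree of an exponent vector; \<^const>\<open>Poly_Mapping.degree\<close> is a different notion.\<close>

definition mdeg :: "('x \<Rightarrow>\<^sub>0 nat) \<Rightarrow> nat" where
  "mdeg m = (\<Sum>i\<in>Poly_Mapping.keys m. Poly_Mapping.lookup m i)"

lemma mdeg_superset:
  assumes "finite S" "Poly_Mapping.keys m \<subseteq> S"
  shows "mdeg m = (\<Sum>i\<in>S. Poly_Mapping.lookup m i)"
  unfolding mdeg_def
  by (rule sum.mono_neutral_left) (use assms in \<open>auto simp: in_keys_iff\<close>)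

lemma mdeg_add [simp]: "mdeg (a + b) = mdeg a + mdeg b"
proof -
  let ?S = "Poly_Mapping.keys a \<union> Poly_Mapping.keys b"
  have "mdeg (a + b) = (\<Sum>i\<in>?S. Poly_Mapping.lookup (a + b) i)"
    by (rule mdeg_superset) (use keys_add[of a b] in auto)
  also have "\<dots> = mdeg a + mdeg b"
    by (simp add: lookup_add sum.distrib mdeg_superset[of ?S])
  finally show ?thesis .
qed

lemma mdeg_single [simp]: "mdeg (Poly_Mapping.single i k) = k"
  by (simp add: mdeg_def)

lemma mdeg_eq_0 [simp]: "mdeg m = 0 \<longleftrightarrow> m = 0"
proof
  assume "mdeg m = 0"
  then have "Poly_Mapping.lookup m i = 0" for i
    by (cases "i \<in> Poly_Mapping.keys m") (auto simp: mdeg_def in_keys_iff)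
  then show "m = 0" by (intro poly_mapping_eqI) simp
qed (simp add: mdeg_def)

text \<open>The filtration that plays the role of the powers of the maximal ideal. Defining it
  through coefficients keeps it meaningful for infinitely many indeterminates, such as the pairs of
  naturals in the iterated Segre mappings.\<close>

definition vanish :: "nat \<Rightarrow> ('x, 'a::comm_ring_1) mfps set" where
  "vanish k = {f. \<forall>m. mdeg m < k \<longrightarrow> mfps_coeff f m = 0}"

lemma vanish_0 [simp]: "vanish 0 = UNIV"
  by (auto simp: vanish_def)

lemma vanish_1_iff: "f \<in> vanish (Suc 0) \<longleftrightarrow> mfps_const_coeff f = 0"
  by (auto simp: vanish_def)

lemma vanish_zero [simp]: "0 \<in> vanish k"
  by (auto simp: vanish_def)

lemma vanish_add: "f \<in> vanish k \<Longrightarrow> g \<in> vanish k \<Longrightarrow> f + g \<in> vanish k"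
  by (auto simp: vanish_def)

lemma vanish_diff: "f \<in> vanish k \<Longrightarrow> g \<in> vanish k \<Longrightarrow> f - g \<in> vanish k"
  by (auto simp: vanish_def)

lemma vanish_sum: "(\<And>i. i \<in> A \<Longrightarrow> f i \<in> vanish k) \<Longrightarrow> sum f A \<in> vanish k"
  by (auto simp: vanish_def)

lemma vanish_mono: "f \<in> vanish k \<Longrightarrow> j \<le> k \<Longrightarrow> f \<in> vanish j"
  by (auto simp: vanish_def)

lemma vanish_mult:
  assumes "f \<in> vanish j" "g \<in> vanish k"
  shows "f * g \<in> vanish (j + k)"
proof -
  have "mfps_coeff f a * mfps_coeff g b = 0" if "mdeg (a + b) < j + k" for a b
  proof (cases "mdeg a < j")
    case False
    with that have "mdeg b < k" by simp
    then show ?thesis using assms by (simp add: vanish_def)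
  qed (use assms in \<open>simp add: vanish_def\<close>)
  then show ?thesis
    by (auto simp: vanish_def mfps_coeff_mult splits_def intro!: sum.neutral)
qed

lemma vanish_mult_left: "g \<in> vanish k \<Longrightarrow> f * g \<in> vanish k"
  using vanish_mult[of f 0 g k] by simp

lemma vanish_mult_right: "g \<in> vanish k \<Longrightarrow> g * f \<in> vanish k"
  using vanish_mult[of g k f 0] by simp

lemma vanish_power: "f \<in> vanish k \<Longrightarrow> f ^ n \<in> vanish (k * n)"
  by (induction n) (auto intro: vanish_mult)

text \<open>The filtration is separated; identities proved to every order become exact through
  this.\<close>

lemma vanish_all: "(\<And>k. f \<in> vanish k) \<Longrightarrow> f = 0"
  by (rule mfps_eqI) (auto simp: vanish_def)

section \<open>Partial derivatives of formal series\<close>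

lemma mfps_pderiv_add: "mfps_pderiv i (f + g) = mfps_pderiv i f + mfps_pderiv i g"
  by (rule mfps_eqI) (simp add: mfps_coeff_pderiv algebra_simps)

lemma mfps_pderiv_const [simp]: "mfps_pderiv i (mfps_const c) = 0"
proof (rule mfps_eqI)
  fix m :: "'a \<Rightarrow>\<^sub>0 nat"
  have "m + Poly_Mapping.single i 1 \<noteq> 0"
    by (metis add_is_0 mdeg_add mdeg_eq_0 mdeg_single zero_neq_one)
  then show "mfps_coeff (mfps_pderiv i (mfps_const c)) m = mfps_coeff 0 m"
    by (simp add: mfps_coeff_pderiv mfps_coeff_const)
qed

lemma mfps_pderiv_zero [simp]: "mfps_pderiv i 0 = 0"
  using mfps_pderiv_const[of i 0] by simp

lemma mfps_pderiv_var: "mfps_pderiv i (mfps_var j) = (if i = j then 1 else 0)"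
proof (rule mfps_eqI)
  fix m :: "'a \<Rightarrow>\<^sub>0 nat"
  have 1: "m + Poly_Mapping.single i 1 = Poly_Mapping.single i 1 \<longleftrightarrow> m = 0" by simp
  have 2: "m + Poly_Mapping.single i 1 \<noteq> Poly_Mapping.single j 1" if "i \<noteq> j"
  proof
    assume "m + Poly_Mapping.single i 1 = Poly_Mapping.single j 1"
    then have "Poly_Mapping.lookup (m + Poly_Mapping.single i 1) i = Poly_Mapping.lookup (Poly_Mapping.single j (1::nat)) i" by simp
    with that show False by (simp add: lookup_add lookup_single)
  qed
  show "mfps_coeff (mfps_pderiv i (mfps_var j)) m = mfps_coeff (if i = j then 1 else 0) m"
    using 1 2 by (auto simp: mfps_coeff_pderiv mfps_coeff_var mfps_coeff_one)
qed

lemma mfps_pderiv_commute: "mfps_pderiv i (mfps_pderiv j f) = mfps_pderiv j (mfps_pderiv i f)"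
  by (rule mfps_eqI) (auto simp: mfps_coeff_pderiv lookup_add lookup_single when_def ac_simps)

text \<open>The derivative factor is the exponent of \<open>i\<close> in
  \<open>m + single i 1\<close>, which is the sum of its exponents in the two factors of each
  splitting. Distributing over this sum gives the two Leibniz terms.\<close>

lemma mfps_pderiv_mult: "mfps_pderiv i (f * g) = mfps_pderiv i f * g + f * mfps_pderiv i g"
proof (rule mfps_eqI)
  fix m :: "'a \<Rightarrow>\<^sub>0 nat"
  let ?e = "Poly_Mapping.single i 1 :: 'a \<Rightarrow>\<^sub>0 nat" and ?l = "\<lambda>a. Poly_Mapping.lookup a i"
  \<comment> \<open>Splittings whose first part has exponent 0 carry the factor 0; the others
    correspond, by lowering that exponent by one, to the splittings of \<open>m\<close>.\<close>
  have half: "(\<Sum>(a, b)\<in>splits (m + ?e). of_nat (?l a) * F a b)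
      = (\<Sum>(a, b)\<in>splits m. of_nat (?l a + 1) * F (a + ?e) b)" for F :: "_ \<Rightarrow> _ \<Rightarrow> 'b"
  proof -
    have "(\<Sum>(a, b)\<in>splits (m + ?e). of_nat (?l a) * F a b)
        = (\<Sum>(a, b)\<in>{u \<in> splits (m + ?e). ?l (fst u) \<noteq> 0}. of_nat (?l a) * F a b)"
      by (rule sum.mono_neutral_right[OF finite_splits]) (auto, metis gr0I mult_zero_left of_nat_0)
    also have "\<dots> = (\<Sum>(a, b)\<in>splits m. of_nat (?l a + 1) * F (a + ?e) b)"
    proof (rule sum.reindex_bij_witness[where i = "\<lambda>(a, b). (a + ?e, b)" and j = "\<lambda>(a, b). (a - ?e, b)"])
      fix u assume u: "u \<in> {u \<in> splits (m + ?e). ?l (fst u) \<noteq> 0}"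
      obtain a b where ab: "u = (a, b)" by fastforce
      have a: "a - ?e + ?e = a"
        using u ab by (auto simp: poly_mapping_eq_iff fun_eq_iff lookup_add lookup_minus lookup_single when_def)
      have l: "?l (a - ?e) + 1 = ?l a"
        using u ab by (simp add: lookup_minus)
      show "(case case u of (a, b) \<Rightarrow> (a - ?e, b) of (a, b) \<Rightarrow> (a + ?e, b)) = u"
        using a ab by simp
      have "a - ?e + ?e + b = m + ?e" using u ab a by (simp add: splits_def)
      then have "(a - ?e + b) + ?e = m + ?e" by (simp add: add_ac)
      then show "(case u of (a, b) \<Rightarrow> (a - ?e, b)) \<in> splits m"
        using ab by (simp add: splits_def)
      show "(case case u of (a, b) \<Rightarrow> (a - ?e, b) of (a, b) \<Rightarrow> of_nat (?l a + 1) * F (a + ?e) b) =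
          (case u of (a, b) \<Rightarrow> of_nat (?l a) * F a b)"
        by (simp only: ab prod.case a l)
    qed (auto simp: splits_def lookup_add add_ac)
    finally show ?thesis .
  qed
  have half': "(\<Sum>(a, b)\<in>splits n. F a b) = (\<Sum>(a, b)\<in>splits n. F b a)" for n and F :: "('a \<Rightarrow>\<^sub>0 nat) \<Rightarrow> _ \<Rightarrow> 'b"
    by (rule sum.reindex_bij_witness[where i = prod.swap and j = prod.swap])
       (auto simp: splits_def add.commute)
  let ?f = "mfps_coeff f" and ?g = "mfps_coeff g"
  have "mfps_coeff (mfps_pderiv i (f * g)) m
      = (\<Sum>(a, b)\<in>splits (m + ?e). of_nat (?l m + 1) * (?f a * ?g b))"
    by (simp add: mfps_coeff_pderiv mfps_coeff_mult sum_distrib_left case_prod_unfold)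
  also have "\<dots> = (\<Sum>(a, b)\<in>splits (m + ?e). of_nat (?l a) * (?f a * ?g b) + of_nat (?l b) * (?f a * ?g b))"
  proof (rule sum.cong[OF refl], clarify)
    fix a b assume "(a, b) \<in> splits (m + ?e)"
    then have "?l (a + b) = ?l (m + ?e)" by (simp add: splits_def)
    then have "?l m + 1 = ?l a + ?l b" by (simp add: lookup_add)
    then have "(of_nat (?l m + 1) :: 'b) = of_nat (?l a) + of_nat (?l b)" by (metis of_nat_add)
    then show "of_nat (?l m + 1) * (?f a * ?g b) = of_nat (?l a) * (?f a * ?g b) + of_nat (?l b) * (?f a * ?g b)"
      by (simp add: distrib_right)
  qed
  also have "\<dots> = (\<Sum>(a, b)\<in>splits (m + ?e). of_nat (?l a) * (?f a * ?g b))
      + (\<Sum>(a, b)\<in>splits (m + ?e). of_nat (?l b) * (?f a * ?g b))"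
    by (simp add: case_prod_unfold sum.distrib)
  also have "(\<Sum>(a, b)\<in>splits (m + ?e). of_nat (?l b) * (?f a * ?g b))
      = (\<Sum>(a, b)\<in>splits (m + ?e). of_nat (?l a) * (?f b * ?g a))"
    by (rule half')
  also have "\<dots> = (\<Sum>(a, b)\<in>splits m. of_nat (?l a + 1) * (?f b * ?g (a + ?e)))"
    by (rule half)
  also have "\<dots> = (\<Sum>(a, b)\<in>splits m. of_nat (?l b + 1) * (?f a * ?g (b + ?e)))"
    by (rule half')
  also have "(\<Sum>(a, b)\<in>splits (m + ?e). of_nat (?l a) * (?f a * ?g b))
      = (\<Sum>(a, b)\<in>splits m. of_nat (?l a + 1) * (?f (a + ?e) * ?g b))"
    by (rule half)
  finally show "mfps_coeff (mfps_pderiv i (f * g)) m = mfps_coeff (mfps_pderiv i f * g + f * mfps_pderiv i g) m"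
    by (simp add: mfps_coeff_pderiv mfps_coeff_mult mult.assoc mult.left_commute)
qed

lemma vanish_pderiv:
  assumes "f \<in> vanish (Suc k)" shows "mfps_pderiv i f \<in> vanish k"
  using assms by (auto simp: vanish_def mfps_coeff_pderiv)

lemma const_coeff_pderiv: "mfps_const_coeff (mfps_pderiv i f) = mfps_coeff f (Poly_Mapping.single i 1)"
  by (simp add: mfps_coeff_pderiv)

section \<open>Lie algebras of formal vector fields\<close>

definition formal_apply :: "('s::finite \<Rightarrow> ('s, 'a::comm_ring_1) mfps) \<Rightarrow> ('s, 'a) mfps \<Rightarrow> ('s, 'a) mfps" where
  "formal_apply X h = (\<Sum>s\<in>UNIV. X s * mfps_pderiv s h)"

definition formal_bracket :: "('s::finite \<Rightarrow> ('s, 'a::comm_ring_1) mfps) \<Rightarrow> ('s \<Rightarrow> ('s, 'a) mfps) \<Rightarrow> 's \<Rightarrow> ('s, 'a) mfps" where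
  "formal_bracket X Y s = formal_apply X (Y s) - formal_apply Y (X s)"

text \<open>The last field of the list acts first on the series and the head acts last, just before
  evaluation at the origin. Fields at the right end can thus be absorbed into the series, and the
  head enters only through its value at the origin.\<close>

definition formal_word :: "('s::finite \<Rightarrow> ('s, 'a::comm_ring_1) mfps) list \<Rightarrow> ('s, 'a) mfps \<Rightarrow> 'a" where
  "formal_word Xs h = mfps_const_coeff (foldr formal_apply Xs h)"

lemma formal_apply_add: "formal_apply X (f + g) = formal_apply X f + formal_apply X g"
  by (simp add: formal_apply_def mfps_pderiv_add distrib_left sum.distrib)

lemma formal_apply_zero [simp]: "formal_apply X 0 = 0"
  by (simp add: formal_apply_def)

lemma formal_apply_const [simp]: "formal_apply X (mfps_const c) = 0"
  by (simp add: formal_apply_def)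

lemma formal_apply_mult: "formal_apply X (f * g) = formal_apply X f * g + f * formal_apply X g"
  by (simp add: formal_apply_def mfps_pderiv_mult distrib_left sum.distrib sum_distrib_left sum_distrib_right mult_ac)

lemma formal_apply_const_mult: "formal_apply X (mfps_const c * f) = mfps_const c * formal_apply X f"
  by (simp add: formal_apply_mult)

lemma formal_apply_var: "formal_apply X (mfps_var s) = X s"
proof -
  have "formal_apply X (mfps_var s) = (\<Sum>t\<in>UNIV. if t = s then X t else 0)"
    unfolding formal_apply_def by (intro sum.cong) (auto simp: mfps_pderiv_var)
  then show ?thesis by simp
qed

lemma formal_apply_field_add: "formal_apply (\<lambda>s. X s + Y s) f = formal_apply X f + formal_apply Y f"
  by (simp add: formal_apply_def distrib_right sum.distrib)

lemma formal_apply_field_zero [simp]: "formal_apply (\<lambda>s. 0) f = 0"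
  by (simp add: formal_apply_def)

lemma formal_apply_field_scale: "formal_apply (\<lambda>s. mfps_const c * X s) f = mfps_const c * formal_apply X f"
  by (simp add: formal_apply_def sum_distrib_left mult.assoc)

lemma formal_apply_field_sum: "formal_apply (\<lambda>s. \<Sum>i\<in>I. X i s) f = (\<Sum>i\<in>I. formal_apply (X i) f)"
  by (induction I rule: infinite_finite_induct) (auto simp: formal_apply_field_add)

text \<open>The second-order terms of the two compositions agree because partial derivatives
  commute, so only the first-order terms forming the bracket remain.\<close>

lemma formal_apply_formal_bracket: "formal_apply X (formal_apply Y f) = formal_apply Y (formal_apply X f) + formal_apply (formal_bracket X Y) f"
proof -
  have expand: "formal_apply X (formal_apply Y f) = (\<Sum>t\<in>UNIV. formal_apply X (Y t) * mfps_pderiv t f)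
      + (\<Sum>t\<in>UNIV. \<Sum>s\<in>UNIV. Y t * X s * mfps_pderiv s (mfps_pderiv t f))" for X Y :: "'a \<Rightarrow> ('a, 'b) mfps"
  proof -
    have *: "formal_apply X (sum F A) = (\<Sum>i\<in>A. formal_apply X (F i))" for F :: "'a \<Rightarrow> ('a, 'b) mfps" and A
      by (induction A rule: infinite_finite_induct) (auto simp: formal_apply_add)
    have "formal_apply X (formal_apply Y f) = (\<Sum>t\<in>UNIV. formal_apply X (Y t) * mfps_pderiv t f + Y t * formal_apply X (mfps_pderiv t f))"
      unfolding formal_apply_def[of Y] * formal_apply_mult ..
    then show ?thesis
      by (simp add: sum.distrib formal_apply_def[of X "mfps_pderiv _ f"] sum_distrib_left mult.assoc)
  qed
  have "(\<Sum>t\<in>UNIV. \<Sum>s\<in>UNIV. Y t * X s * mfps_pderiv s (mfps_pderiv t f))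
      = (\<Sum>s\<in>UNIV. \<Sum>t\<in>UNIV. Y t * X s * mfps_pderiv s (mfps_pderiv t f))"
    by (rule sum.swap)
  also have "\<dots> = (\<Sum>t\<in>UNIV. \<Sum>s\<in>UNIV. X t * Y s * mfps_pderiv s (mfps_pderiv t f))"
    by (intro sum.cong refl) (simp add: mfps_pderiv_commute mult_ac)
  finally show ?thesis
    unfolding expand by (simp add: formal_apply_def[of "formal_bracket X Y"] formal_bracket_def left_diff_distrib sum_subtractf)
qed

lemma vanish_formal_apply: "f \<in> vanish (Suc k) \<Longrightarrow> formal_apply X f \<in> vanish k"
  unfolding formal_apply_def by (intro vanish_sum vanish_mult_left vanish_pderiv)

lemma foldr_formal_apply_add: "foldr formal_apply Xs (f + g) = foldr formal_apply Xs f + foldr formal_apply Xs g"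
  by (induction Xs) (auto simp: formal_apply_add)

lemma foldr_formal_apply_zero [simp]: "foldr formal_apply Xs 0 = 0"
  by (induction Xs) auto

lemma formal_word_add: "formal_word Xs (f + g) = formal_word Xs f + formal_word Xs g"
  by (simp add: formal_word_def foldr_formal_apply_add)

lemma formal_word_zero [simp]: "formal_word Xs 0 = 0"
  by (simp add: formal_word_def)

lemma formal_word_append: "formal_word (Xs @ Ys) f = formal_word Xs (foldr formal_apply Ys f)"
  by (simp add: formal_word_def)

lemma formal_word_formal_bracket: "formal_word (As @ X # Y # Bs) f = formal_word (As @ Y # X # Bs) f + formal_word (As @ formal_bracket X Y # Bs) f"
  unfolding formal_word_append foldr.simps o_apply formal_apply_formal_bracket[of X Y] formal_word_add ..

lemma formal_word_vanish: "f \<in> vanish (Suc k) \<Longrightarrow> length Xs \<le> k \<Longrightarrow> formal_word Xs f = 0"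
proof -
  have "f \<in> vanish (length Xs + j) \<Longrightarrow> foldr formal_apply Xs f \<in> vanish j" for j
    by (induction Xs arbitrary: j) (auto intro!: vanish_formal_apply)
  from this[of 1] show "f \<in> vanish (Suc k) \<Longrightarrow> length Xs \<le> k \<Longrightarrow> formal_word Xs f = 0"
    by (auto simp: formal_word_def vanish_1_iff intro: vanish_mono)
qed

text \<open>Adjacent transpositions generate all permutations. The swap hypothesis is restricted to
  lists with the fixed multiset \<open>M\<close>, so that its proof may use the length and the
  entries of the list.\<close>

lemma swap_invariant_imp_mset_invariant:
  assumes "\<And>As x y Bs. mset (As @ x # y # Bs) = M \<Longrightarrow> \<phi> (As @ x # y # Bs) = \<phi> (As @ y # x # Bs)"
    and "mset xs = M" "mset ys = M"
  shows "\<phi> xs = \<phi> ys"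
proof -
  have move: "mset (Ps @ As @ x # Bs) = M \<Longrightarrow> \<phi> (Ps @ As @ x # Bs) = \<phi> (Ps @ x # As @ Bs)" for Ps As x Bs
  proof (induction As arbitrary: Ps)
    case (Cons a As)
    from Cons.IH[of "Ps @ [a]"] Cons.prems have "\<phi> (Ps @ a # As @ x # Bs) = \<phi> (Ps @ a # x # As @ Bs)" by simp
    also have "\<dots> = \<phi> (Ps @ x # a # As @ Bs)"
      using assms(1)[of Ps a x "As @ Bs"] Cons.prems by simp
    finally show ?case by simp
  qed simp
  have "mset (Ps @ xs) = M \<Longrightarrow> mset xs = mset ys \<Longrightarrow> \<phi> (Ps @ xs) = \<phi> (Ps @ ys)" for Ps xs ys
  proof (induction xs arbitrary: Ps ys)
    case (Cons x xs)
    from Cons.prems(2) have "x \<in> set ys" by (metis list.set_intros(1) set_mset_mset)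
    then obtain As Bs where ys: "ys = As @ x # Bs" by (meson split_list)
    have "\<phi> (Ps @ x # xs) = \<phi> ((Ps @ [x]) @ As @ Bs)"
      using Cons.IH[of "Ps @ [x]" "As @ Bs"] Cons.prems ys by simp
    also have "\<dots> = \<phi> (Ps @ ys)"
      using move[of Ps As x Bs] Cons.prems ys by simp
    finally show ?case .
  qed simp
  from this[of "[]" xs ys] assms(2,3) show ?thesis by (simp only: append_Nil)
qed

lemma ex_list_with_counts: "\<exists>ss. \<forall>s::'s::finite. count_list ss s = f s"
proof -
  define M where "M = Abs_multiset f"
  have M: "count M s = f s" for s
    by (simp add: M_def count_Abs_multiset)
  obtain ss where "mset ss = M" by (metis ex_mset)
  then show ?thesis by (intro exI[of _ ss]) (auto simp: M simp flip: count_mset)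
qed

section \<open>The orbit ideal of a formal Lie algebra\<close>

locale formal_lie_algebra =
  fixes H :: "('s::finite \<Rightarrow> ('s, complex) mfps) set"
  assumes H_zero: "(\<lambda>s. 0) \<in> H"
    and H_add: "X \<in> H \<Longrightarrow> Y \<in> H \<Longrightarrow> (\<lambda>s. X s + Y s) \<in> H"
    and H_scale: "X \<in> H \<Longrightarrow> (\<lambda>s. mfps_const c * X s) \<in> H"
    and H_bracket: "X \<in> H \<Longrightarrow> Y \<in> H \<Longrightarrow> formal_bracket X Y \<in> H"
begin

text \<open>The empty word counts, so members have zero constant term; this is what starts the chain
  of Segre points.\<close>

definition orbit_ideal :: "('s, complex) mfps set" where
  "orbit_ideal = {h. \<forall>Xs. set Xs \<subseteq> H \<longrightarrow> formal_word Xs h = 0}"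

lemma orbit_ideal_formal_apply: "h \<in> orbit_ideal \<Longrightarrow> X \<in> H \<Longrightarrow> formal_apply X h \<in> orbit_ideal"
  unfolding orbit_ideal_def
proof safe
  fix Xs assume h: "\<forall>Xs. set Xs \<subseteq> H \<longrightarrow> formal_word Xs h = 0" "X \<in> H" "set Xs \<subseteq> H"
  then have "formal_word (Xs @ [X]) h = 0" by auto
  then show "formal_word Xs (formal_apply X h) = 0" by (simp add: formal_word_append)
qed

definition words_vanish :: "nat \<Rightarrow> ('s, complex) mfps \<Rightarrow> bool" where
  "words_vanish k f \<longleftrightarrow> (\<forall>Xs. set Xs \<subseteq> H \<longrightarrow> length Xs < k \<longrightarrow> formal_word Xs f = 0)"

text \<open>Exchanging two neighbours changes the word by one in which their bracket replaces both.
  The bracket lies in \<open>H\<close> and that word is shorter than \<open>k\<close>, so it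
  vanishes on \<open>f\<close>.\<close>

lemma formal_word_permute:
  assumes "words_vanish k f" "set Xs \<subseteq> H" "length Xs = k" "mset Xs = mset Ys"
  shows "formal_word Xs f = formal_word Ys f"
proof (rule swap_invariant_imp_mset_invariant[where \<phi> = "\<lambda>Xs. formal_word Xs f" and M = "mset Xs"])
  fix As X Y Bs assume m: "mset (As @ X # Y # Bs) = mset Xs"
  have "set (As @ X # Y # Bs) \<subseteq> H" using m assms(2) by (metis set_mset_mset)
  moreover have "length (As @ X # Y # Bs) = k" using m assms(3) by (metis size_mset)
  ultimately have "formal_word (As @ formal_bracket X Y # Bs) f = 0"
    using assms(1) unfolding words_vanish_def by (auto simp: H_bracket)
  then show "formal_word (As @ X # Y # Bs) f = formal_word (As @ Y # X # Bs) f"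
    by (simp add: formal_word_formal_bracket[of As X Y])
qed (use assms in auto)

end

text \<open>The indeterminates in \<open>Zs\<close> are the \<open>Z\<close>-coordinates. The \<open>Z\<close>-parts of the values of \<open>H\<close> at the
  origin form a graph over the coordinates in \<open>U\<close>, and \<open>E\<close> lifts the coordinate vectors.\<close>

locale graded_lie_algebra = formal_lie_algebra H for H :: "('s::finite \<Rightarrow> ('s, complex) mfps) set" +
  fixes Zs U :: "'s set" and E :: "'s \<Rightarrow> 's \<Rightarrow> ('s, complex) mfps"
  assumes U: "U \<subseteq> Zs"
    and E: "i \<in> U \<Longrightarrow> E i \<in> H"
    and E_const: "i \<in> U \<Longrightarrow> s \<in> U \<Longrightarrow> mfps_const_coeff (E i s) = (if s = i then 1 else 0)"
    and decomp: "X \<in> H \<Longrightarrow> \<exists>c X0 K. X0 \<in> H \<and> (\<forall>s. mfps_const_coeff (X0 s) = 0) \<and>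
        K \<in> H \<and> (\<forall>s\<in>Zs. K s = 0) \<and> X = (\<lambda>s. X0 s + (\<Sum>i\<in>U. mfps_const (c i) * E i s) + K s)"
begin

lemma formal_apply_vars_in:
  assumes "mfps_vars_in Zs f" "\<forall>s\<in>Zs. K s = 0"
  shows "formal_apply K f = 0"
proof -
  have "mfps_pderiv s f = 0" if "s \<notin> Zs" for s
  proof (rule mfps_eqI)
    fix m :: "'s \<Rightarrow>\<^sub>0 nat"
    have "s \<in> Poly_Mapping.keys (m + Poly_Mapping.single s 1)" by (simp add: in_keys_iff lookup_add)
    then have "mfps_coeff f (m + Poly_Mapping.single s 1) = 0"
      using assms(1) that by (auto simp: mfps_vars_in_def)
    then show "mfps_coeff (mfps_pderiv s f) m = mfps_coeff 0 m" by (simp add: mfps_coeff_pderiv)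
  qed
  then have "K s * mfps_pderiv s f = 0" for s
    using assms(2) by (cases "s \<in> Zs") auto
  then show ?thesis by (simp add: formal_apply_def)
qed

text \<open>Arbitrary fields are traded for the \<open>E i\<close> one by one from the left. The
  head is decomposed: its part vanishing at the origin contributes 0 because the head acts last; its
  part without Z-components moves to the far right, where it kills a series in the Z-indeterminates;
  its \<open>E i\<close>-part moves behind the remaining fields.\<close>

lemma words_vanish_step:
  assumes f: "words_vanish k f" "mfps_vars_in Zs f"
    and E0: "\<And>is. set is \<subseteq> U \<Longrightarrow> length is = k \<Longrightarrow> formal_word (map E is) f = 0"
  shows "words_vanish (Suc k) f"
proof -
  have "formal_word (Xs @ map E is) f = 0" if "set Xs \<subseteq> H" "set is \<subseteq> U" "length Xs + length is = k" for Xs "is"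
    using that
  proof (induction Xs arbitrary: "is")
    case Nil
    then show ?case by (simp add: E0)
  next
    case (Cons X Xs)
    obtain c X0 K where X0: "X0 \<in> H" "\<And>s. mfps_const_coeff (X0 s) = 0"
      and K: "K \<in> H" "\<forall>s\<in>Zs. K s = 0"
      and X: "X = (\<lambda>s. X0 s + (\<Sum>i\<in>U. mfps_const (c i) * E i s) + K s)"
      using decomp[of X] Cons.prems(1) by auto
    let ?h = "foldr formal_apply (Xs @ map E is) f"
    have E_H: "E ` set is \<subseteq> H" using Cons.prems E by auto
    have "formal_apply X ?h = formal_apply X0 ?h + (\<Sum>i\<in>U. mfps_const (c i) * formal_apply (E i) ?h) + formal_apply K ?h"
      unfolding X formal_apply_field_add formal_apply_field_sum formal_apply_field_scale ..
    moreover have "mfps_const_coeff (formal_apply X0 ?h) = 0"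
      by (simp add: formal_apply_def X0)
    moreover have "mfps_const_coeff (formal_apply K ?h) = 0"
    proof -
      have "formal_word (K # Xs @ map E is) f = formal_word (Xs @ map E is @ [K]) f"
        by (rule formal_word_permute[OF f(1)]) (use Cons.prems K E_H in auto)
      also have "\<dots> = 0"
        by (simp add: formal_word_append formal_apply_vars_in[OF f(2) K(2)] formal_word_def)
      finally show ?thesis by (simp add: formal_word_def)
    qed
    moreover have "mfps_const_coeff (formal_apply (E i) ?h) = 0" if "i \<in> U" for i
    proof -
      have "formal_word (E i # Xs @ map E is) f = formal_word (Xs @ map E (i # is)) f"
        by (rule formal_word_permute[OF f(1)]) (use Cons.prems E_H E that in auto)
      also have "\<dots> = 0"
        by (rule Cons.IH) (use Cons.prems that in auto)
      finally show ?thesis by (simp add: formal_word_def)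
    qed
    ultimately show ?case by (simp add: formal_word_def)
  qed
  from this[of _ "[]"] f(1) show ?thesis
    unfolding words_vanish_def by (auto simp: less_Suc_eq)
qed

text \<open>The leading part of \<open>p\<close> has degree \<open>length is\<close>, so whatever
  gains an order is invisible to the word. \<open>E i\<close> differs from the partial derivative in
  direction \<open>i\<close> by coefficients that vanish at the origin in the directions of
  \<open>U\<close>; in the other directions the derivative of \<open>p\<close> has no leading
  part.\<close>

lemma formal_word_leading:
  assumes "set is \<subseteq> U" "p \<in> vanish (length is)"
    and "\<And>m. mdeg m = length is \<Longrightarrow> mfps_coeff p m \<noteq> 0 \<Longrightarrow> Poly_Mapping.keys m \<subseteq> U"
  shows "formal_word (map E is) p = mfps_const_coeff (foldr mfps_pderiv is p)"
  using assms
proof (induction "is" arbitrary: p rule: rev_induct)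
  case (snoc i "is")
  let ?k = "length is"
  have diff: "formal_apply (E i) p - mfps_pderiv i p \<in> vanish (Suc ?k)"
  proof -
    have "formal_apply (E i) p - mfps_pderiv i p = (\<Sum>s\<in>UNIV. (E i s - (if s = i then 1 else 0)) * mfps_pderiv s p)"
      by (simp add: formal_apply_def left_diff_distrib sum_subtractf) (simp add: if_distrib[of "\<lambda>x. x * _"] cong: if_cong)
    also have "\<dots> \<in> vanish (Suc ?k)"
    proof (rule vanish_sum)
      fix s
      have p: "mfps_pderiv s p \<in> vanish ?k"
        using snoc.prems(2) by (auto intro: vanish_pderiv)
      show "(E i s - (if s = i then 1 else 0)) * mfps_pderiv s p \<in> vanish (Suc ?k)"
      proof (cases "s \<in> U")
        case True
        then have "E i s - (if s = i then 1 else 0) \<in> vanish 1"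
          using E_const[of i s] snoc.prems(1) by (auto simp: vanish_1_iff mfps_coeff_one)
        from vanish_mult[OF this p] show ?thesis by simp
      next
        case False
        have "mfps_pderiv s p \<in> vanish (Suc ?k)"
          unfolding vanish_def
        proof safe
          fix m :: "'s \<Rightarrow>\<^sub>0 nat" assume m: "mdeg m < Suc ?k"
          show "mfps_coeff (mfps_pderiv s p) m = 0"
          proof (cases "mdeg m = ?k")
            case True
            have "s \<in> Poly_Mapping.keys (m + Poly_Mapping.single s 1)" by (simp add: in_keys_iff lookup_add)
            with snoc.prems(3)[of "m + Poly_Mapping.single s 1"] True \<open>s \<notin> U\<close>
            have "mfps_coeff p (m + Poly_Mapping.single s 1) = 0" by auto
            then show ?thesis by (simp add: mfps_coeff_pderiv)
          next
            case False
            with p m show ?thesis by (auto simp: vanish_def)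
          qed
        qed
        then show ?thesis by (rule vanish_mult_left)
      qed
    qed
    finally show ?thesis .
  qed
  have "formal_word (map E (is @ [i])) p = formal_word (map E is) (mfps_pderiv i p + (formal_apply (E i) p - mfps_pderiv i p))"
    by (simp add: formal_word_append)
  also have "\<dots> = formal_word (map E is) (mfps_pderiv i p)"
    unfolding formal_word_add using formal_word_vanish[OF diff] by simp
  also have "\<dots> = mfps_const_coeff (foldr mfps_pderiv is (mfps_pderiv i p))"
  proof (rule snoc.IH)
    show "mfps_pderiv i p \<in> vanish ?k"
      using snoc.prems(2) by (auto intro: vanish_pderiv)
    fix m :: "'s \<Rightarrow>\<^sub>0 nat" assume m: "mdeg m = ?k" "mfps_coeff (mfps_pderiv i p) m \<noteq> 0"
    then have "Poly_Mapping.keys (m + Poly_Mapping.single i 1) \<subseteq> U"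
      using snoc.prems(3)[of "m + Poly_Mapping.single i 1"] by (auto simp: mfps_coeff_pderiv)
    then show "Poly_Mapping.keys m \<subseteq> U"
      by (auto simp: in_keys_iff lookup_add subset_eq)
  qed (use snoc.prems in auto)
  finally show ?case by simp
qed (simp add: formal_word_def)

end

section \<open>Coefficients as iterated partial derivatives\<close>

lemma count_list_eq_mset: "(\<forall>s. count_list xs s = count_list ys s) \<longleftrightarrow> mset xs = mset ys"
  by (simp add: multiset_eq_iff count_mset)

definition list_exponent :: "'s::finite list \<Rightarrow> ('s \<Rightarrow>\<^sub>0 nat)" where
  "list_exponent ss = Abs_poly_mapping (count_list ss)"

lemma lookup_list_exponent [simp]: "Poly_Mapping.lookup (list_exponent ss) = count_list ss"
  by (simp add: list_exponent_def)

lemma list_exponent_Nil [simp]: "list_exponent [] = 0"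
  by (rule poly_mapping_eqI) simp

lemma list_exponent_Cons: "list_exponent (i # is) = Poly_Mapping.single i 1 + list_exponent is"
  by (rule poly_mapping_eqI) (auto simp: lookup_add lookup_single)

lemma mdeg_list_exponent [simp]: "mdeg (list_exponent ss) = length ss"
  by (induction ss) (simp_all add: list_exponent_Cons)

lemma keys_list_exponent [simp]: "Poly_Mapping.keys (list_exponent ss) = set ss"
  by (auto simp: in_keys_iff count_list_0_iff)

definition mfact :: "('s::finite \<Rightarrow>\<^sub>0 nat) \<Rightarrow> complex" where
  "mfact m = (\<Prod>s\<in>UNIV. fact (Poly_Mapping.lookup m s))"

lemma mfact_nonzero [simp]: "mfact m \<noteq> 0"
  by (simp add: mfact_def)

lemma mfact_add_single:
  "mfact (m + Poly_Mapping.single i 1) = of_nat (Poly_Mapping.lookup m i + 1) * mfact m"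
proof -
  have "mfact (m + Poly_Mapping.single i 1) =
      (\<Prod>s\<in>UNIV. (if s = i then of_nat (Poly_Mapping.lookup m i + 1) else 1) * fact (Poly_Mapping.lookup m s))"
    unfolding mfact_def by (intro prod.cong) (auto simp: lookup_add lookup_single)
  then show ?thesis by (simp add: prod.distrib mfact_def)
qed

text \<open>Weighting a coefficient by its factorial turns differentiation into a pure shift of the
  exponent.\<close>

lemma foldr_pderiv_coeff:
  "mfact m * mfps_coeff (foldr mfps_pderiv is p) m = mfact (list_exponent is + m) * mfps_coeff p (list_exponent is + m)"
proof (induction "is" arbitrary: m)
  case (Cons i "is")
  have "mfact m * mfps_coeff (foldr mfps_pderiv (i # is) p) m =
     mfact (m + Poly_Mapping.single i 1) * mfps_coeff (foldr mfps_pderiv is p) (m + Poly_Mapping.single i 1)"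
    unfolding mfact_add_single by (simp add: mfps_coeff_pderiv)
  also have "\<dots> = mfact (list_exponent (i # is) + m) * mfps_coeff p (list_exponent (i # is) + m)"
    unfolding Cons.IH by (simp add: list_exponent_Cons add_ac)
  finally show ?case .
qed simp

lemma const_coeff_foldr_pderiv:
  "mfps_const_coeff (foldr mfps_pderiv is p) = mfact (list_exponent is) * mfps_coeff p (list_exponent is)"
  using foldr_pderiv_coeff[of 0 "is" p] by (simp add: mfact_def)

context graded_lie_algebra
begin

text \<open>Each correction is a homogeneous polynomial in the \<open>U\<close>-indeterminates. On
  words of its own degree in the \<open>E i\<close> it acts by plain partial derivatives, so its
  coefficients can be chosen to cancel all of these words, while shorter words do not see
  it.\<close>

lemma ex_orbit_ideal_element:
  assumes b: "b \<in> Zs - U"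
  shows "\<exists>f\<in>orbit_ideal. mfps_coeff f (Poly_Mapping.single b 1) = 1 \<and>
    (\<forall>m. mfps_coeff f m \<noteq> 0 \<longrightarrow> m = Poly_Mapping.single b 1 \<or> Poly_Mapping.keys m \<subseteq> U)"
proof -
  let ?b = "Poly_Mapping.single b (1::nat)"
  define good where "good k f \<longleftrightarrow> words_vanish (Suc k) f \<and> mfps_coeff f ?b = 1 \<and>
    (\<forall>m. mfps_coeff f m \<noteq> 0 \<longrightarrow> m = ?b \<or> Poly_Mapping.keys m \<subseteq> U)" for k f
  have vars: "mfps_vars_in Zs f" if "good k f" for k f
    unfolding mfps_vars_in_def
  proof (intro allI impI)
    fix m assume "mfps_coeff f m \<noteq> 0"
    then have "m = ?b \<or> Poly_Mapping.keys m \<subseteq> U" using that by (simp add: good_def)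
    then show "Poly_Mapping.keys m \<subseteq> Zs" using U b by auto
  qed
  have [simp]: "Poly_Mapping.single b (Suc 0) \<noteq> 0"
    by (metis mdeg_eq_0 mdeg_single old.nat.distinct(2))
  have "good 0 (mfps_var b)"
    by (auto simp: good_def words_vanish_def formal_word_def mfps_coeff_var split: if_splits)
  moreover have "\<exists>g. good (Suc k) g \<and> g - f \<in> vanish (Suc k)" if f: "good k f" for k f
  proof -
    \<comment> \<open>One ordering of directions per monomial. The word in the \<open>E i\<close>
      does not depend on the ordering, since all shorter words vanish on \<open>f\<close>, so the
      coefficient chosen in \<open>p\<close> is right for every ordering.\<close>
    define L where "L m = (SOME is. \<forall>s. count_list is s = Poly_Mapping.lookup m s)" for m :: "'s \<Rightarrow>\<^sub>0 nat"
    have L: "count_list (L m) s = Poly_Mapping.lookup m s" for m s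
      unfolding L_def by (rule someI2_ex[OF ex_list_with_counts]) auto
    define p where "p = Abs_mfps (\<lambda>m. if mdeg m = Suc k \<and> Poly_Mapping.keys m \<subseteq> U
        then - formal_word (map E (L m)) f / mfact m else 0)"
    have p: "p \<in> vanish (Suc k)" by (auto simp: p_def vanish_def)
    have keys: "Poly_Mapping.keys m \<subseteq> U" if "mfps_coeff p m \<noteq> 0" for m
      using that by (auto simp: p_def split: if_splits)
    have wv: "words_vanish (Suc k) (f + p)"
      using f formal_word_vanish[OF p] by (auto simp: good_def words_vanish_def formal_word_add)
    have "formal_word (map E is) (f + p) = 0" if "is": "set is \<subseteq> U" "length is = Suc k" for "is"
    proof -
      have "mset is = mset (L (list_exponent is))"
        by (simp add: L flip: count_list_eq_mset)
      then have *: "mset (map E is) = mset (map E (L (list_exponent is)))"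
        by simp
      have "formal_word (map E is) f = formal_word (map E (L (list_exponent is))) f"
        by (rule formal_word_permute[of "Suc k"]) (use * f E "is" in \<open>auto simp: good_def\<close>)
      moreover have "formal_word (map E is) p = mfps_const_coeff (foldr mfps_pderiv is p)"
        by (rule formal_word_leading) (use "is" p keys in auto)
      ultimately show ?thesis
        using "is" by (simp add: formal_word_add const_coeff_foldr_pderiv p_def)
    qed
    moreover have "mfps_vars_in Zs (f + p)"
      unfolding mfps_vars_in_def
    proof (intro allI impI)
      fix m assume "mfps_coeff (f + p) m \<noteq> 0"
      then have "mfps_coeff f m \<noteq> 0 \<or> mfps_coeff p m \<noteq> 0" by auto
      then show "Poly_Mapping.keys m \<subseteq> Zs"
        using vars[OF f] keys U unfolding mfps_vars_in_def by blast
    qed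
    ultimately have "words_vanish (Suc (Suc k)) (f + p)"
      by (intro words_vanish_step wv)
    \<comment> \<open>Since \<open>b\<close> is not in \<open>U\<close>, the correction leaves the
      coefficient 1 of the indeterminate \<open>b\<close> untouched.\<close>
    moreover have "mfps_coeff p ?b = 0" using keys[of ?b] b by auto
    ultimately have "good (Suc k) (f + p)"
      using f keys unfolding good_def by (metis add.right_neutral add_0 mfps_coeff_add)
    then show ?thesis using p by (intro exI[of _ "f + p"]) simp
  qed
  ultimately have "\<exists>F. \<forall>k. good k (F k) \<and> F (Suc k) - F k \<in> vanish (Suc k)"
    by (intro dependent_nat_choice) auto
  then obtain F where F: "\<And>k. good k (F k)" and step: "\<And>k. F (Suc k) - F k \<in> vanish (Suc k)"
    by blast
  \<comment> \<open>Coefficientwise limit: corrections made after stage \<open>k\<close> have order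
    above \<open>k\<close>, so the coefficients of degree at most \<open>k\<close> are final in
    \<open>F k\<close>.\<close>
  define f where "f = Abs_mfps (\<lambda>m. mfps_coeff (F (mdeg m)) m)"
  have "F (k + j) - F k \<in> vanish (Suc k)" for k j
  proof (induction j)
    case (Suc j)
    have "F (Suc (k + j)) - F (k + j) \<in> vanish (Suc k)"
      using step[of "k + j"] by (rule vanish_mono) simp
    from vanish_add[OF this Suc] show ?case by simp
  qed simp
  then have "f - F k \<in> vanish (Suc k)" for k
    unfolding vanish_def f_def
  proof safe
    fix m :: "'s \<Rightarrow>\<^sub>0 nat" assume *: "\<And>k j. F (k + j) - F k \<in> {f. \<forall>m. mdeg m < Suc k \<longrightarrow> mfps_coeff f m = 0}" "mdeg m < Suc k"
    from *(1)[of "mdeg m" "k - mdeg m"] *(2)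
    show "mfps_coeff (Abs_mfps (\<lambda>m. mfps_coeff (F (mdeg m)) m) - F k) m = 0" by auto
  qed
  then have wf: "formal_word Xs f = formal_word Xs (F (length Xs))" for Xs
    using formal_word_vanish[of "f - F (length Xs)" "length Xs" Xs] formal_word_add[of Xs "F (length Xs)" "f - F (length Xs)"]
    by simp
  have "f \<in> orbit_ideal"
    using F by (auto simp: orbit_ideal_def wf good_def words_vanish_def)
  then show ?thesis
    using F by (intro bexI[of _ f]) (auto simp: f_def good_def)
qed

end

section \<open>Homomorphisms modulo a power of the maximal ideal\<close>

text \<open>Abstract form of a substitution that is known only up to order \<open>K\<close>.
  Additivity and constants are preserved exactly; multiplicativity alone is relaxed, because
  truncating an exponential series spoils only products.\<close>

definition approx_hom :: "nat \<Rightarrow> (('s::finite, complex) mfps \<Rightarrow> ('y, complex) mfps) \<Rightarrow> bool" where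
  "approx_hom K P \<longleftrightarrow> (\<forall>f g. P (f + g) = P f + P g) \<and> (\<forall>c. P (mfps_const c) = mfps_const c) \<and>
     (\<forall>f g. P (f * g) - P f * P g \<in> vanish K) \<and> (\<forall>s. P (mfps_var s) \<in> vanish 1)"

lemma approx_hom_add: "approx_hom K P \<Longrightarrow> P (f + g) = P f + P g"
  and approx_hom_const: "approx_hom K P \<Longrightarrow> P (mfps_const c) = mfps_const c"
  and approx_hom_mult: "approx_hom K P \<Longrightarrow> P (f * g) - P f * P g \<in> vanish K"
  and approx_hom_var: "approx_hom K P \<Longrightarrow> P (mfps_var s) \<in> vanish (Suc 0)"
  by (simp_all add: approx_hom_def)

lemma approx_hom_zero: "approx_hom K P \<Longrightarrow> P 0 = 0"
  using approx_hom_const[of K P 0] by simp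

lemma approx_hom_sum: "approx_hom K P \<Longrightarrow> P (sum F A) = (\<Sum>i\<in>A. P (F i))"
  by (induction A rule: infinite_finite_induct) (auto simp: approx_hom_zero approx_hom_add)

lemma approx_hom_minus_const: "approx_hom K P \<Longrightarrow> P (f - mfps_const c) = P f - mfps_const c"
  using approx_hom_add[of K P "f - mfps_const c" "mfps_const c"] by (simp add: approx_hom_const)

text \<open>Each nonconstant monomial is charged to one of its indeterminates, selected by
  \<open>\<sigma>\<close>, so that it is counted once. The decomposition reduces statements about
  all series to the indeterminates.\<close>

lemma mfps_decompose:
  fixes h :: "('s::finite, complex) mfps"
  obtains g where "h = mfps_const (mfps_const_coeff h) + (\<Sum>s\<in>UNIV. mfps_var s * g s)"
    and "\<And>s. mfps_const_coeff (g s) = mfps_coeff h (Poly_Mapping.single s 1)"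
proof -
  define \<sigma> where "\<sigma> m = (SOME s. s \<in> Poly_Mapping.keys m)" for m :: "'s \<Rightarrow>\<^sub>0 nat"
  have \<sigma>: "\<sigma> m \<in> Poly_Mapping.keys m" if "m \<noteq> 0" for m
    unfolding \<sigma>_def by (rule someI_ex) (use that in \<open>auto simp: ex_in_conv\<close>)
  define g where "g s = Abs_mfps (\<lambda>m. if \<sigma> (m + Poly_Mapping.single s 1) = s
      then mfps_coeff h (m + Poly_Mapping.single s 1) else 0)" for s
  show ?thesis
  proof (rule that[of g])
    fix s
    have "(Poly_Mapping.single s 1 :: 's \<Rightarrow>\<^sub>0 nat) \<noteq> 0" by (metis mdeg_eq_0 mdeg_single zero_neq_one)
    from \<sigma>[OF this] show "mfps_const_coeff (g s) = mfps_coeff h (Poly_Mapping.single s 1)"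
      by (simp add: g_def)
  next
    show "h = mfps_const (mfps_const_coeff h) + (\<Sum>s\<in>UNIV. mfps_var s * g s)"
    proof (rule mfps_eqI)
      fix m :: "'s \<Rightarrow>\<^sub>0 nat"
      have "mfps_coeff (mfps_var s * g s) m = (if s = \<sigma> m \<and> m \<noteq> 0 then mfps_coeff h m else 0)" for s
      proof (cases "Poly_Mapping.lookup m s = 0")
        case True
        then have "\<not> (s = \<sigma> m \<and> m \<noteq> 0)" using \<sigma>[of m] unfolding in_keys_iff by blast
        with True show ?thesis by (auto simp: mfps_coeff_var_mult)
      next
        case False
        then have "m - Poly_Mapping.single s 1 + Poly_Mapping.single s 1 = m"
          by (auto simp: poly_mapping_eq_iff fun_eq_iff lookup_add lookup_minus lookup_single when_def)
        with False show ?thesis by (auto simp: mfps_coeff_var_mult g_def)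
      qed
      then show "mfps_coeff h m = mfps_coeff (mfps_const (mfps_const_coeff h) + (\<Sum>s\<in>UNIV. mfps_var s * g s)) m"
        by (cases "m = 0") (auto simp: mfps_coeff_const)
    qed
  qed
qed

lemma approx_hom_decompose:
  assumes P: "approx_hom K P" and h: "h = mfps_const c + (\<Sum>s\<in>UNIV. mfps_var s * g s)"
  shows "P h - (mfps_const c + (\<Sum>s\<in>UNIV. P (mfps_var s) * P (g s))) \<in> vanish K"
proof -
  have "P h - (mfps_const c + (\<Sum>s\<in>UNIV. P (mfps_var s) * P (g s)))
      = (\<Sum>s\<in>UNIV. P (mfps_var s * g s) - P (mfps_var s) * P (g s))"
    by (subst h) (simp add: approx_hom_add[OF P] approx_hom_const[OF P] approx_hom_sum[OF P] sum_subtractf)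
  also have "\<dots> \<in> vanish K"
    by (intro vanish_sum approx_hom_mult[OF P])
  finally show ?thesis .
qed

lemma approx_hom_vanish_1:
  assumes P: "approx_hom K P" "1 \<le> K" and h: "mfps_const_coeff h = 0"
  shows "P h \<in> vanish (Suc 0)"
proof -
  obtain g where g: "h = mfps_const 0 + (\<Sum>s\<in>UNIV. mfps_var s * g s)"
    using mfps_decompose[of h] h by metis
  have "P h - (\<Sum>s\<in>UNIV. P (mfps_var s) * P (g s)) \<in> vanish (Suc 0)"
    using approx_hom_decompose[OF P(1) g] P(2) by (simp add: vanish_mono)
  moreover have "(\<Sum>s\<in>UNIV. P (mfps_var s) * P (g s)) \<in> vanish (Suc 0)"
    by (intro vanish_sum vanish_mult_right approx_hom_var[OF P(1)])
  ultimately show ?thesis using vanish_add by fastforce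
qed

text \<open>By \<open>mfps_decompose\<close> the difference on \<open>h\<close> consists of two
  kinds of terms: the image of an indeterminate times a difference controlled by induction, where
  the image supplies the missing order, and a multiple of the difference on an indeterminate.
  Continuity in the series thus follows from approximate multiplicativity.\<close>

lemma approx_hom_diff:
  assumes P: "approx_hom K P" and Q: "approx_hom K Q"
    and d: "\<And>s. P (mfps_var s) - Q (mfps_var s) \<in> vanish k" and "j \<le> k" "k \<le> K"
  shows "P h - Q h \<in> vanish j"
  using \<open>j \<le> k\<close>
proof (induction j arbitrary: h)
  case (Suc j)
  obtain c g where g: "h = mfps_const c + (\<Sum>s\<in>UNIV. mfps_var s * g s)"
    using mfps_decompose[of h] by metis
  let ?S = "\<lambda>P. mfps_const c + (\<Sum>s\<in>UNIV. P (mfps_var s) * P (g s))"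
  have "P h - ?S P \<in> vanish (Suc j)" "Q h - ?S Q \<in> vanish (Suc j)"
    using approx_hom_decompose[OF P g] approx_hom_decompose[OF Q g] Suc.prems \<open>k \<le> K\<close>
    by (auto intro: vanish_mono)
  from vanish_diff[OF this] have 1: "(P h - ?S P) - (Q h - ?S Q) \<in> vanish (Suc j)" .
  have "?S P - ?S Q = (\<Sum>s\<in>UNIV. P (mfps_var s) * (P (g s) - Q (g s))
      + (P (mfps_var s) - Q (mfps_var s)) * Q (g s))"
    by (simp add: algebra_simps sum.distrib sum_subtractf)
  also have "\<dots> \<in> vanish (Suc j)"
  proof (intro vanish_sum vanish_add)
    fix s
    have "P (g s) - Q (g s) \<in> vanish j" using Suc by simp
    from vanish_mult[OF approx_hom_var[OF P, of s] this]
    show "P (mfps_var s) * (P (g s) - Q (g s)) \<in> vanish (Suc j)" by simp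
    show "(P (mfps_var s) - Q (mfps_var s)) * Q (g s) \<in> vanish (Suc j)"
      by (intro vanish_mult_right vanish_mono[OF d Suc.prems])
  qed
  finally have "?S P - ?S Q \<in> vanish (Suc j)" .
  from vanish_add[OF 1 this] show ?case by simp
qed simp

lemma approx_hom_eq:
  assumes "\<And>K. approx_hom K P" "\<And>K. approx_hom K Q" "\<And>s. P (mfps_var s) = Q (mfps_var s)"
  shows "P h = Q h"
proof -
  have "P h - Q h \<in> vanish k" for k
    by (rule approx_hom_diff[of k _ _ k]) (use assms in auto)
  from vanish_all[OF this] show ?thesis by simp
qed

text \<open>A first-order Taylor formula at the origin, used to linearise the equations of a leaf.
  Freezing each cofactor \<open>g s\<close> at its constant term costs nothing below order
  \<open>k + 1\<close>, since the remainder maps to a series without constant term.\<close>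

lemma approx_hom_diff_linear:
  assumes P: "approx_hom K P" and Q: "approx_hom K Q"
    and d: "\<And>s. P (mfps_var s) - Q (mfps_var s) \<in> vanish k" and k: "k < K"
  shows "P h - Q h - (\<Sum>s\<in>UNIV. mfps_const (mfps_coeff h (Poly_Mapping.single s 1)) * (P (mfps_var s) - Q (mfps_var s)))
    \<in> vanish (Suc k)"
proof -
  obtain c g where g: "h = mfps_const c + (\<Sum>s\<in>UNIV. mfps_var s * g s)"
      and g0: "\<And>s. mfps_const_coeff (g s) = mfps_coeff h (Poly_Mapping.single s 1)"
    using mfps_decompose[of h] by metis
  let ?c = "\<lambda>s. mfps_const (mfps_coeff h (Poly_Mapping.single s 1))"
  let ?S = "\<lambda>P. mfps_const c + (\<Sum>s\<in>UNIV. P (mfps_var s) * P (g s))"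
  have "P h - ?S P \<in> vanish (Suc k)" "Q h - ?S Q \<in> vanish (Suc k)"
    using approx_hom_decompose[OF P g] approx_hom_decompose[OF Q g] k
    by (auto intro: vanish_mono)
  from vanish_diff[OF this] have 1: "(P h - ?S P) - (Q h - ?S Q) \<in> vanish (Suc k)" .
  have "?S P - ?S Q - (\<Sum>s\<in>UNIV. ?c s * (P (mfps_var s) - Q (mfps_var s)))
      = (\<Sum>s\<in>UNIV. P (mfps_var s) * (P (g s) - Q (g s))
      + (P (mfps_var s) - Q (mfps_var s)) * (Q (g s) - ?c s))"
    by (simp add: algebra_simps sum.distrib sum_subtractf)
  also have "\<dots> \<in> vanish (Suc k)"
  proof (intro vanish_sum vanish_add)
    fix s
    have "P (g s) - Q (g s) \<in> vanish k"
      by (rule approx_hom_diff[OF P Q d]) (use k in auto)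
    from vanish_mult[OF approx_hom_var[OF P, of s] this]
    show "P (mfps_var s) * (P (g s) - Q (g s)) \<in> vanish (Suc k)" by simp
    have "Q (g s - ?c s) \<in> vanish (Suc 0)"
      by (rule approx_hom_vanish_1[OF Q]) (use k g0 in \<open>auto simp: mfps_coeff_const\<close>)
    then have "Q (g s) - ?c s \<in> vanish (Suc 0)"
      by (simp add: approx_hom_minus_const[OF Q])
    from vanish_mult[OF d[of s] this]
    show "(P (mfps_var s) - Q (mfps_var s)) * (Q (g s) - ?c s) \<in> vanish (Suc k)"
      by simp
  qed
  finally have "?S P - ?S Q - (\<Sum>s\<in>UNIV. ?c s * (P (mfps_var s) - Q (mfps_var s))) \<in> vanish (Suc k)" .
  from vanish_add[OF 1 this] show ?thesis by (simp add: algebra_simps)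
qed

section \<open>Truncated flows of formal vector fields\<close>

definition divided_apply :: "('s::finite \<Rightarrow> ('s, complex) mfps) \<Rightarrow> nat \<Rightarrow> ('s, complex) mfps \<Rightarrow> ('s, complex) mfps" where
  "divided_apply X n h = mfps_const (1 / fact n) * (formal_apply X ^^ n) h"

lemma divided_apply_0 [simp]: "divided_apply X 0 h = h"
  by (simp add: divided_apply_def)

lemma formal_apply_divided_apply: "formal_apply X (divided_apply X n h) = mfps_const (of_nat (Suc n)) * divided_apply X (Suc n) h"
proof -
  have "(1 :: complex) / fact n = of_nat (Suc n) * (1 / fact (Suc n))"
    by (simp add: field_simps del: of_nat_Suc)
  then show ?thesis
    unfolding divided_apply_def formal_apply_const_mult funpow.simps o_apply
    by (simp only: mfps_const_mult mult.assoc)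
qed

lemma divided_apply_add: "divided_apply X n (f + g) = divided_apply X n f + divided_apply X n g"
proof -
  have "(formal_apply X ^^ n) (f + g) = (formal_apply X ^^ n) f + (formal_apply X ^^ n) g"
    by (induction n) (auto simp: formal_apply_add)
  then show ?thesis by (simp add: divided_apply_def distrib_left)
qed

lemma divided_apply_Suc_eq_0: "formal_apply X h = 0 \<Longrightarrow> divided_apply X (Suc n) h = 0"
proof -
  assume "formal_apply X h = 0"
  then have "(formal_apply X ^^ Suc n) h = 0" by (induction n) auto
  then show ?thesis by (simp add: divided_apply_def)
qed

lemma mfps_const_of_nat_cancel:
  fixes A B :: "('x, complex) mfps"
  assumes "mfps_const (of_nat (Suc n)) * A = mfps_const (of_nat (Suc n)) * B"
  shows "A = B"
proof (rule mfps_eqI)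
  fix m
  from assms have "of_nat (Suc n) * mfps_coeff A m = of_nat (Suc n) * mfps_coeff B m"
    by (metis mfps_coeff_const_mult)
  then show "mfps_coeff A m = mfps_coeff B m" by (simp del: of_nat_Suc)
qed

text \<open>The operators \<open>divided_apply X n\<close> are the coefficients of exp(tX), and the
  factor 1/n! turns the Leibniz rule into a plain convolution. In the inductive step one more
  application of \<open>X\<close> produces the weight \<open>n + 1\<close>, which is split as
  \<open>i\<close> plus \<open>n + 1 - i\<close> and cancelled at the end.\<close>

lemma divided_apply_mult:
  "divided_apply X n (f * g) = (\<Sum>i\<le>n. divided_apply X i f * divided_apply X (n - i) g)"
proof (induction n)
  case (Suc n)
  let ?D = "divided_apply X" and ?c = "\<lambda>n. mfps_const (of_nat n) :: ('a, complex) mfps"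
  have sum: "formal_apply X (sum F A) = (\<Sum>i\<in>A. formal_apply X (F i))" for F :: "nat \<Rightarrow> ('a, complex) mfps" and A
    by (induction A rule: infinite_finite_induct) (auto simp: formal_apply_add)
  have "?c (Suc n) * ?D (Suc n) (f * g) = formal_apply X (?D n (f * g))"
    by (simp add: formal_apply_divided_apply)
  also have "\<dots> = (\<Sum>i\<le>n. ?c (Suc i) * (?D (Suc i) f * ?D (n - i) g)) + (\<Sum>i\<le>n. ?c (Suc n - i) * (?D i f * ?D (Suc n - i) g))"
    unfolding Suc.IH sum formal_apply_mult formal_apply_divided_apply sum.distrib
    by (intro arg_cong2[where f = "(+)"] sum.cong refl) (auto simp: mult_ac Suc_diff_le simp del: of_nat_Suc)
  also have "(\<Sum>i\<le>n. ?c (Suc i) * (?D (Suc i) f * ?D (n - i) g)) = (\<Sum>i\<le>Suc n. ?c i * (?D i f * ?D (Suc n - i) g))"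
    by (subst sum.atMost_Suc_shift) (simp del: of_nat_Suc)
  also have "(\<Sum>i\<le>n. ?c (Suc n - i) * (?D i f * ?D (Suc n - i) g)) = (\<Sum>i\<le>Suc n. ?c (Suc n - i) * (?D i f * ?D (Suc n - i) g))"
    by (simp del: of_nat_Suc)
  also have "(\<Sum>i\<le>Suc n. ?c i * (?D i f * ?D (Suc n - i) g)) + \<dots>
      = (\<Sum>i\<le>Suc n. ?c (Suc n) * (?D i f * ?D (Suc n - i) g))"
  proof (subst sum.distrib[symmetric], rule sum.cong[OF refl])
    fix i assume "i \<in> {..Suc n}"
    then have "?c (Suc n) = ?c i + ?c (Suc n - i)"
      by (metis atMost_iff le_add_diff_inverse mfps_const_add of_nat_add)
    then show "?c i * (?D i f * ?D (Suc n - i) g) + ?c (Suc n - i) * (?D i f * ?D (Suc n - i) g)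
        = ?c (Suc n) * (?D i f * ?D (Suc n - i) g)"
      by (simp only: distrib_right)
  qed
  also have "\<dots> = ?c (Suc n) * (\<Sum>i\<le>Suc n. ?D i f * ?D (Suc n - i) g)"
    by (simp only: sum_distrib_left)
  finally show ?case by (rule mfps_const_of_nat_cancel)
qed simp

text \<open>The pullback \<open>P \<circ> exp (t X)\<close>, truncated at order \<open>K\<close> so that no convergence is involved.\<close>

definition flow :: "nat \<Rightarrow> ('s::finite \<Rightarrow> ('s, complex) mfps) \<Rightarrow> ('y, complex) mfps \<Rightarrow>
    (('s, complex) mfps \<Rightarrow> ('y, complex) mfps) \<Rightarrow> ('s, complex) mfps \<Rightarrow> ('y, complex) mfps" where
  "flow K X t P h = (\<Sum>i<K. t ^ i * P (divided_apply X i h))"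

lemma flow_fixed:
  assumes "approx_hom K P" "1 \<le> K" "formal_apply X h = 0"
  shows "flow K X t P h = P h"
proof -
  obtain K' where K: "K = Suc K'" using assms(2) by (cases K) auto
  show ?thesis
    unfolding flow_def K sum.lessThan_Suc_shift
    by (simp add: divided_apply_Suc_eq_0[OF assms(3)] approx_hom_zero[OF assms(1)])
qed

text \<open>Exponentials of derivations multiply by the Cauchy product. Index pairs with
  \<open>i + j \<ge> K\<close> carry the factor \<open>t ^ (i + j)\<close> of order at least
  \<open>K\<close>; the remaining triangle is matched by \<open>divided_apply_mult\<close>, up to
  the defect of \<open>P\<close> itself.\<close>

lemma approx_hom_flow:
  assumes P: "approx_hom K P" and K: "1 \<le> K" and t: "t \<in> vanish (Suc 0)"
  shows "approx_hom K (flow K X t P)"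
  unfolding approx_hom_def
proof (intro conjI allI)
  fix f g
  show "flow K X t P (f + g) = flow K X t P f + flow K X t P g"
    by (simp add: flow_def divided_apply_add approx_hom_add[OF P] distrib_left sum.distrib)
  show "flow K X t P (f * g) - flow K X t P f * flow K X t P g \<in> vanish K"
  proof -
    define a where "a i = t ^ i * P (divided_apply X i f)" for i
    define b where "b i = t ^ i * P (divided_apply X i g)" for i
    have ti: "t ^ i \<in> vanish i" for i
      using vanish_power[OF t, of i] by simp
    let ?A = "{(i, j). i + j < K}"
    have "flow K X t P f * flow K X t P g = (\<Sum>(i, j)\<in>{..<K} \<times> {..<K}. a i * b j)"
      by (simp add: flow_def a_def b_def sum_product sum.cartesian_product)
    also have "\<dots> = (\<Sum>(i, j)\<in>?A. a i * b j) + (\<Sum>(i, j)\<in>{..<K} \<times> {..<K} - ?A. a i * b j)"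
      by (subst add.commute, rule sum.subset_diff) auto
    finally have prod: "flow K X t P f * flow K X t P g = \<dots>" .
    have rest: "(\<Sum>(i, j)\<in>{..<K} \<times> {..<K} - ?A. a i * b j) \<in> vanish K"
    proof (rule vanish_sum)
      fix u assume u: "u \<in> {..<K} \<times> {..<K} - ?A"
      obtain i j where ij: "u = (i, j)" by fastforce
      have "a i * b j \<in> vanish (i + j)"
        unfolding a_def b_def by (intro vanish_mult vanish_mult_right ti)
      moreover have "K \<le> i + j" using u ij by auto
      ultimately show "(case u of (i, j) \<Rightarrow> a i * b j) \<in> vanish K"
        unfolding ij by (auto intro: vanish_mono)
    qed
    have tri: "(\<Sum>(i, j)\<in>?A. a i * b j) = (\<Sum>n<K. \<Sum>i\<le>n. a i * b (n - i))"
      by (rule sum.triangle_reindex)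
    have "flow K X t P (f * g) - (\<Sum>n<K. \<Sum>i\<le>n. a i * b (n - i))
        = (\<Sum>n<K. \<Sum>i\<le>n. t ^ n * (P (divided_apply X i f * divided_apply X (n - i) g)
             - P (divided_apply X i f) * P (divided_apply X (n - i) g)))"
      unfolding flow_def divided_apply_mult approx_hom_sum[OF P] sum_distrib_left sum_subtractf[symmetric] a_def b_def
    proof (intro sum.cong refl)
      fix n i :: nat assume "i \<in> {..n}"
      then have "t ^ n = t ^ i * t ^ (n - i)" by (simp flip: power_add)
      then show "t ^ n * P (divided_apply X i f * divided_apply X (n - i) g) -
          t ^ i * P (divided_apply X i f) * (t ^ (n - i) * P (divided_apply X (n - i) g)) =
          t ^ n * (P (divided_apply X i f * divided_apply X (n - i) g) - P (divided_apply X i f) * P (divided_apply X (n - i) g))"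
        by (simp add: algebra_simps)
    qed
    also have "\<dots> \<in> vanish K"
      by (intro vanish_sum vanish_mult_left approx_hom_mult[OF P])
    finally have "flow K X t P (f * g) - (\<Sum>n<K. \<Sum>i\<le>n. a i * b (n - i)) \<in> vanish K" .
    from vanish_diff[OF this rest] show ?thesis unfolding prod tri by (simp add: algebra_simps)
  qed
next
  fix c
  show "flow K X t P (mfps_const c) = mfps_const c"
    using flow_fixed[OF P K, of X "mfps_const c" t] by (simp add: approx_hom_const[OF P])
next
  fix s
  have "t ^ i * P (divided_apply X i (mfps_var s)) \<in> vanish 1" for i
  proof (cases i)
    case 0
    then show ?thesis using approx_hom_var[OF P] by simp
  next
    case (Suc i)
    then show ?thesis using t by (simp add: vanish_mult_right)
  qed
  then show "flow K X t P (mfps_var s) \<in> vanish 1"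
    unfolding flow_def by (rule vanish_sum)
qed

text \<open>Terms from \<open>i = 2\<close> on have order at least \<open>2 * k\<close>, which
  exceeds \<open>k\<close> because \<open>k \<ge> 1\<close>. In the linear term \<open>X s\<close>
  may be replaced by its value at the origin, since the remainder gains one order.\<close>

lemma flow_var:
  assumes P: "approx_hom K P" and k: "1 \<le> k" "k < K" and t: "t \<in> vanish k"
  shows "flow K X t P (mfps_var s) - P (mfps_var s) - t * mfps_const (mfps_const_coeff (X s)) \<in> vanish (Suc k)"
proof -
  obtain K' where K: "K = Suc (Suc K')" using k by (metis Suc_lessE less_eq_Suc_le One_nat_def Suc_le_D)
  let ?D = "\<lambda>i. divided_apply X i (mfps_var s)"
  have D1: "?D 1 = X s" by (simp add: divided_apply_def formal_apply_var)
  have "flow K X t P (mfps_var s) = P (mfps_var s) + t * P (X s) + (\<Sum>i<K'. t ^ Suc (Suc i) * P (?D (Suc (Suc i))))"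
    unfolding flow_def K sum.lessThan_Suc_shift using D1 by (simp add: add.assoc)
  then have "flow K X t P (mfps_var s) - P (mfps_var s) - t * mfps_const (mfps_const_coeff (X s))
      = t * (P (X s) - mfps_const (mfps_const_coeff (X s))) + (\<Sum>i<K'. t ^ Suc (Suc i) * P (?D (Suc (Suc i))))"
    by (simp add: algebra_simps)
  also have "\<dots> \<in> vanish (Suc k)"
  proof (intro vanish_add vanish_sum)
    have "P (X s - mfps_const (mfps_const_coeff (X s))) \<in> vanish (Suc 0)"
      by (rule approx_hom_vanish_1[OF P]) (use k in \<open>auto simp: mfps_coeff_const\<close>)
    then have "P (X s) - mfps_const (mfps_const_coeff (X s)) \<in> vanish (Suc 0)"
      by (simp add: approx_hom_minus_const[OF P])
    from vanish_mult[OF t this]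
    show "t * (P (X s) - mfps_const (mfps_const_coeff (X s))) \<in> vanish (Suc k)" by simp
    fix i
    have "t ^ Suc (Suc i) \<in> vanish (k * Suc (Suc i))" by (rule vanish_power[OF t])
    then have "t ^ Suc (Suc i) \<in> vanish (Suc k)"
      by (rule vanish_mono) (use k in auto)
    then show "t ^ Suc (Suc i) * P (?D (Suc (Suc i))) \<in> vanish (Suc k)"
      by (rule vanish_mult_right)
  qed
  finally show ?thesis .
qed

section \<open>Transport of the orbit ideal along leaves\<close>

context formal_lie_algebra
begin

lemma orbit_ideal_const_mult:
  assumes "h \<in> orbit_ideal" shows "mfps_const c * h \<in> orbit_ideal"
proof -
  have "foldr formal_apply Xs (mfps_const c * h) = mfps_const c * foldr formal_apply Xs h" for Xs
    by (induction Xs) (auto simp: formal_apply_const_mult)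
  then have "formal_word Xs (mfps_const c * h) = c * formal_word Xs h" for Xs
    by (simp add: formal_word_def mfps_coeff_const)
  with assms show ?thesis by (auto simp: orbit_ideal_def)
qed

lemma orbit_ideal_divided_apply: "h \<in> orbit_ideal \<Longrightarrow> X \<in> H \<Longrightarrow> divided_apply X n h \<in> orbit_ideal"
proof -
  assume "h \<in> orbit_ideal" "X \<in> H"
  then have "(formal_apply X ^^ n) h \<in> orbit_ideal" by (induction n) (auto intro: orbit_ideal_formal_apply)
  then show ?thesis unfolding divided_apply_def by (rule orbit_ideal_const_mult)
qed

definition kills :: "nat \<Rightarrow> (('s, complex) mfps \<Rightarrow> ('y, complex) mfps) \<Rightarrow> bool" where
  "kills K P \<longleftrightarrow> (\<forall>h\<in>orbit_ideal. P h \<in> vanish K)"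

text \<open>Divided powers of a field of \<open>H\<close> keep the orbit ideal invariant, so every
  term of the flow vanishes to order \<open>K\<close>.\<close>

lemma kills_flow: "kills K P \<Longrightarrow> X \<in> H \<Longrightarrow> kills K (flow K X t P)"
  unfolding kills_def flow_def by (auto intro!: vanish_sum vanish_mult_left orbit_ideal_divided_apply)

text \<open>The flows are performed one after another; their displacements simply add, because each
  depends on the current point only in order above \<open>k\<close>. Indeterminates outside
  \<open>S\<close> are fixed exactly, not merely to some order, which keeps the moving point in its
  fibre.\<close>

lemma multi_flow:
  assumes P: "approx_hom K P" "kills K P" and k: "1 \<le> k" "k < K" and "finite I"
    and X: "\<And>i. i \<in> I \<Longrightarrow> X i \<in> H" and S: "\<And>i s. i \<in> I \<Longrightarrow> s \<notin> S \<Longrightarrow> X i s = 0"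
    and t: "\<And>i. i \<in> I \<Longrightarrow> t i \<in> vanish k"
  shows "\<exists>P'. approx_hom K P' \<and> kills K P' \<and> (\<forall>s. s \<notin> S \<longrightarrow> P' (mfps_var s) = P (mfps_var s)) \<and>
    (\<forall>s. P' (mfps_var s) - P (mfps_var s) - (\<Sum>i\<in>I. t i * mfps_const (mfps_const_coeff (X i s))) \<in> vanish (Suc k))"
  using \<open>finite I\<close> X S t
proof (induction I)
  case empty
  then show ?case using P by (intro exI[of _ P]) auto
next
  case (insert i I)
  then obtain P' where P': "approx_hom K P'" "kills K P'" "\<forall>s. s \<notin> S \<longrightarrow> P' (mfps_var s) = P (mfps_var s)"
    and d: "\<And>s. P' (mfps_var s) - P (mfps_var s) - (\<Sum>i\<in>I. t i * mfps_const (mfps_const_coeff (X i s))) \<in> vanish (Suc k)"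
    by auto
  let ?F = "flow K (X i) (t i) P'"
  have ti: "t i \<in> vanish k" and Xi: "X i \<in> H" "\<And>s. s \<notin> S \<Longrightarrow> X i s = 0" using insert.prems by auto
  show ?case
  proof (intro exI[of _ ?F] conjI allI impI)
    show "approx_hom K ?F"
      using approx_hom_flow[OF P'(1)] vanish_mono[OF ti] k by auto
    show "kills K ?F" by (rule kills_flow[OF P'(2) Xi(1)])
    fix s
    show "?F (mfps_var s) = P (mfps_var s)" if "s \<notin> S"
      using flow_fixed[OF P'(1), of "X i" "mfps_var s" "t i"] that P'(3) Xi(2) k by (simp add: formal_apply_var)
    from vanish_add[OF flow_var[OF P'(1) k ti, of "X i" s] d[of s]]
    show "?F (mfps_var s) - P (mfps_var s) - (\<Sum>i\<in>insert i I. t i * mfps_const (mfps_const_coeff (X i s))) \<in> vanish (Suc k)"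
      using insert.hyps by (simp add: algebra_simps)
  qed
qed

text \<open>A Newton-type iteration. When the moving point agrees with \<open>Q\<close> to order
  \<open>k\<close>, it flows along the \<open>X i\<close> for times equal to the coordinates in
  \<open>U\<close> of the remaining displacement. By \<open>lin\<close>, a vector tangent to the
  leaf at the origin is determined by these coordinates, so the flow removes the displacement up to
  order \<open>k + 1\<close>.\<close>

lemma kills_along_leaf:
  fixes P Q :: "('s, complex) mfps \<Rightarrow> ('y, complex) mfps"
  assumes P: "\<And>K. approx_hom K P" "\<And>h. h \<in> orbit_ideal \<Longrightarrow> P h = 0"
    and Q: "\<And>K. approx_hom K Q" "\<And>\<rho>. \<rho> \<in> R \<Longrightarrow> Q \<rho> = 0" and R: "R \<subseteq> orbit_ideal"
    and PQ: "\<And>s. s \<notin> S \<Longrightarrow> P (mfps_var s) = Q (mfps_var s)"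
    and X: "\<And>i. i \<in> U \<Longrightarrow> X i \<in> H" "\<And>i s. i \<in> U \<Longrightarrow> s \<notin> S \<Longrightarrow> X i s = 0"
    and lin: "\<And>v s. (\<And>s. s \<notin> S \<Longrightarrow> v s = 0) \<Longrightarrow>
        (\<And>\<rho>. \<rho> \<in> R \<Longrightarrow> (\<Sum>s\<in>UNIV. mfps_coeff \<rho> (Poly_Mapping.single s 1) * v s) = 0) \<Longrightarrow>
        v s = (\<Sum>i\<in>U. v i * mfps_const_coeff (X i s))"
    and h: "h \<in> orbit_ideal"
  shows "Q h = 0"
proof -
  have approximant: "\<exists>P. approx_hom K P \<and> kills K P \<and> (\<forall>s. s \<notin> S \<longrightarrow> P (mfps_var s) = Q (mfps_var s)) \<and>
      (\<forall>s. Q (mfps_var s) - P (mfps_var s) \<in> vanish k)" if "1 \<le> k" "k \<le> K" for k K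
    using that
  proof (induction k rule: nat_induct_at_least)
    \<comment> \<open>At order 1 the given \<open>P\<close> itself works, as both points send
      indeterminates to series without constant term.\<close>
    case base
    show ?case
      using P PQ vanish_diff[OF approx_hom_var[OF Q(1)] approx_hom_var[OF P(1)]]
      by (intro exI[of _ P]) (auto simp: kills_def)
  next
    case (Suc k)
    then obtain P where P: "approx_hom K P" "kills K P" "\<And>s. s \<notin> S \<Longrightarrow> P (mfps_var s) = Q (mfps_var s)"
      and d: "\<And>s. Q (mfps_var s) - P (mfps_var s) \<in> vanish k" by auto
    define \<delta> where "\<delta> s = Q (mfps_var s) - P (mfps_var s)" for s
    obtain P' where P': "approx_hom K P'" "kills K P'" "\<And>s. s \<notin> S \<Longrightarrow> P' (mfps_var s) = P (mfps_var s)"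
      and d': "\<And>s. P' (mfps_var s) - P (mfps_var s) - (\<Sum>i\<in>U. \<delta> i * mfps_const (mfps_const_coeff (X i s))) \<in> vanish (Suc k)"
      using multi_flow[OF P(1,2), of k U X S \<delta>] Suc.hyps Suc.prems X d by (auto simp: \<delta>_def)
    have \<delta>: "\<delta> s - (\<Sum>i\<in>U. \<delta> i * mfps_const (mfps_const_coeff (X i s))) \<in> vanish (Suc k)" for s
      unfolding vanish_def
    proof safe
      fix m :: "'y \<Rightarrow>\<^sub>0 nat" assume m: "mdeg m < Suc k"
      define v where "v s = mfps_coeff (\<delta> s) m" for s
      have "v s = (\<Sum>i\<in>U. v i * mfps_const_coeff (X i s))"
      proof (rule lin)
        show "v s = 0" if "s \<notin> S" for s using P(3)[OF that] by (simp add: v_def \<delta>_def)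
        fix \<rho> assume \<rho>: "\<rho> \<in> R"
        \<comment> \<open>Coefficients of degree at most \<open>k\<close> of the displacement
          satisfy the linearised equations, for \<open>Q\<close> kills \<open>R\<close> exactly and
          the current \<open>P\<close> kills it to order \<open>k + 1\<close>.\<close>
        have "Q \<rho> - P \<rho> - (\<Sum>s\<in>UNIV. mfps_const (mfps_coeff \<rho> (Poly_Mapping.single s 1)) * \<delta> s) \<in> vanish (Suc k)"
          unfolding \<delta>_def by (rule approx_hom_diff_linear[OF Q(1) P(1) d]) (use Suc.prems in auto)
        moreover have "P \<rho> \<in> vanish (Suc k)"
          using P(2) \<rho> R Suc.prems by (auto simp: kills_def intro: vanish_mono)
        ultimately have "Q \<rho> - P \<rho> - (\<Sum>s\<in>UNIV. mfps_const (mfps_coeff \<rho> (Poly_Mapping.single s 1)) * \<delta> s) + P \<rho> \<in> vanish (Suc k)"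
          by (rule vanish_add)
        then show "(\<Sum>s\<in>UNIV. mfps_coeff \<rho> (Poly_Mapping.single s 1) * v s) = 0"
          using m Q(2)[OF \<rho>] by (simp add: vanish_def v_def)
      qed
      then show "mfps_coeff (\<delta> s - (\<Sum>i\<in>U. \<delta> i * mfps_const (mfps_const_coeff (X i s)))) m = 0"
        by (simp add: v_def mult.commute[of "\<delta> _"] mult.commute[of "mfps_coeff _ m"])
    qed
    have "Q (mfps_var s) - P' (mfps_var s) \<in> vanish (Suc k)" for s
      using vanish_diff[OF \<delta>[of s] d'[of s]] by (simp add: \<delta>_def algebra_simps)
    with P' P(3) show ?case by (intro exI[of _ P']) auto
  qed
  have "Q h \<in> vanish k" if "1 \<le> k" for k
  proof -
    obtain P where P: "approx_hom k P" "kills k P" "\<And>s. Q (mfps_var s) - P (mfps_var s) \<in> vanish k"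
      using approximant[OF \<open>1 \<le> k\<close> order.refl] by blast
    have "Q h - P h \<in> vanish k" by (rule approx_hom_diff[OF Q(1) P(1) P(3)]) auto
    moreover have "P h \<in> vanish k" using P(2) h by (simp add: kills_def)
    ultimately have "Q h - P h + P h \<in> vanish k" by (rule vanish_add)
    then show ?thesis by simp
  qed
  then have "Q h \<in> vanish k" for k
    using vanish_mono[of "Q h" "Suc k" k] by auto
  then show ?thesis by (rule vanish_all)
qed

end

section \<open>Substitution\<close>

definition mfps_monom :: "('x \<Rightarrow> ('y, 'a::comm_ring_1) mfps) \<Rightarrow> ('x \<Rightarrow>\<^sub>0 nat) \<Rightarrow> ('y, 'a) mfps" where
  "mfps_monom g a = (\<Prod>i\<in>Poly_Mapping.keys a. g i ^ Poly_Mapping.lookup a i)"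

lemma mfps_monom_superset:
  assumes "finite S" "Poly_Mapping.keys a \<subseteq> S"
  shows "mfps_monom g a = (\<Prod>i\<in>S. g i ^ Poly_Mapping.lookup a i)"
  unfolding mfps_monom_def
  by (rule prod.mono_neutral_left) (use assms in \<open>auto simp: in_keys_iff\<close>)

lemma mfps_monom_add: "mfps_monom g (a + b) = mfps_monom g a * mfps_monom g b"
proof -
  let ?S = "Poly_Mapping.keys a \<union> Poly_Mapping.keys b"
  have "mfps_monom g (a + b) = (\<Prod>i\<in>?S. g i ^ Poly_Mapping.lookup (a + b) i)"
    by (rule mfps_monom_superset) (use keys_add[of a b] in auto)
  also have "\<dots> = mfps_monom g a * mfps_monom g b"
    by (simp add: lookup_add power_add prod.distrib mfps_monom_superset[of ?S])
  finally show ?thesis .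
qed

lemma mfps_monom_0 [simp]: "mfps_monom g 0 = 1"
  by (simp add: mfps_monom_def)

lemma vanish_monom:
  assumes "\<And>i. mfps_const_coeff (g i) = 0"
  shows "mfps_monom g a \<in> vanish (mdeg a)"
proof -
  have "(\<Prod>i\<in>A. g i ^ Poly_Mapping.lookup a i) \<in> vanish (\<Sum>i\<in>A. Poly_Mapping.lookup a i)" for A
  proof (induction A rule: infinite_finite_induct)
    case (insert i A)
    have "g i \<in> vanish (Suc 0)" using assms by (simp add: vanish_1_iff)
    from vanish_mult[OF vanish_power[OF this] insert.IH] show ?case using insert.hyps by simp
  qed auto
  then show ?thesis by (simp add: mfps_monom_def mdeg_def)
qed

definition monomials :: "'x set \<Rightarrow> nat \<Rightarrow> ('x \<Rightarrow>\<^sub>0 nat) set" where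
  "monomials X n = {a. Poly_Mapping.keys a \<subseteq> X \<and> mdeg a \<le> n}"

lemma lookup_le_mdeg: "Poly_Mapping.lookup a i \<le> mdeg a"
proof (cases "i \<in> Poly_Mapping.keys a")
  case True
  then show ?thesis
    unfolding mdeg_def using member_le_sum[OF True, of "Poly_Mapping.lookup a"] by simp
qed (simp add: in_keys_iff)

lemma finite_monomials:
  assumes "finite X" shows "finite (monomials X n)"
proof -
  let ?F = "{f :: 'a \<Rightarrow> nat. \<forall>i. (i \<in> X \<longrightarrow> f i \<in> {..n}) \<and> (i \<notin> X \<longrightarrow> f i = 0)}"
  have "finite ?F"
    by (rule finite_set_of_finite_funs) (use assms in auto)
  then have "finite (Poly_Mapping.lookup -` ?F)"
    by (rule finite_vimageI) (auto simp: inj_def intro: poly_mapping_eqI)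
  moreover have "monomials X n \<subseteq> Poly_Mapping.lookup -` ?F"
  proof
    fix a assume a: "a \<in> monomials X n"
    then have "Poly_Mapping.lookup a i \<le> n" for i
      using lookup_le_mdeg[of a i] by (simp add: monomials_def)
    moreover have "Poly_Mapping.lookup a i = 0" if "i \<notin> X" for i
      using a that by (auto simp: monomials_def in_keys_iff)
    ultimately show "a \<in> Poly_Mapping.lookup -` ?F" by simp
  qed
  ultimately show ?thesis by (rule rev_finite_subset)
qed

text \<open>A monomial of degree above \<open>n\<close> becomes a series of order above
  \<open>n\<close>, as the substituted series have no constant term; the finitely many remaining
  monomials turn \<open>Sum_any\<close> into an ordinary sum. The free bound \<open>n\<close> allows
  one index set for many coefficients.\<close>

lemma mfps_coeff_subst:
  assumes "finite X" "mfps_vars_in X f" "\<And>i. mfps_const_coeff (g i) = 0" "mdeg m \<le> n"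
  shows "mfps_coeff (mfps_subst f g) m = (\<Sum>a\<in>monomials X n. mfps_coeff f a * mfps_coeff (mfps_monom g a) m)"
proof -
  have "mfps_coeff (mfps_subst f g) m = Sum_any (\<lambda>a. mfps_coeff f a * mfps_coeff (mfps_monom g a) m)"
    by (simp add: mfps_subst_def mfps_monom_def)
  also have "\<dots> = (\<Sum>a\<in>monomials X n. mfps_coeff f a * mfps_coeff (mfps_monom g a) m)"
  proof (rule Sum_any.expand_superset[OF finite_monomials[OF assms(1)]], safe)
    fix a assume *: "mfps_coeff f a * mfps_coeff (mfps_monom g a) m \<noteq> 0"
    then have "mfps_coeff f a \<noteq> 0" "mfps_coeff (mfps_monom g a) m \<noteq> 0" by auto
    then have "Poly_Mapping.keys a \<subseteq> X" "\<not> mdeg m < mdeg a"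
      using assms(2) vanish_monom[of g a, OF assms(3)] by (auto simp: mfps_vars_in_def vanish_def)
    then show "a \<in> monomials X n" using assms(4) by (simp add: monomials_def)
  qed
  finally show ?thesis .
qed

lemma mfps_vars_in_mult:
  assumes "mfps_vars_in X f" "mfps_vars_in X g" shows "mfps_vars_in X (f * g)"
  unfolding mfps_vars_in_def
proof (intro allI impI)
  fix m assume "mfps_coeff (f * g) m \<noteq> 0"
  then obtain u where "u \<in> splits m" "mfps_coeff f (fst u) * mfps_coeff g (snd u) \<noteq> 0"
    unfolding mfps_coeff_mult case_prod_unfold by (meson sum.neutral)
  then have "mfps_coeff f (fst u) \<noteq> 0" "mfps_coeff g (snd u) \<noteq> 0" "m = fst u + snd u"
    by (auto simp: splits_def)
  then show "Poly_Mapping.keys m \<subseteq> X"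
    using assms keys_add[of "fst u" "snd u"] unfolding mfps_vars_in_def by blast
qed

lemma mfps_vars_in_one: "mfps_vars_in X 1"
  by (simp add: mfps_vars_in_def mfps_coeff_one)

lemma mfps_vars_in_monom:
  assumes "\<And>i. mfps_vars_in X (g i)" shows "mfps_vars_in X (mfps_monom g a)"
proof -
  have pow: "mfps_vars_in X (g i ^ n)" for i n
    by (induction n) (auto intro: mfps_vars_in_mult mfps_vars_in_one assms)
  have "mfps_vars_in X (\<Prod>i\<in>A. g i ^ Poly_Mapping.lookup a i)" for A
    by (induction A rule: infinite_finite_induct) (auto intro: mfps_vars_in_mult mfps_vars_in_one pow)
  then show ?thesis by (simp add: mfps_monom_def)
qed

lemma mfps_vars_in_UNIV [simp]: "mfps_vars_in UNIV f"
  by (simp add: mfps_vars_in_def)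

lemma mfps_vars_in_add: "mfps_vars_in X f \<Longrightarrow> mfps_vars_in X g \<Longrightarrow> mfps_vars_in X (f + g)"
  unfolding mfps_vars_in_def by (metis add.right_neutral mfps_coeff_add)

lemma mfps_vars_in_subst:
  assumes "finite X" "mfps_vars_in X f" "\<And>i. mfps_const_coeff (g i) = 0" "\<And>i. mfps_vars_in Y (g i)"
  shows "mfps_vars_in Y (mfps_subst f g)"
  unfolding mfps_vars_in_def
proof (intro allI impI)
  fix m assume "mfps_coeff (mfps_subst f g) m \<noteq> 0"
  then obtain a where "mfps_coeff f a * mfps_coeff (mfps_monom g a) m \<noteq> 0"
    unfolding mfps_coeff_subst[OF assms(1-3) order.refl] by (meson sum.neutral)
  then have "mfps_coeff (mfps_monom g a) m \<noteq> 0" by auto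
  then show "Poly_Mapping.keys m \<subseteq> Y"
    using mfps_vars_in_monom[of Y g a, OF assms(4)] by (simp add: mfps_vars_in_def)
qed

lemma mfps_subst_add:
  assumes "finite X" "mfps_vars_in X f" "mfps_vars_in X h" "\<And>i. mfps_const_coeff (g i) = 0"
  shows "mfps_subst (f + h) g = mfps_subst f g + mfps_subst h g"
  by (rule mfps_eqI)
     (simp add: mfps_coeff_subst[OF assms(1) _ assms(4) order.refl] assms mfps_vars_in_add distrib_right sum.distrib)

lemma mfps_const_coeff_subst:
  assumes "finite X" "mfps_vars_in X f" "\<And>i. mfps_const_coeff (g i) = 0"
  shows "mfps_const_coeff (mfps_subst f g) = mfps_const_coeff f"
proof -
  have "monomials X 0 = {0}" by (auto simp: monomials_def)
  then show ?thesis
    using mfps_coeff_subst[OF assms, of 0 0] by (simp add: mfps_coeff_one)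
qed

text \<open>Both sides are compared with substitution into truncations of degree \<open>n\<close>.
  The product of the truncations differs from the truncation of the product only by monomials of
  degree above \<open>n\<close>.\<close>

lemma mfps_subst_mult:
  fixes f h :: "('x, 'a::comm_ring_1) mfps"
  assumes "finite X" "mfps_vars_in X f" "mfps_vars_in X h" "\<And>i. mfps_const_coeff (g i) = 0"
  shows "mfps_subst (f * h) g = mfps_subst f g * mfps_subst h g"
proof -
  define T where "T n f = (\<Sum>a\<in>monomials X n. mfps_const (mfps_coeff f a) * mfps_monom g a)"
    for n and f :: "('x, 'a) mfps"
  have T: "mfps_subst f g - T n f \<in> vanish (Suc n)" if "mfps_vars_in X f" for n f
    unfolding vanish_def T_def
    by (auto simp: mfps_coeff_subst[OF assms(1) that assms(4)])
  have TT: "T n f * T n h - T n (f * h) \<in> vanish (Suc n)" for n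
  proof -
    let ?M = "monomials X n" and ?F = "\<lambda>(a, b). mfps_const (mfps_coeff f a * mfps_coeff h b) * mfps_monom g (a + b)"
    let ?A = "{(a, b) \<in> ?M \<times> ?M. a + b \<in> ?M}"
    have fin: "finite ?M" by (rule finite_monomials[OF assms(1)])
    have "T n f * T n h = (\<Sum>u\<in>?M \<times> ?M. ?F u)"
      unfolding T_def sum_product sum.cartesian_product
      by (intro sum.cong refl) (auto simp: mfps_const_mult mfps_monom_add mult_ac)
    also have "\<dots> = (\<Sum>u\<in>?M \<times> ?M - ?A. ?F u) + (\<Sum>u\<in>?A. ?F u)"
      by (rule sum.subset_diff) (use fin in auto)
    \<comment> \<open>Pairs whose product survives the truncation are regrouped by that product. All
      splittings of it occur, since factors of a monomial in the range are again in the
      range.\<close>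
    also have "(\<Sum>u\<in>?A. ?F u) = (\<Sum>(c, u)\<in>(SIGMA c:?M. splits c). ?F u)"
    proof (rule sum.reindex_bij_witness[where i = snd and j = "\<lambda>u. (fst u + snd u, u)"])
      fix u assume "u \<in> (SIGMA c:?M. splits c)"
      then obtain a b where u: "u = (a + b, a, b)" "a + b \<in> ?M"
        by (auto simp: splits_def)
      have "Poly_Mapping.keys a \<subseteq> Poly_Mapping.keys (a + b)" "Poly_Mapping.keys b \<subseteq> Poly_Mapping.keys (a + b)"
        by (auto simp: in_keys_iff lookup_add)
      then show "snd u \<in> ?A" using u by (auto simp: monomials_def)
      show "(fst (snd u) + snd (snd u), snd u) = u" using u by simp
    qed (auto simp: splits_def)
    also have "\<dots> = (\<Sum>c\<in>?M. \<Sum>u\<in>splits c. ?F u)"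
      by (rule sum.Sigma[symmetric]) (auto simp: fin finite_splits)
    also have "\<dots> = T n (f * h)"
      unfolding T_def
    proof (rule sum.cong[OF refl])
      fix c
      have const_sum: "mfps_const (sum F A) = (\<Sum>i\<in>A. mfps_const (F i))" for F :: "('x \<Rightarrow>\<^sub>0 nat) \<times> ('x \<Rightarrow>\<^sub>0 nat) \<Rightarrow> 'a" and A
        by (induction A rule: infinite_finite_induct) (auto simp: mfps_const_add)
      have "(\<Sum>u\<in>splits c. ?F u) = (\<Sum>u\<in>splits c. mfps_const (mfps_coeff f (fst u) * mfps_coeff h (snd u)) * mfps_monom g c)"
        by (intro sum.cong refl) (auto simp: splits_def)
      then show "(\<Sum>u\<in>splits c. ?F u) = mfps_const (mfps_coeff (f * h) c) * mfps_monom g c"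
        by (simp add: mfps_coeff_mult case_prod_unfold const_sum sum_distrib_right)
    qed
    finally have "T n f * T n h - T n (f * h) = (\<Sum>u\<in>?M \<times> ?M - ?A. ?F u)" by simp
    also have "\<dots> \<in> vanish (Suc n)"
    proof (rule vanish_sum)
      fix u assume u: "u \<in> ?M \<times> ?M - ?A"
      obtain a b where ab: "u = (a, b)" by fastforce
      have "Poly_Mapping.keys (a + b) \<subseteq> X" using u ab keys_add[of a b] by (auto simp: monomials_def)
      then have "Suc n \<le> mdeg (a + b)" using u ab by (auto simp: monomials_def)
      then have "mfps_monom g (a + b) \<in> vanish (Suc n)"
        using vanish_monom[of g, OF assms(4)] vanish_mono by blast
      then show "?F u \<in> vanish (Suc n)" unfolding ab by (simp add: vanish_mult_left)
    qed
    finally show ?thesis .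
  qed
  have ST: "mfps_subst f g * mfps_subst h g - T n f * T n h \<in> vanish (Suc n)" for n
  proof -
    have "mfps_subst f g * mfps_subst h g - T n f * T n h
        = (mfps_subst f g - T n f) * mfps_subst h g + T n f * (mfps_subst h g - T n h)"
      by (simp add: algebra_simps)
    also have "\<dots> \<in> vanish (Suc n)"
      by (intro vanish_add vanish_mult_left vanish_mult_right T assms)
    finally show ?thesis .
  qed
  have "(mfps_subst f g * mfps_subst h g - T n f * T n h) + (T n f * T n h - T n (f * h))
      - (mfps_subst (f * h) g - T n (f * h)) \<in> vanish (Suc n)" for n
    by (rule vanish_diff[OF vanish_add[OF ST TT] T[OF mfps_vars_in_mult[OF assms(2,3)]]])
  then have "mfps_subst f g * mfps_subst h g - mfps_subst (f * h) g \<in> vanish (Suc n)" for n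
    by simp
  then have "mfps_subst f g * mfps_subst h g - mfps_subst (f * h) g \<in> vanish n" for n
    by (rule vanish_mono[of _ "Suc n"]) simp
  from vanish_all[OF this] show ?thesis by simp
qed

lemma mfps_subst_const [simp]: "mfps_subst (mfps_const c) g = mfps_const c"
proof (rule mfps_eqI)
  fix m
  have "mfps_coeff (mfps_subst (mfps_const c) g) m = Sum_any (\<lambda>a. mfps_coeff (mfps_const c) a * mfps_coeff (mfps_monom g a) m)"
    by (simp add: mfps_subst_def mfps_monom_def)
  also have "\<dots> = (\<Sum>a\<in>{0}. mfps_coeff (mfps_const c) a * mfps_coeff (mfps_monom g a) m)"
    by (rule Sum_any.expand_superset) (auto simp: mfps_coeff_const)
  finally show "mfps_coeff (mfps_subst (mfps_const c) g) m = mfps_coeff (mfps_const c) m"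
    by (auto simp: mfps_coeff_const mfps_coeff_one)
qed

lemma mfps_subst_var [simp]: "mfps_subst (mfps_var i) g = g i"
proof (rule mfps_eqI)
  fix m
  have "mfps_coeff (mfps_subst (mfps_var i) g) m = Sum_any (\<lambda>a. mfps_coeff (mfps_var i) a * mfps_coeff (mfps_monom g a) m)"
    by (simp add: mfps_subst_def mfps_monom_def)
  also have "\<dots> = (\<Sum>a\<in>{Poly_Mapping.single i 1}. mfps_coeff (mfps_var i) a * mfps_coeff (mfps_monom g a) m)"
    by (rule Sum_any.expand_superset) (auto simp: mfps_coeff_var)
  finally show "mfps_coeff (mfps_subst (mfps_var i) g) m = mfps_coeff (g i) m"
    by (simp add: mfps_coeff_var mfps_monom_def)
qed

lemma approx_hom_subst:
  assumes "\<And>i. mfps_const_coeff (g i) = 0"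
  shows "approx_hom K (\<lambda>f. mfps_subst f g)"
  using assms
  by (simp add: approx_hom_def mfps_subst_add[of UNIV] mfps_subst_mult[of UNIV] vanish_1_iff)

text \<open>Both sides are homomorphisms in \<open>f\<close>, in the sense of
  \<open>approx_hom\<close> for every order, and agree on the indeterminates. The finite set
  \<open>X\<close> makes the outer substitution well behaved on the intermediate series, whose type
  of indeterminates may be infinite.\<close>

lemma mfps_subst_subst:
  fixes f :: "('s::finite, complex) mfps"
  assumes "finite X" "\<And>s. mfps_vars_in X (g s)" "\<And>s. mfps_const_coeff (g s) = 0" "\<And>i. mfps_const_coeff (h i) = 0"
  shows "mfps_subst (mfps_subst f g) h = mfps_subst f (\<lambda>s. mfps_subst (g s) h)"
proof (rule approx_hom_eq[where P = "\<lambda>f. mfps_subst (mfps_subst f g) h"])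
  note vars = mfps_vars_in_subst[of UNIV _ g X, OF _ _ assms(3) assms(2), simplified]
  note gh = mfps_const_coeff_subst[OF assms(1,2,4)]
  show "approx_hom K (\<lambda>f. mfps_subst (mfps_subst f g) h)" for K
    unfolding approx_hom_def
    by (simp add: assms vars mfps_subst_add[of UNIV] mfps_subst_mult[of UNIV]
        mfps_subst_add[OF assms(1) _ _ assms(4)] mfps_subst_mult[OF assms(1) _ _ assms(4)] vanish_1_iff gh)
  show "approx_hom K (\<lambda>f. mfps_subst f (\<lambda>s. mfps_subst (g s) h))" for K
    by (rule approx_hom_subst) (simp add: gh assms)
qed simp

section \<open>Conjugation of series and exchange of the two groups of indeterminates\<close>

lemma mfps_cnj_mult: "mfps_cnj (f * g) = mfps_cnj f * mfps_cnj g"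
  by (rule mfps_eqI) (simp add: mfps_coeff_mult case_prod_unfold)

lemma mfps_cnj_1 [simp]: "mfps_cnj 1 = 1"
  by (rule mfps_eqI) (simp add: mfps_coeff_one)

lemma mfps_cnj_0 [simp]: "mfps_cnj 0 = 0"
  by (rule mfps_eqI) simp

lemma mfps_cnj_cnj [simp]: "mfps_cnj (mfps_cnj f) = f"
  by (rule mfps_eqI) simp

lemma mfps_cnj_monom: "mfps_cnj (mfps_monom g a) = mfps_monom (\<lambda>i. mfps_cnj (g i)) a"
proof -
  have pow: "mfps_cnj (f ^ n) = mfps_cnj f ^ n" for f :: "('x, complex) mfps" and n
    by (induction n) (auto simp: mfps_cnj_mult)
  have "mfps_cnj (\<Prod>i\<in>A. g i ^ Poly_Mapping.lookup a i) = (\<Prod>i\<in>A. mfps_cnj (g i) ^ Poly_Mapping.lookup a i)" for A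
    by (induction A rule: infinite_finite_induct) (auto simp: mfps_cnj_mult pow)
  then show ?thesis by (simp add: mfps_monom_def)
qed

lemma mfps_cnj_subst:
  assumes "finite X" "mfps_vars_in X f" "\<And>i. mfps_const_coeff (g i) = 0"
  shows "mfps_cnj (mfps_subst f g) = mfps_subst (mfps_cnj f) (\<lambda>i. mfps_cnj (g i))"
proof (rule mfps_eqI)
  fix m
  have "mfps_vars_in X (mfps_cnj f)" using assms(2) by (simp add: mfps_vars_in_def)
  moreover have "cnj (mfps_coeff (mfps_monom g a) m) = mfps_coeff (mfps_monom (\<lambda>i. mfps_cnj (g i)) a) m" for a
    by (simp flip: mfps_cnj_monom)
  ultimately show "mfps_coeff (mfps_cnj (mfps_subst f g)) m = mfps_coeff (mfps_subst (mfps_cnj f) (\<lambda>i. mfps_cnj (g i))) m"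
    using assms by (simp add: mfps_coeff_subst[OF assms(1) _ _ order.refl])
qed

text \<open>Conjugation turns \<open>\<rho>(Z, \<zeta>)\<close> into the same series with \<open>Z\<close> and \<open>\<zeta>\<close> interchanged when \<open>\<rho>\<close>
  is the Taylor series of a real-valued function.\<close>

definition sum_swap :: "'a + 'a \<Rightarrow> 'a + 'a" where
  "sum_swap = case_sum Inr Inl"

lemma sum_swap_sum_swap [simp]: "sum_swap (sum_swap s) = s"
  by (cases s) (auto simp: sum_swap_def)

definition exponent_swap :: "('a::finite + 'a \<Rightarrow>\<^sub>0 nat) \<Rightarrow> ('a + 'a \<Rightarrow>\<^sub>0 nat)" where
  "exponent_swap m = Abs_poly_mapping (\<lambda>s. Poly_Mapping.lookup m (sum_swap s))"

lemma lookup_exponent_swap [simp]: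
  "Poly_Mapping.lookup (exponent_swap m) s = Poly_Mapping.lookup m (sum_swap s)"
  by (simp add: exponent_swap_def)

lemma exponent_swap_exponent_swap [simp]: "exponent_swap (exponent_swap m) = m"
  by (rule poly_mapping_eqI) simp

lemma sum_swap_reindex: "(\<Sum>s\<in>UNIV. F (sum_swap s)) = (\<Sum>s\<in>(UNIV :: ('a::finite + 'a) set). F s)"
  by (rule sum.reindex_bij_witness[where i = sum_swap and j = sum_swap]) auto

lemma mdeg_exponent_swap [simp]: "mdeg (exponent_swap m) = mdeg m"
  by (simp add: mdeg_superset[of UNIV] sum_swap_reindex[of "Poly_Mapping.lookup m"])

lemma mfps_subst_swap:
  fixes f :: "('a::finite + 'a, complex) mfps"
  assumes "\<And>i. mfps_const_coeff (g i) = 0" "\<And>m. mfps_coeff f' m = mfps_coeff f (exponent_swap m)"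
  shows "mfps_subst f' g = mfps_subst f (\<lambda>s. g (sum_swap s))"
proof (rule mfps_eqI)
  fix m
  have monom: "mfps_monom (\<lambda>s. g (sum_swap s)) (exponent_swap a) = mfps_monom g a" for a
    unfolding mfps_monom_superset[OF finite subset_UNIV]
    by (rule prod.reindex_bij_witness[where i = sum_swap and j = sum_swap]) auto
  show "mfps_coeff (mfps_subst f' g) m = mfps_coeff (mfps_subst f (\<lambda>s. g (sum_swap s))) m"
    unfolding mfps_coeff_subst[OF finite mfps_vars_in_UNIV assms(1) order.refl]
    by (rule sum.reindex_bij_witness[where i = exponent_swap and j = exponent_swap])
       (auto simp: monomials_def assms(2) monom)
qed

section \<open>Series in the Z-indeterminates alone\<close>

definition exponent_Inl :: "('a::finite \<Rightarrow>\<^sub>0 nat) \<Rightarrow> ('a + 'b::finite \<Rightarrow>\<^sub>0 nat)" where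
  "exponent_Inl m = Abs_poly_mapping (case_sum (Poly_Mapping.lookup m) (\<lambda>_. 0))"

definition exponent_restrict_Inl :: "('a::finite + 'b::finite \<Rightarrow>\<^sub>0 nat) \<Rightarrow> ('a \<Rightarrow>\<^sub>0 nat)" where
  "exponent_restrict_Inl m = Abs_poly_mapping (\<lambda>i. Poly_Mapping.lookup m (Inl i))"

lemma lookup_exponent_Inl [simp]:
  "Poly_Mapping.lookup (exponent_Inl m) = case_sum (Poly_Mapping.lookup m) (\<lambda>_. 0)"
  by (simp add: exponent_Inl_def)

lemma lookup_exponent_restrict_Inl [simp]:
  "Poly_Mapping.lookup (exponent_restrict_Inl m) = (\<lambda>i. Poly_Mapping.lookup m (Inl i))"
  by (simp add: exponent_restrict_Inl_def)

lemma keys_exponent_Inl: "Poly_Mapping.keys (exponent_Inl m) \<subseteq> range Inl"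
proof
  fix s assume "s \<in> Poly_Mapping.keys (exponent_Inl m)"
  then show "s \<in> range Inl" by (cases s) (auto simp: in_keys_iff)
qed

lemma mdeg_exponent_Inl [simp]: "mdeg (exponent_Inl m :: 'a::finite + 'b::finite \<Rightarrow>\<^sub>0 nat) = mdeg m"
proof -
  have "mdeg (exponent_Inl m :: 'a + 'b \<Rightarrow>\<^sub>0 nat) =
      (\<Sum>s\<in>range Inl. Poly_Mapping.lookup (exponent_Inl m :: 'a + 'b \<Rightarrow>\<^sub>0 nat) s)"
    by (rule mdeg_superset) (use keys_exponent_Inl in auto)
  also have "\<dots> = (\<Sum>i\<in>UNIV. Poly_Mapping.lookup m i)"
    by (subst sum.reindex) auto
  finally show ?thesis by (simp add: mdeg_superset[of UNIV])
qed

text \<open>Brings equations found in the complexification back to series in Z: as \<open>f\<close>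
  involves only the \<open>Inl\<close>-indeterminates, \<open>w\<close> may be the second component
  of any point.\<close>

lemma mfps_subst_restrict_Inl:
  fixes f :: "('a::finite + 'b::finite, complex) mfps"
  assumes "mfps_vars_in (range Inl) f" "\<And>i. mfps_const_coeff (v i) = 0" "\<And>i. mfps_const_coeff (w i) = 0"
  shows "mfps_subst (Abs_mfps (\<lambda>m. mfps_coeff f (exponent_Inl m))) v = mfps_subst f (case_sum v w)"
proof (rule mfps_eqI)
  fix m
  have monom: "mfps_monom (case_sum v w) (exponent_Inl a) = mfps_monom v a" for a
  proof -
    have "mfps_monom (case_sum v w) (exponent_Inl a) = (\<Prod>s\<in>range Inl. case_sum v w s ^ Poly_Mapping.lookup (exponent_Inl a) s)"
      by (rule mfps_monom_superset) (use keys_exponent_Inl in auto)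
    also have "\<dots> = mfps_monom v a"
      by (subst prod.reindex) (auto simp: mfps_monom_superset[OF finite subset_UNIV])
    finally show ?thesis .
  qed
  have vw: "mfps_const_coeff (case_sum v w s) = 0" for s
    using assms(2,3) by (cases s) auto
  have inv: "exponent_restrict_Inl (exponent_Inl a :: 'a + 'b \<Rightarrow>\<^sub>0 nat) = a" for a
    by (rule poly_mapping_eqI) simp
  have inv': "exponent_Inl (exponent_restrict_Inl a) = a" if "Poly_Mapping.keys a \<subseteq> range Inl" for a :: "'a + 'b \<Rightarrow>\<^sub>0 nat"
  proof (rule poly_mapping_eqI)
    fix s
    show "Poly_Mapping.lookup (exponent_Inl (exponent_restrict_Inl a)) s = Poly_Mapping.lookup a s"
      using that by (cases s) (auto simp: in_keys_iff subset_eq)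
  qed
  show "mfps_coeff (mfps_subst (Abs_mfps (\<lambda>m. mfps_coeff f (exponent_Inl m))) v) m = mfps_coeff (mfps_subst f (case_sum v w)) m"
    unfolding mfps_coeff_subst[OF finite mfps_vars_in_UNIV assms(2) order.refl]
      mfps_coeff_subst[OF finite assms(1) vw order.refl]
  proof (rule sum.reindex_bij_witness[where i = exponent_restrict_Inl and j = exponent_Inl])
    fix a :: "'a + 'b \<Rightarrow>\<^sub>0 nat" assume "a \<in> monomials (range Inl) (mdeg m)"
    then have a: "Poly_Mapping.keys a \<subseteq> range Inl" "mdeg a \<le> mdeg m" by (auto simp: monomials_def)
    show "exponent_Inl (exponent_restrict_Inl a) = a" by (rule inv'[OF a(1)])
    then have "mdeg (exponent_restrict_Inl a) = mdeg a" by (metis mdeg_exponent_Inl)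
    then show "exponent_restrict_Inl a \<in> monomials UNIV (mdeg m)" using a by (simp add: monomials_def)
  qed (auto simp: monomials_def inv monom keys_exponent_Inl subsetD[OF keys_exponent_Inl])
qed

section \<open>Smooth functions\<close>

lemma Ck_on_cong:
  assumes "open S" "\<And>x. x \<in> S \<Longrightarrow> f x = g x" "Ck_on k S f"
  shows "Ck_on k S g"
  using assms(2,3)
proof (induction k arbitrary: f g)
  case 0
  then show ?case by (simp cong: continuous_on_cong)
next
  case (Suc k)
  have d: "f differentiable at x" if "x \<in> S" for x using Suc.prems that by auto
  have eq: "frechet_derivative f (at x) = frechet_derivative g (at x)" if "x \<in> S" for x
    by (rule frechet_derivative_transform_within_open[OF d[OF that] assms(1) that Suc.prems(1)])
  have "Ck_on k S (\<lambda>x. frechet_derivative g (at x) v)" for v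
  proof (rule Suc.IH)
    show "Ck_on k S (\<lambda>x. frechet_derivative f (at x) v)" using Suc.prems(2) by simp
  qed (simp add: eq)
  moreover have "g differentiable at x" if "x \<in> S" for x
    using has_derivative_transform_within_open[OF _ assms(1) that, of f _ UNIV g] d[OF that] Suc.prems(1)
    unfolding differentiable_def by auto
  ultimately show ?case by simp
qed

lemma Ck_on_subset: "Ck_on k S f \<Longrightarrow> T \<subseteq> S \<Longrightarrow> Ck_on k T f"
  by (induction k arbitrary: f) (auto intro: continuous_on_subset)

lemma Ck_on_Suc_has_derivative:
  "Ck_on (Suc k) S f \<Longrightarrow> x \<in> S \<Longrightarrow> (f has_derivative frechet_derivative f (at x)) (at x)"
  by (simp add: frechet_derivative_works)

lemma Ck_on_SucI:
  assumes "open S" "\<And>x. x \<in> S \<Longrightarrow> (f has_derivative f' x) (at x)" "\<And>v. Ck_on k S (\<lambda>x. f' x v)"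
  shows "Ck_on (Suc k) S f"
proof -
  have "Ck_on k S (\<lambda>x. frechet_derivative f (at x) v)" for v
    by (rule Ck_on_cong[OF assms(1) _ assms(3)[of v]]) (simp add: frechet_derivative_at[OF assms(2), symmetric])
  then show ?thesis using assms(2) by (auto simp: differentiable_def)
qed

lemma Ck_on_Suc_imp: "Ck_on (Suc k) S f \<Longrightarrow> Ck_on k S f"
proof (induction k arbitrary: f)
  case 0
  then show ?case
    by (auto intro!: continuous_at_imp_continuous_on differentiable_imp_continuous_within)
qed auto

lemma Ck_on_const: "Ck_on k S (\<lambda>x. c)"
  by (induction k arbitrary: c) auto

lemma Ck_on_add: "open S \<Longrightarrow> Ck_on k S f \<Longrightarrow> Ck_on k S g \<Longrightarrow> Ck_on k S (\<lambda>x. f x + g x)"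
proof (induction k arbitrary: f g)
  case (Suc k)
  show ?case
    by (rule Ck_on_SucI[OF \<open>open S\<close> has_derivative_add[OF Ck_on_Suc_has_derivative[OF Suc.prems(2)] Ck_on_Suc_has_derivative[OF Suc.prems(3)]]])
       (use Suc in auto)
qed (auto intro: continuous_intros)

lemma Ck_on_bounded_linear:
  assumes T: "bounded_linear T" and "open S" shows "Ck_on k S f \<Longrightarrow> Ck_on k S (\<lambda>x. T (f x))"
proof (induction k arbitrary: f)
  case 0
  then show ?case by (simp add: bounded_linear.continuous_on[OF T])
next
  case (Suc k)
  show ?case
    by (rule Ck_on_SucI[OF \<open>open S\<close> bounded_linear.has_derivative[OF T Ck_on_Suc_has_derivative[OF Suc.prems]]])
       (use Suc in auto)
qed

lemma Ck_on_mult: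
  fixes f g :: "'a::real_normed_vector \<Rightarrow> 'b::real_normed_algebra"
  shows "open S \<Longrightarrow> Ck_on k S f \<Longrightarrow> Ck_on k S g \<Longrightarrow> Ck_on k S (\<lambda>x. f x * g x)"
proof (induction k arbitrary: f g)
  case (Suc k)
  note fg = Ck_on_Suc_imp[OF Suc.prems(2)] Ck_on_Suc_imp[OF Suc.prems(3)]
  show ?case
    by (rule Ck_on_SucI[OF \<open>open S\<close> has_derivative_mult[OF Ck_on_Suc_has_derivative[OF Suc.prems(2)] Ck_on_Suc_has_derivative[OF Suc.prems(3)]]])
       (use Suc fg in \<open>auto intro: Ck_on_add\<close>)
qed (auto intro: continuous_intros)

lemma smooth_on_subset: "smooth_on S f \<Longrightarrow> T \<subseteq> S \<Longrightarrow> smooth_on T f"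
  unfolding smooth_on_def using Ck_on_subset by blast

lemma smooth_on_differentiable: "smooth_on S f \<Longrightarrow> x \<in> S \<Longrightarrow> f differentiable at x"
  unfolding smooth_on_def using Ck_on.simps(2) by blast

lemma smooth_on_frechet_derivative: "smooth_on S f \<Longrightarrow> smooth_on S (\<lambda>x. frechet_derivative f (at x) v)"
  unfolding smooth_on_def using Ck_on.simps(2) by blast

lemma smooth_on_const: "smooth_on S (\<lambda>x. c)"
  by (simp add: smooth_on_def Ck_on_const)

lemma smooth_on_add: "open S \<Longrightarrow> smooth_on S f \<Longrightarrow> smooth_on S g \<Longrightarrow> smooth_on S (\<lambda>x. f x + g x)"
  by (simp add: smooth_on_def Ck_on_add)

lemma smooth_on_mult:
  fixes f g :: "'a::real_normed_vector \<Rightarrow> 'b::real_normed_algebra"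
  shows "open S \<Longrightarrow> smooth_on S f \<Longrightarrow> smooth_on S g \<Longrightarrow> smooth_on S (\<lambda>x. f x * g x)"
  by (simp add: smooth_on_def Ck_on_mult)

lemma smooth_on_bounded_linear:
  "bounded_linear T \<Longrightarrow> open S \<Longrightarrow> smooth_on S f \<Longrightarrow> smooth_on S (\<lambda>x. T (f x))"
  by (simp add: smooth_on_def Ck_on_bounded_linear)

lemma smooth_on_sum:
  "open S \<Longrightarrow> (\<And>i. i \<in> A \<Longrightarrow> smooth_on S (f i)) \<Longrightarrow> smooth_on S (\<lambda>x. \<Sum>i\<in>A. f i x)"
  by (induction A rule: infinite_finite_induct) (auto intro: smooth_on_add smooth_on_const)

lemma smooth_on_cong: "open S \<Longrightarrow> (\<And>x. x \<in> S \<Longrightarrow> f x = g x) \<Longrightarrow> smooth_on S f \<Longrightarrow> smooth_on S g"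
  unfolding smooth_on_def using Ck_on_cong by blast

section \<open>Symmetry of second derivatives\<close>

lemma has_real_derivative_along_line:
  fixes f :: "'a::real_normed_vector \<Rightarrow> real"
  assumes "f differentiable at (x + s *\<^sub>R u)"
  shows "((\<lambda>s. f (x + s *\<^sub>R u)) has_real_derivative frechet_derivative f (at (x + s *\<^sub>R u)) u) (at s)"
proof -
  let ?D = "frechet_derivative f (at (x + s *\<^sub>R u))"
  have D: "(f has_derivative ?D) (at (x + s *\<^sub>R u))"
    using assms by (simp add: frechet_derivative_works)
  have "((\<lambda>s. x + s *\<^sub>R u) has_derivative (\<lambda>h. h *\<^sub>R u)) (at s)"
    by (auto intro!: derivative_eq_intros)
  from has_derivative_compose[OF this D]
  have "((\<lambda>s. f (x + s *\<^sub>R u)) has_derivative (\<lambda>h. ?D (h *\<^sub>R u))) (at s)" .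
  moreover have "(\<lambda>h. ?D (h *\<^sub>R u)) = (*) (?D u)"
    using linear_frechet_derivative[OF assms] by (auto simp: linear_cmul mult.commute)
  ultimately show ?thesis by (simp add: has_field_derivative_def)
qed

text \<open>The mean value theorem is applied along \<open>u\<close> to the increment in direction
  \<open>v\<close>, and then along \<open>v\<close> to the derivative in direction
  \<open>u\<close>.\<close>

lemma double_difference_mean_value:
  fixes f :: "'a::real_normed_vector \<Rightarrow> real"
  assumes h: "0 < h" and B: "\<And>a b. 0 \<le> a \<Longrightarrow> a \<le> h \<Longrightarrow> 0 \<le> b \<Longrightarrow> b \<le> h \<Longrightarrow> x + a *\<^sub>R u + b *\<^sub>R v \<in> S"
    and f: "\<And>p. p \<in> S \<Longrightarrow> f differentiable at p"
    and fu: "\<And>p. p \<in> S \<Longrightarrow> (\<lambda>y. frechet_derivative f (at y) u) differentiable at p"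
  shows "\<exists>a b. 0 \<le> a \<and> a \<le> h \<and> 0 \<le> b \<and> b \<le> h \<and>
    f (x + h *\<^sub>R u + h *\<^sub>R v) - f (x + h *\<^sub>R u) - f (x + h *\<^sub>R v) + f x =
      h * h * frechet_derivative (\<lambda>y. frechet_derivative f (at y) u) (at (x + a *\<^sub>R u + b *\<^sub>R v)) v"
proof -
  let ?fu = "\<lambda>y. frechet_derivative f (at y) u"
  define g where "g s = f ((x + h *\<^sub>R v) + s *\<^sub>R u) - f (x + s *\<^sub>R u)" for s
  have "\<exists>a. 0 < a \<and> a < h \<and> g h - g 0 = (h - 0) * (?fu ((x + h *\<^sub>R v) + a *\<^sub>R u) - ?fu (x + a *\<^sub>R u))"
  proof (rule MVT2[OF h])
    fix a assume a: "0 \<le> a" "a \<le> h"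
    show "(g has_real_derivative ?fu ((x + h *\<^sub>R v) + a *\<^sub>R u) - ?fu (x + a *\<^sub>R u)) (at a)"
      unfolding g_def
      by (intro DERIV_diff has_real_derivative_along_line f)
         (use B[of a h] B[of a 0] a h in \<open>auto simp: algebra_simps\<close>)
  qed
  then obtain a where a: "0 < a" "a < h" "g h - g 0 = (h - 0) * (?fu ((x + h *\<^sub>R v) + a *\<^sub>R u) - ?fu (x + a *\<^sub>R u))"
    by blast
  have swap: "(x + h *\<^sub>R v) + c *\<^sub>R u = (x + c *\<^sub>R u) + h *\<^sub>R v" for c
    by (simp add: add_ac)
  have "\<exists>b. 0 < b \<and> b < h \<and> ?fu ((x + a *\<^sub>R u) + h *\<^sub>R v) - ?fu ((x + a *\<^sub>R u) + 0 *\<^sub>R v)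
      = (h - 0) * frechet_derivative ?fu (at ((x + a *\<^sub>R u) + b *\<^sub>R v)) v"
    by (rule MVT2[OF h], rule has_real_derivative_along_line, rule fu) (use B a in auto)
  then obtain b where "0 < b" "b < h" "?fu ((x + a *\<^sub>R u) + h *\<^sub>R v) - ?fu ((x + a *\<^sub>R u) + 0 *\<^sub>R v)
      = h * frechet_derivative ?fu (at ((x + a *\<^sub>R u) + b *\<^sub>R v)) v" by auto
  with a(3) have "g h - g 0 = h * h * frechet_derivative ?fu (at ((x + a *\<^sub>R u) + b *\<^sub>R v)) v"
    unfolding swap by simp
  moreover have "g h - g 0 = f (x + h *\<^sub>R u + h *\<^sub>R v) - f (x + h *\<^sub>R u) - f (x + h *\<^sub>R v) + f x"
    unfolding g_def swap by simp
  ultimately show ?thesis using a(1,2) \<open>0 < b\<close> \<open>b < h\<close>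
    by (intro exI[of _ a] exI[of _ b]) simp
qed

text \<open>The double difference is symmetric in \<open>u\<close> and \<open>v\<close>. It equals
  \<open>h * h\<close> times either mixed derivative at some point of a small parallelogram, and by
  continuity both derivatives are close to their values at \<open>x\<close>.\<close>

lemma frechet_derivative_commute_real:
  fixes f :: "'a::real_normed_vector \<Rightarrow> real"
  assumes f: "Ck_on 2 S f" and S: "open S" "x \<in> S"
  shows "frechet_derivative (\<lambda>y. frechet_derivative f (at y) u) (at x) v
       = frechet_derivative (\<lambda>y. frechet_derivative f (at y) v) (at x) u"
proof -
  define D where "D u v p = frechet_derivative (\<lambda>y. frechet_derivative f (at y) u) (at p) v" for u v p
  have C2: "Ck_on (Suc (Suc 0)) S f" using f by (simp add: numeral_2_eq_2)
  then have f1: "\<And>p. p \<in> S \<Longrightarrow> f differentiable at p"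
    and f2: "\<And>p u. p \<in> S \<Longrightarrow> (\<lambda>y. frechet_derivative f (at y) u) differentiable at p"
    and f3: "\<And>u v. continuous_on S (D u v)"
    by (simp_all add: D_def)
  have "\<bar>D u v x - D v u x\<bar> \<le> \<epsilon>" if "\<epsilon> > 0" for \<epsilon>
  proof -
    have "\<exists>\<delta>>0. \<forall>p. dist p x < \<delta> \<longrightarrow> p \<in> S \<and> \<bar>D u v p - D u v x\<bar> < \<epsilon> / 2" for u v
    proof -
      have "isCont (D u v) x" using f3 S by (simp add: continuous_on_eq_continuous_at)
      then have "(D u v \<longlongrightarrow> D u v x) (nhds x)"
        by (simp add: isCont_def tendsto_at_iff_tendsto_nhds)
      then have "eventually (\<lambda>p. dist (D u v p) (D u v x) < \<epsilon> / 2) (nhds x)"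
        by (rule tendstoD) (use that in simp)
      moreover have "eventually (\<lambda>p. p \<in> S) (nhds x)" by (rule eventually_nhds_in_open[OF S])
      ultimately have "eventually (\<lambda>p. p \<in> S \<and> \<bar>D u v p - D u v x\<bar> < \<epsilon> / 2) (nhds x)"
        by eventually_elim (simp add: dist_real_def)
      then show ?thesis by (simp add: eventually_nhds_metric)
    qed
    then obtain \<delta>1 \<delta>2 where \<delta>: "\<delta>1 > 0" "\<delta>2 > 0"
      and \<delta>1: "\<And>p. dist p x < \<delta>1 \<Longrightarrow> p \<in> S \<and> \<bar>D u v p - D u v x\<bar> < \<epsilon> / 2"
      and \<delta>2: "\<And>p. dist p x < \<delta>2 \<Longrightarrow> p \<in> S \<and> \<bar>D v u p - D v u x\<bar> < \<epsilon> / 2"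
      by meson
    define \<delta> where "\<delta> = min \<delta>1 \<delta>2"
    \<comment> \<open>The parallelogram with sides \<open>h *\<^sub>R u\<close> and
      \<open>h *\<^sub>R v\<close> has to stay in the ball of radius \<open>\<delta>\<close>; with
      \<open>h = \<delta> / (2 * c)\<close> its points have distance less than
      \<open>\<delta> / 2\<close> from \<open>x\<close>. The summand 1 keeps \<open>c\<close>
      positive.\<close>
    define c where "c = 1 + norm u + norm v"
    have c: "c > 0" by (simp add: c_def add_pos_nonneg)
    define h where "h = \<delta> / (2 * c)"
    have h: "h > 0" using \<delta> c by (simp add: h_def \<delta>_def)
    have "h * c = \<delta> / 2" using c by (simp add: h_def)
    moreover have "\<delta> > 0" using \<delta> by (simp add: \<delta>_def)
    ultimately have hd: "h * norm u + h * norm v < \<delta>" using h by (simp add: c_def algebra_simps)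
    have near: "dist (x + a *\<^sub>R u + b *\<^sub>R v) x < \<delta>" if "0 \<le> a" "a \<le> h" "0 \<le> b" "b \<le> h" for a b
    proof -
      have "dist (x + a *\<^sub>R u + b *\<^sub>R v) x = norm (a *\<^sub>R u + b *\<^sub>R v)" by (simp add: dist_norm add.assoc)
      also have "\<dots> \<le> a * norm u + b * norm v" using that by (metis norm_triangle_ineq norm_scaleR abs_of_nonneg)
      also have "\<dots> \<le> h * norm u + h * norm v" using that by (intro add_mono mult_right_mono) auto
      finally show ?thesis using hd by simp
    qed
    have near': "dist (x + a *\<^sub>R v + b *\<^sub>R u) x < \<delta>" if "0 \<le> a" "a \<le> h" "0 \<le> b" "b \<le> h" for a b
      using near[of b a] that by (simp add: add_ac)
    let ?\<Delta> = "f (x + h *\<^sub>R u + h *\<^sub>R v) - f (x + h *\<^sub>R u) - f (x + h *\<^sub>R v) + f x"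
    have "\<exists>a b. 0 \<le> a \<and> a \<le> h \<and> 0 \<le> b \<and> b \<le> h \<and> ?\<Delta> = h * h * D u v (x + a *\<^sub>R u + b *\<^sub>R v)"
      unfolding D_def by (rule double_difference_mean_value[OF h _ f1 f2, of _ _ _ S])
        (use near \<delta>1 in \<open>auto simp: \<delta>_def\<close>)
    then obtain a b where ab: "0 \<le> a" "a \<le> h" "0 \<le> b" "b \<le> h" "?\<Delta> = h * h * D u v (x + a *\<^sub>R u + b *\<^sub>R v)"
      by blast
    have "\<exists>a b. 0 \<le> a \<and> a \<le> h \<and> 0 \<le> b \<and> b \<le> h \<and>
        f (x + h *\<^sub>R v + h *\<^sub>R u) - f (x + h *\<^sub>R v) - f (x + h *\<^sub>R u) + f x = h * h * D v u (x + a *\<^sub>R v + b *\<^sub>R u)"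
      unfolding D_def by (rule double_difference_mean_value[OF h _ f1 f2, of _ _ _ S])
        (use near' \<delta>1 in \<open>auto simp: \<delta>_def\<close>)
    then obtain a' b' where ab': "0 \<le> a'" "a' \<le> h" "0 \<le> b'" "b' \<le> h"
      "f (x + h *\<^sub>R v + h *\<^sub>R u) - f (x + h *\<^sub>R v) - f (x + h *\<^sub>R u) + f x = h * h * D v u (x + a' *\<^sub>R v + b' *\<^sub>R u)"
      by blast
    have "x + h *\<^sub>R v + h *\<^sub>R u = x + h *\<^sub>R u + h *\<^sub>R v" by (simp add: add_ac)
    with ab(5) ab'(5) have "h * h * D u v (x + a *\<^sub>R u + b *\<^sub>R v) = h * h * D v u (x + a' *\<^sub>R v + b' *\<^sub>R u)"
      by (smt (verit))
    with h have eq: "D u v (x + a *\<^sub>R u + b *\<^sub>R v) = D v u (x + a' *\<^sub>R v + b' *\<^sub>R u)" by simp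
    have "\<bar>D u v (x + a *\<^sub>R u + b *\<^sub>R v) - D u v x\<bar> < \<epsilon> / 2"
      using \<delta>1 near[OF ab(1-4)] by (simp add: \<delta>_def)
    moreover have "\<bar>D v u (x + a' *\<^sub>R v + b' *\<^sub>R u) - D v u x\<bar> < \<epsilon> / 2"
      using \<delta>2 near'[OF ab'(1-4)] by (simp add: \<delta>_def)
    ultimately show ?thesis using eq by linarith
  qed
  then have "\<bar>D u v x - D v u x\<bar> \<le> 0" by (rule field_le_epsilon[of _ 0, simplified])
  then show ?thesis by (simp add: D_def)
qed

lemma frechet_derivative_bounded_linear_comp:
  assumes "bounded_linear T" "f differentiable at x"
  shows "frechet_derivative (\<lambda>y. T (f y)) (at x) v = T (frechet_derivative f (at x) v)"
proof -
  have "((\<lambda>y. T (f y)) has_derivative (\<lambda>v. T (frechet_derivative f (at x) v))) (at x)"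
    by (rule bounded_linear.has_derivative[OF assms(1) assms(2)[unfolded frechet_derivative_works]])
  from fun_cong[OF frechet_derivative_at[OF this], of v] show ?thesis by simp
qed

text \<open>The mean value argument is real, so real and imaginary parts are treated separately, as
  bounded linear maps that commute with differentiation.\<close>

lemma frechet_derivative_commute:
  fixes f :: "'a::real_normed_vector \<Rightarrow> complex"
  assumes f: "smooth_on S f" and S: "open S" "x \<in> S"
  shows "frechet_derivative (\<lambda>y. frechet_derivative f (at y) u) (at x) v
       = frechet_derivative (\<lambda>y. frechet_derivative f (at y) v) (at x) u"
proof -
  have T: "T (frechet_derivative (\<lambda>y. frechet_derivative f (at y) u) (at x) v)
      = T (frechet_derivative (\<lambda>y. frechet_derivative f (at y) v) (at x) u)"
    if T: "bounded_linear T" for T :: "complex \<Rightarrow> real"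
  proof -
    have "T (frechet_derivative (\<lambda>y. frechet_derivative f (at y) u) (at x) v)
        = frechet_derivative (\<lambda>y. frechet_derivative (\<lambda>y. T (f y)) (at y) u) (at x) v" for u v
    proof -
      have d: "(\<lambda>y. frechet_derivative f (at y) u) differentiable at x"
        using smooth_on_differentiable[OF smooth_on_frechet_derivative[OF f] S(2)] .
      have "T (frechet_derivative (\<lambda>y. frechet_derivative f (at y) u) (at x) v)
          = frechet_derivative (\<lambda>y. T (frechet_derivative f (at y) u)) (at x) v"
        by (rule frechet_derivative_bounded_linear_comp[OF T d, symmetric])
      also have "frechet_derivative (\<lambda>y. T (frechet_derivative f (at y) u)) (at x)
          = frechet_derivative (\<lambda>y. frechet_derivative (\<lambda>y. T (f y)) (at y) u) (at x)"
      proof (rule frechet_derivative_transform_within_open[OF _ S])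
        show "(\<lambda>y. T (frechet_derivative f (at y) u)) differentiable at x"
          using bounded_linear.has_derivative[OF T] d unfolding differentiable_def by blast
      qed (simp add: frechet_derivative_bounded_linear_comp[OF T smooth_on_differentiable[OF f]])
      finally show ?thesis .
    qed
    moreover have "Ck_on 2 S (\<lambda>y. T (f y))"
      using f Ck_on_bounded_linear[OF T S(1)] by (simp add: smooth_on_def)
    ultimately show ?thesis
      using frechet_derivative_commute_real[OF _ S, of "\<lambda>y. T (f y)" u v] by simp
  qed
  show ?thesis
    by (rule complex_eqI) (use T[OF bounded_linear_Re] T[OF bounded_linear_Im] in auto)
qed

section \<open>Taylor series\<close>

text \<open>Together with \<open>base_index\<close> this puts the two Wirtinger derivatives into one
  formula, so that each rule is proved once for both kinds of direction.\<close>

definition wirtinger_sign :: "'N + 'N \<Rightarrow> complex" where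
  "wirtinger_sign s = (case s of Inl _ \<Rightarrow> - \<i> | Inr _ \<Rightarrow> \<i>)"

definition base_index :: "'N + 'N \<Rightarrow> 'N" where
  "base_index s = (case s of Inl i \<Rightarrow> i | Inr i \<Rightarrow> i)"

lemma wirtinger_eq:
  "wirtinger s F p = (frechet_derivative F (at p) (axis (base_index s) 1)
     + wirtinger_sign s * frechet_derivative F (at p) (axis (base_index s) \<i>)) / 2"
  by (cases s) (auto simp: wirtinger_sign_def base_index_def)

lemma smooth_on_complex_divide:
  fixes f :: "'a::real_normed_vector \<Rightarrow> complex"
  shows "open S \<Longrightarrow> smooth_on S f \<Longrightarrow> smooth_on S (\<lambda>x. f x / c)"
  by (rule smooth_on_bounded_linear[OF bounded_linear_divide])

lemma smooth_on_wirtinger: "open S \<Longrightarrow> smooth_on S F \<Longrightarrow> smooth_on S (wirtinger s F)"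
  unfolding wirtinger_eq[abs_def]
  by (intro smooth_on_complex_divide smooth_on_add smooth_on_mult smooth_on_const smooth_on_frechet_derivative) auto

lemma wirtinger_cong:
  assumes "open S" "p \<in> S" "\<And>x. x \<in> S \<Longrightarrow> F x = G x" "smooth_on S F"
  shows "wirtinger s F p = wirtinger s G p"
  unfolding wirtinger_eq
  using frechet_derivative_transform_within_open[OF smooth_on_differentiable[OF assms(4,2)] assms(1,2,3)] by simp

lemma wirtinger_add:
  assumes "F differentiable at p" "G differentiable at p"
  shows "wirtinger s (\<lambda>x. F x + G x) p = wirtinger s F p + wirtinger s G p"
proof -
  have "((\<lambda>x. F x + G x) has_derivative (\<lambda>v. frechet_derivative F (at p) v + frechet_derivative G (at p) v)) (at p)"
    by (intro has_derivative_add assms[unfolded frechet_derivative_works])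
  from frechet_derivative_at[OF this, symmetric] show ?thesis
    by (simp add: wirtinger_eq field_simps)
qed

lemma wirtinger_mult:
  assumes "F differentiable at p" "G differentiable at p"
  shows "wirtinger s (\<lambda>x. F x * G x) p = wirtinger s F p * G p + F p * wirtinger s G p"
proof -
  have "((\<lambda>x. F x * G x) has_derivative (\<lambda>v. F p * frechet_derivative G (at p) v + frechet_derivative F (at p) v * G p)) (at p)"
    by (intro has_derivative_mult assms[unfolded frechet_derivative_works])
  from frechet_derivative_at[OF this, symmetric] show ?thesis
    by (simp add: wirtinger_eq field_simps)
qed

lemma wirtinger_const [simp]: "wirtinger s (\<lambda>x. c) p = 0"
  by (simp add: wirtinger_eq)

lemma wirtinger_cnj:
  assumes "F differentiable at p"
  shows "wirtinger (sum_swap s) (\<lambda>x. cnj (F x)) p = cnj (wirtinger s F p)"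
  unfolding wirtinger_eq frechet_derivative_bounded_linear_comp[OF bounded_linear_cnj assms]
  by (cases s) (simp_all add: wirtinger_sign_def base_index_def sum_swap_def)

lemma wirtinger_commute:
  assumes F: "smooth_on S F" and S: "open S" "p \<in> S"
  shows "wirtinger s (wirtinger t F) p = wirtinger t (wirtinger s F) p"
proof -
  let ?D = "\<lambda>v F x. frechet_derivative F (at x) v" and ?k = wirtinger_sign
  let ?a = "\<lambda>s. axis (base_index s) 1" and ?b = "\<lambda>s. axis (base_index s) \<i>"
  have D: "?D v (wirtinger t F) p = (?D v (?D (?a t) F) p + ?k t * ?D v (?D (?b t) F) p) / 2" for v t
  proof -
    note d = smooth_on_differentiable[OF smooth_on_frechet_derivative[OF F] S(2), unfolded frechet_derivative_works]
    have "(wirtinger t F has_derivative (\<lambda>v. (?D v (?D (?a t) F) p + ?k t * ?D v (?D (?b t) F) p) / 2)) (at p)"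
      unfolding wirtinger_eq[abs_def]
      by (intro bounded_linear.has_derivative[OF bounded_linear_divide] has_derivative_add
          bounded_linear.has_derivative[OF bounded_linear_mult_right] d)
    from fun_cong[OF frechet_derivative_at[OF this], of v] show ?thesis by simp
  qed
  show ?thesis
    unfolding wirtinger_eq[of s "wirtinger t F"] wirtinger_eq[of t "wirtinger s F"] D
      frechet_derivative_commute[OF F S, of "axis (base_index t) _" "axis (base_index s) _"]
    by (simp add: field_simps)
qed

section \<open>Germs at the origin and their Taylor series\<close>

definition smooth_near_0 :: "(complex^'N::finite \<Rightarrow> complex) \<Rightarrow> bool" where
  "smooth_near_0 F \<longleftrightarrow> (\<exists>S. open S \<and> 0 \<in> S \<and> smooth_on S F)"

lemma smooth_near_0_pair:
  assumes "smooth_near_0 F" "smooth_near_0 G"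
  obtains S where "open S" "0 \<in> S" "smooth_on S F" "smooth_on S G"
proof -
  from assms obtain S T where "open S" "0 \<in> S" "smooth_on S F" "open T" "0 \<in> T" "smooth_on T G"
    by (auto simp: smooth_near_0_def)
  then show ?thesis
    by (intro that[of "S \<inter> T"]) (auto intro: smooth_on_subset)
qed

lemma smooth_near_0_add: "smooth_near_0 F \<Longrightarrow> smooth_near_0 G \<Longrightarrow> smooth_near_0 (\<lambda>x. F x + G x)"
  by (erule (1) smooth_near_0_pair) (auto simp: smooth_near_0_def intro: smooth_on_add)

lemma smooth_near_0_mult: "smooth_near_0 F \<Longrightarrow> smooth_near_0 G \<Longrightarrow> smooth_near_0 (\<lambda>x. F x * G x)"
  by (erule (1) smooth_near_0_pair) (auto simp: smooth_near_0_def intro: smooth_on_mult)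

lemma smooth_near_0_const: "smooth_near_0 (\<lambda>x. c)"
  by (auto simp: smooth_near_0_def intro: smooth_on_const exI[of _ UNIV])

lemma smooth_near_0_sum: "(\<And>i. i \<in> A \<Longrightarrow> smooth_near_0 (F i)) \<Longrightarrow> smooth_near_0 (\<lambda>x. \<Sum>i\<in>A. F i x)"
  by (induction A rule: infinite_finite_induct) (auto intro: smooth_near_0_add smooth_near_0_const)

lemma smooth_near_0_diff:
  assumes "smooth_near_0 F" "smooth_near_0 G" shows "smooth_near_0 (\<lambda>x. F x - G x)"
  using smooth_near_0_add[OF assms(1) smooth_near_0_mult[OF smooth_near_0_const[of "-1"] assms(2)]] by simp

lemma smooth_near_0_wirtinger: "smooth_near_0 F \<Longrightarrow> smooth_near_0 (wirtinger s F)"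
  by (auto simp: smooth_near_0_def intro: smooth_on_wirtinger)

lemma smooth_near_0_differentiable: "smooth_near_0 F \<Longrightarrow> F differentiable at 0"
  by (auto simp: smooth_near_0_def intro: smooth_on_differentiable)

lemma smooth_on_foldr_wirtinger: "open S \<Longrightarrow> smooth_on S F \<Longrightarrow> smooth_on S (foldr wirtinger is F)"
  by (induction "is") (auto intro: smooth_on_wirtinger)

lemma foldr_wirtinger_cong:
  assumes "open S" "\<And>x. x \<in> S \<Longrightarrow> F x = G x" "smooth_on S F" "p \<in> S"
  shows "foldr wirtinger is F p = foldr wirtinger is G p"
  using assms(4)
proof (induction "is" arbitrary: p)
  case (Cons s "is")
  then show ?case
    using wirtinger_cong[OF assms(1) Cons.prems Cons.IH smooth_on_foldr_wirtinger[OF assms(1,3)]] by simp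
qed (use assms in simp)

lemma foldr_wirtinger_mset:
  assumes F: "smooth_on S F" and S: "open S" "p \<in> S" and "mset xs = mset ys"
  shows "foldr wirtinger xs F p = foldr wirtinger ys F p"
proof (rule swap_invariant_imp_mset_invariant[where \<phi> = "\<lambda>xs. foldr wirtinger xs F p" and M = "mset xs"])
  fix As x y Bs
  let ?G = "foldr wirtinger Bs F"
  have G: "smooth_on S ?G" by (rule smooth_on_foldr_wirtinger[OF S(1) F])
  have "foldr wirtinger As (wirtinger x (wirtinger y ?G)) p = foldr wirtinger As (wirtinger y (wirtinger x ?G)) p"
    by (rule foldr_wirtinger_cong[OF S(1) wirtinger_commute[OF G S(1)] _ S(2)])
       (auto intro: smooth_on_wirtinger S G)
  then show "foldr wirtinger (As @ x # y # Bs) F p = foldr wirtinger (As @ y # x # Bs) F p" by simp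
qed (use assms in auto)

text \<open>The list of directions chosen inside \<open>taylor0\<close> may be replaced by any other
  with the same counts, because Wirtinger derivatives of smooth functions commute; the factorials
  cancel against those of formal differentiation. With \<open>mfps_eq_by_derivs\<close> this is the
  working description of Taylor series.\<close>

lemma taylor0_deriv:
  assumes "smooth_near_0 F"
  shows "mfps_const_coeff (foldr mfps_pderiv is (taylor0 F)) = foldr wirtinger is F 0"
proof -
  obtain S where S: "open S" "0 \<in> S" "smooth_on S F" using assms by (auto simp: smooth_near_0_def)
  let ?m = "list_exponent is"
  define L where "L = (SOME ss. \<forall>s. count_list ss s = Poly_Mapping.lookup ?m s)"
  have "\<forall>s. count_list L s = Poly_Mapping.lookup ?m s"
    unfolding L_def by (rule someI_ex[OF ex_list_with_counts])
  then have "mset L = mset is" by (simp flip: count_list_eq_mset)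
  then have "foldr wirtinger L F 0 = foldr wirtinger is F 0"
    by (rule foldr_wirtinger_mset[OF S(3,1,2)])
  moreover have "(\<Prod>s\<in>Poly_Mapping.keys ?m. fact (Poly_Mapping.lookup ?m s)) = mfact ?m"
    unfolding mfact_def by (rule prod.mono_neutral_left) (auto simp: count_list_0_iff)
  ultimately have "mfps_coeff (taylor0 F) ?m = foldr wirtinger is F 0 / mfact ?m"
    by (simp add: taylor0_def L_def)
  then show ?thesis by (simp add: const_coeff_foldr_pderiv)
qed

lemma mfps_eq_by_derivs:
  assumes "\<And>is. mfps_const_coeff (foldr mfps_pderiv is f) = mfps_const_coeff (foldr mfps_pderiv is g)"
  shows "f = (g :: ('s::finite, complex) mfps)"
proof (rule mfps_eqI)
  fix m :: "'s \<Rightarrow>\<^sub>0 nat"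
  obtain "is" where "\<And>s. count_list is s = Poly_Mapping.lookup m s"
    using ex_list_with_counts by blast
  then have "m = list_exponent is" by (intro poly_mapping_eqI) simp
  then show "mfps_coeff f m = mfps_coeff g m"
    using assms[of "is"] by (simp add: const_coeff_foldr_pderiv)
qed

lemma taylor0_const_coeff: "smooth_near_0 F \<Longrightarrow> mfps_const_coeff (taylor0 F) = F 0"
  using taylor0_deriv[of F "[]"] by simp

lemma taylor0_cong:
  assumes "open S" "0 \<in> S" "smooth_on S F" "\<And>x. x \<in> S \<Longrightarrow> F x = G x"
  shows "taylor0 F = taylor0 G"
proof (rule mfps_eq_by_derivs)
  fix "is"
  have "smooth_on S G" by (rule smooth_on_cong[OF assms(1) assms(4) assms(3)])
  then have "smooth_near_0 F" "smooth_near_0 G" using assms by (auto simp: smooth_near_0_def)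
  then show "mfps_const_coeff (foldr mfps_pderiv is (taylor0 F)) = mfps_const_coeff (foldr mfps_pderiv is (taylor0 G))"
    using foldr_wirtinger_cong[OF assms(1,4,3,2)] by (simp add: taylor0_deriv)
qed

lemma taylor0_wirtinger:
  assumes "smooth_near_0 F" shows "mfps_pderiv s (taylor0 F) = taylor0 (wirtinger s F)"
proof (rule mfps_eq_by_derivs)
  fix "is"
  show "mfps_const_coeff (foldr mfps_pderiv is (mfps_pderiv s (taylor0 F)))
      = mfps_const_coeff (foldr mfps_pderiv is (taylor0 (wirtinger s F)))"
    using taylor0_deriv[OF assms, of "is @ [s]"] taylor0_deriv[OF smooth_near_0_wirtinger[OF assms], of "is" s] by simp
qed

lemma taylor0_const: "taylor0 (\<lambda>x. c) = mfps_const c"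
proof (rule mfps_eq_by_derivs)
  fix "is" :: "('a + 'a) list"
  have fw: "foldr wirtinger is (\<lambda>x. 0) = (\<lambda>x. 0 :: complex)" for "is" :: "('a + 'a) list"
    by (induction "is") auto
  have fp: "foldr mfps_pderiv is 0 = 0" for "is" :: "('a + 'a) list"
    by (induction "is") auto
  show "mfps_const_coeff (foldr mfps_pderiv is (taylor0 (\<lambda>x. c))) = mfps_const_coeff (foldr mfps_pderiv is (mfps_const c))"
    unfolding taylor0_deriv[OF smooth_near_0_const]
  proof (cases "is" rule: rev_cases)
    case (snoc js s)
    have "wirtinger s (\<lambda>x. c) = (\<lambda>x. 0)" by (rule ext) simp
    then show "foldr wirtinger is (\<lambda>x. c) 0 = mfps_const_coeff (foldr mfps_pderiv is (mfps_const c))"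
      using snoc by (simp add: fw fp)
  qed (simp add: mfps_coeff_const)
qed

lemma foldr_pderiv_add: "foldr mfps_pderiv is (f + g) = foldr mfps_pderiv is f + foldr mfps_pderiv is g"
  by (induction "is") (auto simp: mfps_pderiv_add)

lemma taylor0_wirtinger_add:
  assumes "smooth_near_0 F" "smooth_near_0 G"
  shows "taylor0 (wirtinger s (\<lambda>x. F x + G x)) = taylor0 (\<lambda>x. wirtinger s F x + wirtinger s G x)"
  using assms
proof (rule smooth_near_0_pair)
  fix S assume S: "open S" "0 \<in> S" "smooth_on S F" "smooth_on S G"
  show ?thesis
    by (rule taylor0_cong[OF S(1,2)])
       (use S in \<open>auto intro: smooth_on_wirtinger smooth_on_add wirtinger_add smooth_on_differentiable\<close>)
qed

lemma taylor0_wirtinger_mult: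
  assumes "smooth_near_0 F" "smooth_near_0 G"
  shows "taylor0 (wirtinger s (\<lambda>x. F x * G x)) = taylor0 (\<lambda>x. wirtinger s F x * G x + F x * wirtinger s G x)"
  using assms
proof (rule smooth_near_0_pair)
  fix S assume S: "open S" "0 \<in> S" "smooth_on S F" "smooth_on S G"
  show ?thesis
    by (rule taylor0_cong[OF S(1,2)])
       (use S in \<open>auto intro: smooth_on_wirtinger smooth_on_mult wirtinger_mult smooth_on_differentiable\<close>)
qed

lemma taylor0_add:
  assumes "smooth_near_0 F" "smooth_near_0 G"
  shows "taylor0 (\<lambda>x. F x + G x) = taylor0 F + taylor0 G"
proof (rule mfps_eq_by_derivs)
  fix "is"
  show "mfps_const_coeff (foldr mfps_pderiv is (taylor0 (\<lambda>x. F x + G x))) = mfps_const_coeff (foldr mfps_pderiv is (taylor0 F + taylor0 G))"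
    using assms
  proof (induction "is" arbitrary: F G rule: rev_induct)
    case Nil
    then show ?case by (simp add: taylor0_const_coeff smooth_near_0_add)
  next
    case (snoc s "is")
    then show ?case
      by (simp add: taylor0_wirtinger mfps_pderiv_add smooth_near_0_add taylor0_wirtinger_add smooth_near_0_wirtinger)
  qed
qed

lemma taylor0_mult:
  assumes "smooth_near_0 F" "smooth_near_0 G"
  shows "taylor0 (\<lambda>x. F x * G x) = taylor0 F * taylor0 G"
proof (rule mfps_eq_by_derivs)
  fix "is"
  show "mfps_const_coeff (foldr mfps_pderiv is (taylor0 (\<lambda>x. F x * G x))) = mfps_const_coeff (foldr mfps_pderiv is (taylor0 F * taylor0 G))"
    using assms
  \<comment> \<open>Induction from the right: the last direction acts first, directly on the series,
    where \<open>taylor0_wirtinger\<close> trades it for a Wirtinger derivative and the product rule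
    gives two products of the same shape.\<close>
  proof (induction "is" arbitrary: F G rule: rev_induct)
    case Nil
    then show ?case by (simp add: taylor0_const_coeff smooth_near_0_mult)
  next
    case (snoc s "is")
    then show ?case
      by (simp add: taylor0_wirtinger mfps_pderiv_mult smooth_near_0_mult taylor0_wirtinger_mult
          smooth_near_0_wirtinger taylor0_add foldr_pderiv_add)
  qed
qed

lemma taylor0_sum:
  "(\<And>i. i \<in> A \<Longrightarrow> smooth_near_0 (F i)) \<Longrightarrow> taylor0 (\<lambda>x. \<Sum>i\<in>A. F i x) = (\<Sum>i\<in>A. taylor0 (F i))"
  by (induction A rule: infinite_finite_induct) (auto simp: taylor0_const taylor0_add smooth_near_0_sum)

lemma taylor0_scale: "smooth_near_0 F \<Longrightarrow> taylor0 (\<lambda>x. c * F x) = mfps_const c * taylor0 F"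
  by (simp add: taylor0_mult smooth_near_0_const taylor0_const)

lemma taylor0_diff:
  assumes "smooth_near_0 F" "smooth_near_0 G"
  shows "taylor0 (\<lambda>x. F x - G x) = taylor0 F - taylor0 G"
proof -
  have "taylor0 (\<lambda>x. (F x - G x) + G x) = taylor0 (\<lambda>x. F x - G x) + taylor0 G"
    by (rule taylor0_add[OF smooth_near_0_diff[OF assms] assms(2)])
  then show ?thesis by (simp add: algebra_simps)
qed

text \<open>Conjugating an iterated Wirtinger derivative of a real function exchanges the directions
  Z and Z-bar. On the complexification this is the reality condition that relates \<rho>(Z, \<zeta>)
  to its conjugate with the arguments interchanged.\<close>

lemma taylor0_real:
  fixes r :: "complex^'N::finite \<Rightarrow> real"
  assumes "smooth_near_0 (\<lambda>z. complex_of_real (r z))"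
  shows "mfps_coeff (mfps_cnj (taylor0 (\<lambda>z. complex_of_real (r z)))) m
       = mfps_coeff (taylor0 (\<lambda>z. complex_of_real (r z))) (exponent_swap m)"
proof -
  let ?r = "\<lambda>z. complex_of_real (r z)"
  obtain S where S: "open S" "0 \<in> S" "smooth_on S ?r" using assms by (auto simp: smooth_near_0_def)
  have conj: "foldr wirtinger (map sum_swap is) ?r p = cnj (foldr wirtinger is ?r p)" if "p \<in> S" for "is" p
    using that
  proof (induction "is" arbitrary: p)
    case (Cons s "is")
    let ?F = "foldr wirtinger is ?r"
    have "wirtinger (sum_swap s) (foldr wirtinger (map sum_swap is) ?r) p = wirtinger (sum_swap s) (\<lambda>x. cnj (?F x)) p"
      by (rule wirtinger_cong[OF S(1) Cons.prems Cons.IH smooth_on_foldr_wirtinger[OF S(1,3)]])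
    also have "\<dots> = cnj (wirtinger s ?F p)"
      by (rule wirtinger_cnj[OF smooth_on_differentiable[OF smooth_on_foldr_wirtinger[OF S(1,3)] Cons.prems]])
    finally show ?case by simp
  qed simp
  obtain "is" where "\<And>s. count_list is s = Poly_Mapping.lookup m s"
    using ex_list_with_counts by blast
  then have m: "m = list_exponent is" by (intro poly_mapping_eqI) simp
  have "count_list (map sum_swap is) s = count_list is (sum_swap s)" for s
    by (induction "is") auto
  then have m': "exponent_swap m = list_exponent (map sum_swap is)"
    unfolding m by (intro poly_mapping_eqI) simp
  have "mfact (list_exponent (map sum_swap is)) = mfact m"
    unfolding m'[symmetric] mfact_def
    by (rule prod.reindex_bij_witness[where i = sum_swap and j = sum_swap]) auto
  then have "mfact m * mfps_coeff (taylor0 ?r) (exponent_swap m) = cnj (mfact m * mfps_coeff (taylor0 ?r) m)"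
    using conj[OF S(2), of "is"] unfolding taylor0_deriv[OF assms, symmetric] const_coeff_foldr_pderiv m'[symmetric]
    by (simp add: m)
  moreover have "cnj (mfact m) = mfact m" by (simp add: mfact_def)
  ultimately show ?thesis by simp
qed

section \<open>Taylor series of vector fields\<close>

definition taylor_field :: "'N::finite cfield \<Rightarrow> 'N + 'N \<Rightarrow> ('N + 'N, complex) mfps" where
  "taylor_field X s = taylor0 (\<lambda>p. X p $ s)"

definition smooth_field :: "'N::finite cfield \<Rightarrow> bool" where
  "smooth_field X \<longleftrightarrow> (\<forall>s. smooth_near_0 (\<lambda>p. X p $ s))"

lemma smooth_near_0_field_apply:
  "smooth_field X \<Longrightarrow> smooth_near_0 F \<Longrightarrow> smooth_near_0 (field_apply X F)"
  unfolding field_apply_def[abs_def] smooth_field_def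
  by (intro smooth_near_0_sum smooth_near_0_mult smooth_near_0_wirtinger) auto

lemma taylor0_field_apply:
  assumes "smooth_field X" "smooth_near_0 F"
  shows "taylor0 (field_apply X F) = formal_apply (taylor_field X) (taylor0 F)"
  using assms unfolding field_apply_def[abs_def] smooth_field_def formal_apply_def taylor_field_def
  by (simp add: taylor0_sum taylor0_mult smooth_near_0_mult smooth_near_0_wirtinger taylor0_wirtinger)

lemma smooth_field_bracket: "smooth_field X \<Longrightarrow> smooth_field Y \<Longrightarrow> smooth_field (field_bracket X Y)"
  unfolding smooth_field_def[of "field_bracket X Y"] field_bracket_def vec_lambda_beta
  by (intro allI smooth_near_0_diff smooth_near_0_field_apply) (auto simp: smooth_field_def)

lemma taylor_field_bracket:
  assumes "smooth_field X" "smooth_field Y"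
  shows "taylor_field (field_bracket X Y) = formal_bracket (taylor_field X) (taylor_field Y)"
proof
  fix s
  have X: "smooth_near_0 (\<lambda>p. X p $ s)" and Y: "smooth_near_0 (\<lambda>p. Y p $ s)"
    using assms by (auto simp: smooth_field_def)
  have "taylor_field (field_bracket X Y) s
      = taylor0 (\<lambda>p. field_apply X (\<lambda>z. Y z $ s) p - field_apply Y (\<lambda>z. X z $ s) p)"
    by (simp add: taylor_field_def field_bracket_def)
  also have "\<dots> = formal_apply (taylor_field X) (taylor_field Y s) - formal_apply (taylor_field Y) (taylor_field X s)"
    by (subst taylor0_diff)
       (simp_all add: smooth_near_0_field_apply taylor0_field_apply assms X Y taylor_field_def[of X s] taylor_field_def[of Y s])
  finally show "taylor_field (field_bracket X Y) s = formal_bracket (taylor_field X) (taylor_field Y) s"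
    by (simp add: formal_bracket_def)
qed

lemma taylor_field_const_coeff: "smooth_field X \<Longrightarrow> mfps_const_coeff (taylor_field X s) = X 0 $ s"
  by (simp add: taylor_field_def taylor0_const_coeff smooth_field_def)

section \<open>Linear algebra and smooth fields\<close>

lemma independent_family_iff:
  assumes "finite I"
  shows "independent_family I v \<longleftrightarrow> (\<forall>c. (\<Sum>i\<in>I. c i *s v i) = 0 \<longrightarrow> (\<forall>i\<in>I. c i = 0))"
proof (intro iffI allI impI ballI)
  fix c i assume v: "independent_family I v" and c: "(\<Sum>i\<in>I. c i *s v i) = 0" and i: "i \<in> I"
  from v have inj: "inj_on v I" and ind: "vec.independent (v ` I)" by (auto simp: independent_family_def)
  let ?u = "\<lambda>w. c (the_inv_into I v w)"
  have "(\<Sum>w\<in>v ` I. ?u w *s w) = (\<Sum>i\<in>I. c i *s v i)"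
    by (subst sum.reindex[OF inj]) (simp add: the_inv_into_f_f[OF inj])
  then have "?u (v i) = 0"
    by (intro vec.independentD[OF ind, of "v ` I" ?u "v i"]) (use assms c i in auto)
  then show "c i = 0" by (simp add: the_inv_into_f_f[OF inj i])
next
  assume *: "\<forall>c. (\<Sum>i\<in>I. c i *s v i) = 0 \<longrightarrow> (\<forall>i\<in>I. c i = 0)"
  have inj: "inj_on v I"
  proof (rule inj_onI, rule ccontr)
    fix i j assume ij: "i \<in> I" "j \<in> I" "v i = v j" "i \<noteq> j"
    define c where "c k = (if k = i then 1 else if k = j then - 1 else (0 :: 'b))" for k
    have "(\<Sum>k\<in>I. c k *s v k) = (\<Sum>k\<in>{i, j}. c k *s v k)"
      by (rule sum.mono_neutral_right) (use assms ij in \<open>auto simp: c_def\<close>)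
    also have "\<dots> = 0" using ij by (simp add: c_def vec_eq_iff)
    finally have "c i = 0" using * ij by blast
    then show False by (simp add: c_def)
  qed
  have "vec.independent (v ` I)"
    unfolding vec.independent_explicit_module
  proof (intro allI impI)
    fix t u w assume t: "finite t" "t \<subseteq> v ` I" "(\<Sum>w\<in>t. u w *s w) = 0" "w \<in> t"
    define c where "c i = (if v i \<in> t then u (v i) else 0)" for i
    have "(\<Sum>i\<in>I. c i *s v i) = (\<Sum>x\<in>v ` I. (if x \<in> t then u x else 0) *s x)"
      by (simp add: sum.reindex[OF inj] c_def)
    also have "\<dots> = (\<Sum>x\<in>t. u x *s x)"
      by (rule sum.mono_neutral_cong_right) (use assms t in auto)
    finally have "\<forall>i\<in>I. c i = 0" using * t by auto
    moreover obtain i where "i \<in> I" "w = v i" using t by auto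
    ultimately show "u w = 0" using t by (auto simp: c_def)
  qed
  with inj show "independent_family I v" by (simp add: independent_family_def)
qed

text \<open>The pairing of a covector with a vector: bilinear, without the conjugation of a
  Hermitian product.\<close>

definition dot :: "'a::field ^ 'n \<Rightarrow> 'a ^ 'n \<Rightarrow> 'a" where
  "dot u w = (\<Sum>i\<in>UNIV. u $ i * w $ i)"

lemma dot_scale_right: "dot u (c *s w) = c * dot u w"
  by (simp add: dot_def sum_distrib_left mult_ac)

lemma dot_diff_right: "dot u (w - w') = dot u w - dot u w'"
  by (simp add: dot_def right_diff_distrib sum_subtractf)

lemma dot_add_right: "dot u (w + w') = dot u w + dot u w'"
  by (simp add: dot_def distrib_left sum.distrib)

text \<open>A basis of the span extended by \<open>x\<close> admits a linear map that is 0 on the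
  basis and has all components 1 at \<open>x\<close>. One component \<open>k\<close> of it is the
  desired functional, and its values on the coordinate vectors form \<open>w\<close>.\<close>

lemma ex_annihilator:
  fixes x :: "'a::field ^ 'n"
  assumes "x \<notin> vec.span S"
  shows "\<exists>w. (\<forall>v\<in>S. dot v w = 0) \<and> dot x w = 1"
proof -
  obtain B where B: "B \<subseteq> S" "vec.independent B" "S \<subseteq> vec.span B"
    using vec.maximal_independent_subset[of S] by blast
  have "x \<notin> vec.span B" using assms vec.span_mono[OF B(1)] by blast
  then have "vec.independent (insert x B)" "x \<notin> B"
    using B vec.span_base[of x B] by (auto simp: vec.independent_insert)
  then obtain g :: "'a ^ 'n \<Rightarrow> 'a ^ 'n" where g: "Vector_Spaces.linear (*s) (*s) g"
    and gB: "\<And>b. b \<in> insert x B \<Longrightarrow> g b = (if b = x then vec 1 else 0)"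
    using vec.linear_independent_extend[of "insert x B" "\<lambda>b. if b = x then vec 1 else 0"] by blast
  interpret g: Vector_Spaces.linear "(*s)" "(*s)" g by (rule g)
  obtain k :: 'n where True by simp
  define w where "w = (\<chi> i. g (axis i 1) $ k)"
  have dot: "dot v w = g v $ k" for v
  proof -
    have "g v = g (\<Sum>i\<in>UNIV. v $ i *s axis i 1)" by (simp add: basis_expansion)
    also have "\<dots> = (\<Sum>i\<in>UNIV. v $ i *s g (axis i 1))" by (simp add: g.sum g.scale)
    finally show ?thesis by (simp add: dot_def w_def)
  qed
  have "g v = 0" if "v \<in> S" for v
  proof -
    have "v \<in> vec.span B" using B(3) that by blast
    then show ?thesis
    proof (induction rule: vec.span_induct_alt)
      case base
      then show ?case by (rule g.zero)
    next
      case (step c b y)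
      then show ?case using gB[of b] \<open>x \<notin> B\<close> by (auto simp: g.add g.scale)
    qed
  qed
  then show ?thesis using gB[of x] by (intro exI[of _ w]) (simp add: dot)
qed

lemma independent_family_ex_dual:
  assumes "independent_family {..<Suc d} \<omega>"
  shows "\<exists>w. (\<forall>k<d. dot (\<omega> k) w = 0) \<and> dot (\<omega> d) w = 1"
proof -
  from assms have inj: "inj_on \<omega> {..<Suc d}" and ind: "vec.independent (insert (\<omega> d) (\<omega> ` {..<d}))"
    by (auto simp: independent_family_def lessThan_Suc)
  have "\<omega> d \<notin> \<omega> ` {..<d}"
  proof
    assume "\<omega> d \<in> \<omega> ` {..<d}"
    then obtain k where "k < d" "\<omega> d = \<omega> k" by auto
    with inj_onD[OF inj, of d k] show False by simp
  qed
  with ind have "\<omega> d \<notin> vec.span (\<omega> ` {..<d})" by (simp add: vec.independent_insert)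
  from ex_annihilator[OF this] show ?thesis by auto
qed

text \<open>A reduced echelon form. \<open>U\<close> is a smallest set of coordinates determining
  the elements of \<open>W\<close>; minimality at \<open>i\<close> provides an element that vanishes
  on the rest of \<open>U\<close> but not at \<open>i\<close>, and it is then normalised.\<close>

lemma ex_coordinate_basis:
  fixes W :: "('a::field ^ 'n) set"
  assumes W: "vec.subspace W"
  obtains U b where "\<And>i. i \<in> U \<Longrightarrow> b i \<in> W"
    and "\<And>i j. i \<in> U \<Longrightarrow> j \<in> U \<Longrightarrow> b i $ j = (if j = i then 1 else 0)"
    and "\<And>w. w \<in> W \<Longrightarrow> w = (\<Sum>i\<in>U. w $ i *s b i)"
proof -
  define P where "P U \<longleftrightarrow> (\<forall>w\<in>W. (\<forall>i\<in>U. w $ i = 0) \<longrightarrow> w = 0)" for U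
  have "P UNIV" by (auto simp: P_def vec_eq_iff)
  then obtain U where U: "P U" and min: "\<And>V. P V \<Longrightarrow> card U \<le> card V"
    using ex_has_least_nat[of P UNIV card] by blast
  have "\<exists>b\<in>W. \<forall>j\<in>U. b $ j = (if j = i then 1 else 0)" if i: "i \<in> U" for i
  proof -
    have "card (U - {i}) < card U" using i by (intro card_Diff1_less) auto
    then have "\<not> P (U - {i})" using min leD by blast
    then obtain w where w: "w \<in> W" "\<And>j. j \<in> U - {i} \<Longrightarrow> w $ j = 0" "w \<noteq> 0" by (auto simp: P_def)
    then have "w $ i \<noteq> 0" using U i by (auto simp: P_def)
    with w show ?thesis
      by (intro bexI[of _ "(1 / w $ i) *s w"]) (auto intro: vec.subspace_scale[OF W])
  qed
  then obtain b where b: "\<And>i. i \<in> U \<Longrightarrow> b i \<in> W" "\<And>i j. i \<in> U \<Longrightarrow> j \<in> U \<Longrightarrow> b i $ j = (if j = i then 1 else 0)"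
    by metis
  have "w = (\<Sum>i\<in>U. w $ i *s b i)" if w: "w \<in> W" for w
  proof -
    have "w - (\<Sum>i\<in>U. w $ i *s b i) \<in> W"
      by (intro vec.subspace_diff[OF W w] vec.subspace_sum[OF W] vec.subspace_scale[OF W] b)
    moreover have "(w - (\<Sum>i\<in>U. w $ i *s b i)) $ j = 0" if "j \<in> U" for j
      using that by (simp add: b if_distrib cong: if_cong)
    ultimately have "w - (\<Sum>i\<in>U. w $ i *s b i) = 0" using U unfolding P_def by blast
    then show ?thesis by simp
  qed
  with b show ?thesis by (intro that)
qed

lemma subspace_annihilator: "vec.subspace {w. \<forall>k<d. dot (\<omega> k) w = 0}"
  by (intro vec.subspaceI) (auto simp: dot_add_right dot_scale_right dot_def[of _ 0])

text \<open>The covectors \<open>\<omega> k\<close> and the coordinate covectors from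
  \<open>U\<close> annihilate no common nonzero vector, so by \<open>ex_annihilator\<close> they
  span the whole space.\<close>

lemma card_annihilator_coordinates:
  fixes \<omega> :: "nat \<Rightarrow> 'a::field ^ 'n"
  assumes "\<And>w. (\<And>k. k < d \<Longrightarrow> dot (\<omega> k) w = 0) \<Longrightarrow> w = (\<Sum>i\<in>U. w $ i *s b i)"
  shows "CARD('n) \<le> d + card U"
proof -
  let ?A = "\<omega> ` {..<d} \<union> (\<lambda>i. axis i 1) ` U"
  have "x \<in> vec.span ?A" for x
  proof (rule ccontr)
    assume "x \<notin> vec.span ?A"
    from ex_annihilator[OF this] obtain w where w: "\<forall>v\<in>?A. dot v w = 0" "dot x w = 1" by blast
    have dot_axis: "dot (axis i 1) w = w $ i" for i
      by (simp add: dot_def axis_def if_distrib[of "\<lambda>x. x * _"] cong: if_cong)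
    have "w $ i = 0" if "i \<in> U" for i
      using w(1) that unfolding dot_axis[symmetric] by blast
    then have "w = 0" using assms[of w] w(1) by simp
    with w(2) show False by (simp add: dot_def)
  qed
  then have "vec.dim (UNIV :: ('a ^ 'n) set) \<le> card ?A"
    by (intro vec.dim_le_card) auto
  also have "\<dots> \<le> card (\<omega> ` {..<d}) + card ((\<lambda>i. axis i 1 :: 'a ^ 'n) ` U)" by (rule card_Un_le)
  also have "\<dots> \<le> d + card U"
    using card_image_le[of "{..<d}" \<omega>] card_image_le[of U "\<lambda>i. axis i 1 :: 'a ^ 'n"] by simp
  finally show ?thesis by (simp only: vec_dim_card)
qed

text \<open>Block triangularity: the \<open>Inl\<close>-coordinates in \<open>U\<close> detect the
  \<open>E i\<close> alone, and once these are gone the \<open>Inr\<close>-coordinates in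
  \<open>V\<close> detect the \<open>F i\<close>.\<close>

lemma card_le_dim_graph:
  fixes H0 :: "('a::field ^ ('n::finite + 'm::finite)) set"
  assumes E: "\<And>i. i \<in> U \<Longrightarrow> E i \<in> H0" "\<And>i j. i \<in> U \<Longrightarrow> j \<in> U \<Longrightarrow> E i $ Inl j = (if j = i then 1 else 0)"
    and F: "\<And>i. i \<in> V \<Longrightarrow> F i \<in> H0" "\<And>i j. i \<in> V \<Longrightarrow> j \<in> V \<Longrightarrow> F i $ Inr j = (if j = i then 1 else 0)"
      "\<And>i j. i \<in> V \<Longrightarrow> F i $ Inl j = 0"
  shows "card U + card V \<le> vec.dim H0"
proof -
  let ?v = "case_sum E F" and ?I = "U <+> V"
  have "independent_family ?I ?v"
  proof (subst independent_family_iff, simp, intro allI impI)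
    fix c assume c: "(\<Sum>s\<in>?I. c s *s ?v s) = 0"
    then have sum: "(\<Sum>i\<in>U. c (Inl i) *s E i) + (\<Sum>i\<in>V. c (Inr i) *s F i) = 0"
      by (simp add: sum.Plus)
    have U: "c (Inl j) = 0" if "j \<in> U" for j
    proof -
      have "((\<Sum>i\<in>U. c (Inl i) *s E i) + (\<Sum>i\<in>V. c (Inr i) *s F i)) $ Inl j = c (Inl j)"
        using that by (simp add: E F if_distrib cong: if_cong)
      then show ?thesis using sum by simp
    qed
    have V: "c (Inr j) = 0" if "j \<in> V" for j
    proof -
      have "((\<Sum>i\<in>U. c (Inl i) *s E i) + (\<Sum>i\<in>V. c (Inr i) *s F i)) $ Inr j = c (Inr j)"
        using that by (simp add: U F if_distrib cong: if_cong)
      then show ?thesis using sum by simp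
    qed
    from U V show "\<forall>i\<in>?I. c i = 0" by auto
  qed
  then have "inj_on ?v ?I" "vec.independent (?v ` ?I)" by (auto simp: independent_family_def)
  moreover have "?v ` ?I \<subseteq> H0" using E F by auto
  ultimately have "card ?I \<le> vec.dim H0"
    using vec.independent_card_le_dim[of "?v ` ?I" H0] by (simp add: card_image)
  then show ?thesis by (simp add: card_Plus)
qed

section \<open>Smooth vector functions annihilated by varying covectors\<close>

lemma smooth_near_0_dot:
  "(\<And>i. smooth_near_0 (\<lambda>p. u p $ i)) \<Longrightarrow> (\<And>i. smooth_near_0 (\<lambda>p. w p $ i)) \<Longrightarrow> smooth_near_0 (\<lambda>p. dot (u p) (w p))"
  unfolding dot_def by (intro smooth_near_0_sum smooth_near_0_mult)

text \<open>Solving the equations one at a time: \<open>b\<close> is transversal to the last equation and satisfies the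
  others, and the combination below needs no division.\<close>

lemma ex_smooth_annihilator:
  fixes \<omega> :: "nat \<Rightarrow> complex ^ 'N::finite \<Rightarrow> complex ^ 'N"
  assumes "\<And>k i. k < d \<Longrightarrow> smooth_near_0 (\<lambda>p. \<omega> k p $ i)"
    and "independent_family {..<d} (\<lambda>k. \<omega> k 0)"
    and "\<And>k. k < d \<Longrightarrow> dot (\<omega> k 0) v = 0"
  shows "\<exists>a. (\<forall>i. smooth_near_0 (\<lambda>p. a p $ i)) \<and> a 0 = v \<and> (\<forall>p. \<forall>k<d. dot (\<omega> k p) (a p) = 0)"
  using assms
proof (induction d arbitrary: v)
  case 0
  then show ?case by (intro exI[of _ "\<lambda>_. v"]) (auto intro: smooth_near_0_const)
next
  case (Suc d)
  have "independent_family {..<d} (\<lambda>k. \<omega> k 0)"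
    using Suc.prems(2) vec.independent_mono[OF _ image_mono] inj_on_subset
    unfolding independent_family_def by (metis lessThan_Suc subset_insertI)
  note IH = Suc.IH[OF _ this]
  obtain B where B: "\<And>k. k < d \<Longrightarrow> dot (\<omega> k 0) B = 0" "dot (\<omega> d 0) B = 1"
    using independent_family_ex_dual[OF Suc.prems(2)] by blast
  obtain a where a: "\<And>i. smooth_near_0 (\<lambda>p. a p $ i)" "a 0 = v" "\<And>p k. k < d \<Longrightarrow> dot (\<omega> k p) (a p) = 0"
    using IH[of v] Suc.prems by auto
  obtain b where b: "\<And>i. smooth_near_0 (\<lambda>p. b p $ i)" "b 0 = B" "\<And>p k. k < d \<Longrightarrow> dot (\<omega> k p) (b p) = 0"
    using IH[of B] Suc.prems B by auto
  let ?a = "\<lambda>p. dot (\<omega> d p) (b p) *s a p - dot (\<omega> d p) (a p) *s b p"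
  show ?case
  proof (intro exI[of _ ?a] conjI allI impI)
    fix i
    show "smooth_near_0 (\<lambda>p. ?a p $ i)"
      by (simp, intro smooth_near_0_diff smooth_near_0_mult smooth_near_0_dot a b Suc.prems) auto
  next
    show "?a 0 = v" using Suc.prems(3)[of d] by (simp add: a b B)
  next
    fix p k assume "k < Suc d"
    then show "dot (\<omega> k p) (?a p) = 0"
      by (auto simp: less_Suc_eq dot_diff_right dot_scale_right a b)
  qed
qed

lemma smooth_on_componentwise:
  fixes X :: "complex ^ 'N::finite \<Rightarrow> complex ^ 'm::finite"
  assumes "\<And>s. smooth_near_0 (\<lambda>p. X p $ s)"
  shows "\<exists>S. open S \<and> 0 \<in> S \<and> smooth_on S X"
proof -
  obtain T where T: "\<And>s. open (T s)" "\<And>s. 0 \<in> T s" "\<And>s. smooth_on (T s) (\<lambda>p. X p $ s)"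
    using assms unfolding smooth_near_0_def by metis
  let ?S = "\<Inter>s. T s"
  have S: "open ?S" "0 \<in> ?S" using T by auto
  have lin: "bounded_linear (axis s :: complex \<Rightarrow> complex ^ 'm)" for s
    unfolding linear_conv_bounded_linear[symmetric]
    by (intro linearI) (auto simp: vec_eq_iff axis_def)
  have "smooth_on ?S (\<lambda>p. \<Sum>s\<in>UNIV. axis s (X p $ s))"
    by (intro smooth_on_sum S(1) smooth_on_bounded_linear[OF lin S(1)] smooth_on_subset[OF T(3)]) auto
  moreover have "(\<lambda>p. \<Sum>s\<in>UNIV. axis s (X p $ s)) = X"
    by (rule ext) (simp add: vec_eq_iff axis_def)
  ultimately show ?thesis using S by auto
qed

section \<open>Segre mappings of a generic submanifold\<close>

lemma lie_algebra_generated_mono: "X \<in> lie_algebra_generated G \<Longrightarrow> G \<subseteq> G' \<Longrightarrow> X \<in> lie_algebra_generated G'"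
  by (induction rule: lie_algebra_generated.induct) (auto intro: lie_algebra_generated.intros)

locale generic_manifold =
  fixes M :: "(complex^'N::finite) set" and d :: nat and r :: "nat \<Rightarrow> complex^'N \<Rightarrow> real"
  assumes M0: "0 \<in> M" and def_fun: "defining_functions_near_0 M d r" and generic: "generic_at_0 d r"
begin

definition rc :: "nat \<Rightarrow> complex^'N \<Rightarrow> complex" where
  "rc k z = complex_of_real (r k z)"

definition \<rho> :: "nat \<Rightarrow> ('N + 'N, complex) mfps" where
  "\<rho> k = taylor0 (rc k)"

lemma rc_smooth: "k < d \<Longrightarrow> smooth_near_0 (rc k)"
  and rc_0: "k < d \<Longrightarrow> rc k 0 = 0"
proof -
  assume k: "k < d"
  obtain U where U: "open U" "0 \<in> U" "\<forall>k<d. smooth_on U (r k)" "M \<inter> U = {z \<in> U. \<forall>k<d. r k z = 0}"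
    using def_fun by (auto simp: defining_functions_near_0_def)
  have "smooth_on U (rc k)"
    unfolding rc_def[abs_def] using U k by (intro smooth_on_bounded_linear[OF bounded_linear_of_real]) auto
  then show "smooth_near_0 (rc k)" using U by (auto simp: smooth_near_0_def)
  have "0 \<in> M \<inter> U" using M0 U by auto
  then show "rc k 0 = 0" using U k by (auto simp: rc_def)
qed

lemma \<rho>_linear_coeff: "k < d \<Longrightarrow> mfps_coeff (\<rho> k) (Poly_Mapping.single s 1) = wirtinger s (rc k) 0"
  by (simp only: const_coeff_pderiv[symmetric] \<rho>_def taylor0_wirtinger rc_smooth taylor0_const_coeff smooth_near_0_wirtinger)

lemma differential_eq: "differential (r k) p $ s = wirtinger s (rc k) p"
  by (simp add: differential_def rc_def[abs_def])

text \<open>The dZ-part of the differential for \<open>L = Inl\<close> and the dZ-bar-part for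
  \<open>L = Inr\<close>. Keeping \<open>L\<close> as a parameter treats (1,0) and (0,1) fields, and
  both kinds of leaves, uniformly.\<close>

definition covector :: "('N \<Rightarrow> 'N + 'N) \<Rightarrow> nat \<Rightarrow> complex^'N \<Rightarrow> complex^'N" where
  "covector L k p = (\<chi> i. wirtinger (L i) (rc k) p)"

text \<open>Since \<open>r k\<close> is real, its dZ-bar-part is the conjugate of its dZ-part; a
  linear relation conjugates into one among the complex differentials, which are independent by
  genericity.\<close>

lemma covector_Inr_eq_0:
  assumes "(\<Sum>k<d. c k *s covector Inr k 0) = 0" "k < d"
  shows "c k = 0"
proof -
  have cnj_rc: "(\<lambda>x. cnj (rc k x)) = rc k" for k
    by (simp add: rc_def fun_eq_iff)
  have "wirtinger (Inr i) (rc k) 0 = cnj (wirtinger (Inl i) (rc k) 0)" if "k < d" for i k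
    using wirtinger_cnj[OF smooth_near_0_differentiable[OF rc_smooth[OF that]], of "Inl i"]
    by (simp only: cnj_rc sum_swap_def sum.case)
  then have "(\<Sum>k<d. c k * cnj (wirtinger (Inl i) (rc k) 0)) = 0" for i
    using arg_cong[OF assms(1), of "\<lambda>v. v $ i"] by (simp add: covector_def del: wirtinger.simps)
  from arg_cong[OF this, of cnj] have "(\<Sum>k<d. cnj (c k) *s complex_differential (r k) 0) = 0"
    by (simp add: vec_eq_iff complex_differential_def differential_eq)
  with generic have "cnj (c k) = 0"
    unfolding generic_at_0_def by (subst (asm) independent_family_iff) (use assms in auto)
  then show ?thesis by simp
qed

lemma covector_independent:
  assumes "L = Inl \<or> L = Inr"
  shows "independent_family {..<d} (\<lambda>k. covector L k 0)"
  using assms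
proof
  assume "L = Inl"
  then have "(\<lambda>k. covector L k 0) = (\<lambda>k. complex_differential (r k) 0)"
    by (auto simp: covector_def complex_differential_def differential_eq)
  with generic show ?thesis by (simp add: generic_at_0_def)
next
  assume "L = Inr"
  then show ?thesis using covector_Inr_eq_0 by (auto simp: independent_family_iff)
qed

text \<open>Only fields annihilating the \<open>r\<^sub>k\<close> on a full neighbourhood of the origin are used: their
  Taylor series then annihilate the \<open>\<rho>\<^sub>k\<close> exactly, with no ideal membership involved.\<close>

definition G :: "'N cfield set" where
  "G = {X \<in> type_10_near_0 \<union> type_01_near_0. \<exists>S. open S \<and> 0 \<in> S \<and> smooth_on S X \<and>
     (\<forall>p\<in>S. \<forall>k<d. field_apply X (rc k) p = 0)}"

definition H :: "('N + 'N \<Rightarrow> ('N + 'N, complex) mfps) set" where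
  "H = taylor_field ` lie_algebra_generated G"

lemma G_subset: "G \<subseteq> tangent_near_0 M d r \<inter> (type_10_near_0 \<union> type_01_near_0)"
  unfolding G_def tangent_near_0_def rc_def[abs_def] by blast

lemma smooth_on_imp_smooth_field:
  assumes "open S" "0 \<in> S" "smooth_on S X" shows "smooth_field X"
  unfolding smooth_field_def smooth_near_0_def
  using assms smooth_on_bounded_linear[OF bounded_linear_vec_nth assms(1,3)] by blast

lemma taylor_field_add:
  "smooth_field X \<Longrightarrow> smooth_field Y \<Longrightarrow> taylor_field (\<lambda>p. X p + Y p) = (\<lambda>s. taylor_field X s + taylor_field Y s)"
  by (rule ext) (simp add: taylor_field_def smooth_field_def taylor0_add)

lemma taylor_field_scale:
  "smooth_field X \<Longrightarrow> taylor_field (\<lambda>p. c *s X p) = (\<lambda>s. mfps_const c * taylor_field X s)"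
  by (rule ext) (simp add: taylor_field_def smooth_field_def taylor0_scale)

lemma taylor_field_zero: "taylor_field (\<lambda>p. 0) = (\<lambda>s. 0)"
  by (rule ext) (simp add: taylor_field_def taylor0_const)

lemma lie_smooth: "X \<in> lie_algebra_generated G \<Longrightarrow> smooth_field X"
proof (induction rule: lie_algebra_generated.induct)
  case (gen X)
  then show ?case by (auto simp: G_def intro: smooth_on_imp_smooth_field)
qed (auto simp: smooth_field_def smooth_near_0_const smooth_near_0_add smooth_near_0_mult
      intro: smooth_field_bracket[unfolded smooth_field_def, rule_format])

text \<open>The property passes from the generators to brackets because a bracket is a commutator of
  derivations.\<close>

lemma lie_annihilates:
  assumes k: "k < d"
  shows "X \<in> lie_algebra_generated G \<Longrightarrow> formal_apply (taylor_field X) (\<rho> k) = 0"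
proof (induction rule: lie_algebra_generated.induct)
  case (gen X)
  then obtain S where S: "open S" "0 \<in> S" "smooth_on S X" "\<forall>p\<in>S. \<forall>k<d. field_apply X (rc k) p = 0"
    by (auto simp: G_def)
  have "formal_apply (taylor_field X) (\<rho> k) = taylor0 (field_apply X (rc k))"
    unfolding \<rho>_def by (rule taylor0_field_apply[symmetric]) (use S k rc_smooth smooth_on_imp_smooth_field in auto)
  also have "\<dots> = taylor0 (\<lambda>p. 0)"
    by (rule taylor0_cong[symmetric, OF S(1,2) smooth_on_const]) (use S(4) k in auto)
  finally show ?case by (simp add: taylor0_const)
next
  case (add X Y)
  then show ?case by (simp add: taylor_field_add lie_smooth formal_apply_field_add)
next
  case (scale X c)
  then show ?case by (simp add: taylor_field_scale lie_smooth formal_apply_field_scale)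
next
  case (bracket X Y)
  then show ?case
    using formal_apply_formal_bracket[of "taylor_field X" "taylor_field Y" "\<rho> k"] by (simp add: taylor_field_bracket lie_smooth)
qed (simp add: taylor_field_zero)

sublocale formal_lie_algebra H
proof
  show "(\<lambda>s. 0) \<in> H"
    unfolding H_def taylor_field_zero[symmetric] by (intro imageI lie_algebra_generated.zero)
  fix X Y assume "X \<in> H" "Y \<in> H"
  then obtain X' Y' where X: "X' \<in> lie_algebra_generated G" "X = taylor_field X'"
    and Y: "Y' \<in> lie_algebra_generated G" "Y = taylor_field Y'" by (auto simp: H_def)
  show "(\<lambda>s. X s + Y s) \<in> H"
    unfolding H_def X Y taylor_field_add[OF lie_smooth[OF X(1)] lie_smooth[OF Y(1)], symmetric]
    by (intro imageI lie_algebra_generated.add X Y)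
  show "(\<lambda>s. mfps_const c * X s) \<in> H" for c
    unfolding H_def X taylor_field_scale[OF lie_smooth[OF X(1)], symmetric]
    by (intro imageI lie_algebra_generated.scale X)
  show "formal_bracket X Y \<in> H"
    unfolding H_def X Y taylor_field_bracket[OF lie_smooth[OF X(1)] lie_smooth[OF Y(1)], symmetric]
    by (intro imageI lie_algebra_generated.bracket X Y)
qed

lemma H_annihilates: "X \<in> H \<Longrightarrow> k < d \<Longrightarrow> formal_apply X (\<rho> k) = 0"
  by (auto simp: H_def lie_annihilates)

text \<open>In a nonempty word the field acting first already kills \<open>\<rho> k\<close>, and the
  empty word gives \<open>r k 0\<close>, which is 0 because the origin lies on
  \<open>M\<close>.\<close>

lemma \<rho>_in_orbit_ideal: "k < d \<Longrightarrow> \<rho> k \<in> orbit_ideal"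
  unfolding orbit_ideal_def
proof safe
  fix Xs assume k: "k < d" and Xs: "set Xs \<subseteq> H"
  show "formal_word Xs (\<rho> k) = 0"
  proof (cases Xs rule: rev_cases)
    case Nil
    then show ?thesis using k by (simp add: formal_word_def \<rho>_def taylor0_const_coeff rc_smooth rc_0)
  next
    case (snoc Ys X)
    then show ?thesis using Xs k by (simp add: formal_word_append H_annihilates)
  qed
qed

text \<open>The fields in \<open>G\<close> are tangent CR fields, so the smaller algebra evaluates
  inside g_M(0); the dimension count rests on this inclusion.\<close>

lemma H_value_in_cr: "X \<in> H \<Longrightarrow> (\<chi> s. mfps_const_coeff (X s)) \<in> cr_lie_algebra_at_0 M d r"
proof -
  assume "X \<in> H"
  then obtain Y where Y: "Y \<in> lie_algebra_generated G" "X = taylor_field Y" by (auto simp: H_def)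
  have "(\<chi> s. mfps_const_coeff (X s)) = Y 0"
    using Y lie_smooth by (simp add: vec_eq_iff taylor_field_const_coeff)
  moreover have "Y \<in> cr_lie_algebra M d r"
    unfolding cr_lie_algebra_def by (rule lie_algebra_generated_mono[OF Y(1) G_subset])
  ultimately show ?thesis by (auto simp: cr_lie_algebra_at_0_def)
qed

text \<open>By \<open>ex_smooth_annihilator\<close>, applied to the varying covectors, a tangent
  vector of type (1,0) or (0,1) at the origin extends to a smooth field of the same type that
  annihilates every \<open>r k\<close>; its Taylor series is the required element.\<close>

lemma ex_H_field:
  assumes L: "L = Inl \<or> L = Inr" and v: "\<And>k. k < d \<Longrightarrow> dot (covector L k 0) v = 0"
  shows "\<exists>X\<in>H. (\<forall>i. mfps_const_coeff (X (L i)) = v $ i) \<and> (\<forall>s. s \<notin> range L \<longrightarrow> X s = 0)"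
proof -
  have L_inj: "L i = L j \<longleftrightarrow> i = j" for i j using L by auto
  obtain a where a: "\<And>i. smooth_near_0 (\<lambda>p. a p $ i)" "a 0 = v" "\<And>p k. k < d \<Longrightarrow> dot (covector L k p) (a p) = 0"
    using ex_smooth_annihilator[of d "covector L" v] covector_independent[OF L] v
    by (auto simp: covector_def intro: smooth_near_0_wirtinger rc_smooth)
  define X :: "'N cfield" where "X p = (\<chi> s. \<Sum>i\<in>UNIV. if s = L i then a p $ i else 0)" for p
  have X_L: "X p $ L i = a p $ i" for p i
    by (simp add: X_def L_inj)
  have X_other: "X p $ s = 0" if "s \<notin> range L" for p s
    using that by (auto simp: X_def intro!: sum.neutral)
  have X_apply: "field_apply X F p = (\<Sum>i\<in>UNIV. a p $ i * wirtinger (L i) F p)" for F p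
  proof -
    have "field_apply X F p = (\<Sum>s\<in>range L. X p $ s * wirtinger s F p)"
      unfolding field_apply_def by (rule sum.mono_neutral_right) (auto simp: X_other)
    also have "\<dots> = (\<Sum>i\<in>UNIV. a p $ i * wirtinger (L i) F p)"
      by (subst sum.reindex) (auto simp: X_L inj_def L_inj)
    finally show ?thesis .
  qed
  have smooth: "smooth_near_0 (\<lambda>p. X p $ s)" for s
  proof (cases "s \<in> range L")
    case True
    then show ?thesis using a(1) by (auto simp: X_L)
  next
    case False
    then show ?thesis by (simp add: X_other smooth_near_0_const)
  qed
  have "X \<in> type_10_near_0 \<union> type_01_near_0"
    using L
  proof
    assume "L = Inl"
    then have "X p $ Inr i = 0" for p i by (intro X_other) auto
    then have "X \<in> type_10_near_0" by (simp add: type_10_near_0_def)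
    then show ?thesis ..
  next
    assume "L = Inr"
    then have "X p $ Inl i = 0" for p i by (intro X_other) auto
    then have "X \<in> type_01_near_0" by (simp add: type_01_near_0_def)
    then show ?thesis ..
  qed
  moreover have "field_apply X (rc k) p = 0" if "k < d" for p k
    using a(3)[OF that, of p] by (simp add: X_apply dot_def covector_def mult.commute)
  ultimately have "X \<in> G"
    using smooth_on_componentwise[of X, OF smooth] by (auto simp: G_def)
  then have "X \<in> lie_algebra_generated G" by (rule lie_algebra_generated.gen)
  moreover have "taylor_field X s = 0" if "s \<notin> range L" for s
    using that by (simp add: taylor_field_def X_other taylor0_const)
  ultimately show ?thesis
    using a(2) by (intro bexI[of _ "taylor_field X"]) (auto simp: H_def taylor_field_const_coeff lie_smooth X_L)
qed

text \<open>The (1,0) tangent space of \<open>M\<close> at the origin for \<open>L = Inl\<close>,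
  the (0,1) tangent space for \<open>L = Inr\<close>, in the coordinates of that type.\<close>

definition kernel :: "('N \<Rightarrow> 'N + 'N) \<Rightarrow> (complex^'N) set" where
  "kernel L = {w. \<forall>k<d. dot (covector L k 0) w = 0}"

text \<open>An echelon basis of the kernel is lifted to fields of \<open>H\<close>. These fields
  span the leaf directions at the origin, and \<open>V\<close> serves as a set of coordinates on the
  leaf.\<close>

lemma ex_leaf_fields:
  assumes L: "L = Inl \<or> L = Inr"
  obtains V X where "\<And>i. i \<in> V \<Longrightarrow> X i \<in> H" "\<And>i s. i \<in> V \<Longrightarrow> s \<notin> range L \<Longrightarrow> X i s = 0"
    "\<And>i j. i \<in> V \<Longrightarrow> j \<in> V \<Longrightarrow> mfps_const_coeff (X i (L j)) = (if j = i then 1 else 0)"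
    "\<And>w j. w \<in> kernel L \<Longrightarrow> w $ j = (\<Sum>i\<in>V. w $ i * mfps_const_coeff (X i (L j)))"
    "CARD('N) \<le> d + card V"
proof -
  have "vec.subspace (kernel L)" unfolding kernel_def by (rule subspace_annihilator)
  then obtain V b where b: "\<And>i. i \<in> V \<Longrightarrow> b i \<in> kernel L"
    "\<And>i j. i \<in> V \<Longrightarrow> j \<in> V \<Longrightarrow> b i $ j = (if j = i then 1 else 0)"
    "\<And>w. w \<in> kernel L \<Longrightarrow> w = (\<Sum>i\<in>V. w $ i *s b i)"
    by (rule ex_coordinate_basis) metis
  have "\<exists>X\<in>H. (\<forall>j. mfps_const_coeff (X (L j)) = b i $ j) \<and> (\<forall>s. s \<notin> range L \<longrightarrow> X s = 0)" if "i \<in> V" for i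
    by (rule ex_H_field[OF L]) (use b(1)[OF that] in \<open>auto simp: kernel_def\<close>)
  then obtain X where X: "\<And>i. i \<in> V \<Longrightarrow> X i \<in> H" "\<And>i j. i \<in> V \<Longrightarrow> mfps_const_coeff (X i (L j)) = b i $ j"
    "\<And>i s. i \<in> V \<Longrightarrow> s \<notin> range L \<Longrightarrow> X i s = 0"
    by metis
  have "CARD('N) \<le> d + card V"
    by (rule card_annihilator_coordinates[of d "\<lambda>k. covector L k 0"]) (rule b(3), auto simp: kernel_def)
  moreover have "w $ j = (\<Sum>i\<in>V. w $ i * mfps_const_coeff (X i (L j)))" if "w \<in> kernel L" for w j
    by (subst b(3)[OF that]) (simp add: X(2))
  ultimately show ?thesis using X b(2) by (intro that[of V X]) auto
qed

text \<open>Two points of the complexification with the same \<zeta> (\<open>L = Inl\<close>) or the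
  same Z (\<open>L = Inr\<close>); that \<open>P\<close> lies on it is contained in the orbit ideal
  condition. A vector in the fibre direction killed by the linear parts of the
  \<open>\<rho> k\<close> lies in \<open>kernel L\<close>, which verifies the condition on tangent
  vectors in \<open>kills_along_leaf\<close>.\<close>

lemma kills_along_Segre_leaf:
  fixes P Q :: "('N + 'N, complex) mfps \<Rightarrow> ('y, complex) mfps"
  assumes L: "L = Inl \<or> L = Inr"
    and P: "\<And>K. approx_hom K P" "\<And>h. h \<in> orbit_ideal \<Longrightarrow> P h = 0"
    and Q: "\<And>K. approx_hom K Q" "\<And>k. k < d \<Longrightarrow> Q (\<rho> k) = 0"
    and PQ: "\<And>s. s \<notin> range L \<Longrightarrow> P (mfps_var s) = Q (mfps_var s)"
    and h: "h \<in> orbit_ideal"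
  shows "Q h = 0"
proof -
  have inj: "inj L" using L by auto
  obtain V X where X: "\<And>i. i \<in> V \<Longrightarrow> X i \<in> H" "\<And>i s. i \<in> V \<Longrightarrow> s \<notin> range L \<Longrightarrow> X i s = 0"
    "\<And>w j. w \<in> kernel L \<Longrightarrow> w $ j = (\<Sum>i\<in>V. w $ i * mfps_const_coeff (X i (L j)))"
    by (rule ex_leaf_fields[OF L]) blast
  \<comment> \<open>The fields are indexed by coordinates in \<open>V\<close>, whereas
    \<open>kills_along_leaf\<close> indexes them by the corresponding indeterminates.\<close>
  define X' where "X' s = X (inv L s)" for s
  have X'_L: "X' (L i) = X i" for i by (simp add: X'_def inv_f_f[OF inj])
  show ?thesis
  proof (rule kills_along_leaf[where R = "\<rho> ` {..<d}" and S = "range L" and U = "L ` V" and X = X', OF P Q(1)])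
    fix v :: "'N + 'N \<Rightarrow> complex" and s
    assume v0: "\<And>s. s \<notin> range L \<Longrightarrow> v s = 0"
      and eq: "\<And>\<rho>'. \<rho>' \<in> \<rho> ` {..<d} \<Longrightarrow> (\<Sum>s\<in>UNIV. mfps_coeff \<rho>' (Poly_Mapping.single s 1) * v s) = 0"
    have "dot (covector L k 0) (\<chi> i. v (L i)) = 0" if k: "k < d" for k
    proof -
      have "(\<Sum>s\<in>UNIV. wirtinger s (rc k) 0 * v s) = 0"
        using eq[of "\<rho> k"] k by (simp only: \<rho>_linear_coeff) simp
      also have "(\<Sum>s\<in>UNIV. wirtinger s (rc k) 0 * v s) = (\<Sum>s\<in>range L. wirtinger s (rc k) 0 * v s)"
        by (rule sum.mono_neutral_right) (auto simp: v0)
      also have "\<dots> = dot (covector L k 0) (\<chi> i. v (L i))"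
        by (subst sum.reindex[OF inj]) (simp add: dot_def covector_def)
      finally show ?thesis .
    qed
    then have ker: "(\<chi> i. v (L i)) \<in> kernel L" by (simp add: kernel_def)
    show "v s = (\<Sum>i\<in>L ` V. v i * mfps_const_coeff (X' i s))"
    proof (cases "s \<in> range L")
      case True
      then obtain j where "s = L j" by auto
      then show ?thesis
        using X(3)[OF ker, of j] by (simp add: sum.reindex[OF inj_on_subset[OF inj subset_UNIV]] X'_L)
    next
      case False
      have "(\<Sum>i\<in>L ` V. v i * mfps_const_coeff (X' i s)) = 0"
        by (rule sum.neutral) (use X(2) False in \<open>auto simp: X'_L\<close>)
      with False show ?thesis by (simp add: v0)
    qed
  qed (use Q(2) \<rho>_in_orbit_ideal PQ X h X'_L in auto)
qed

text \<open>Supplies the data of \<open>graded_lie_algebra\<close>: \<open>W\<close> collects the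
  Z-parts of the values of \<open>H\<close> at the origin, \<open>U\<close> is a set of pivot
  coordinates of \<open>W\<close>, and \<open>E\<close> lifts its echelon basis to
  \<open>H\<close>.\<close>

lemma ex_formal_equations:
  obtains U f where "2 * CARD('N) - d - vec.dim (cr_lie_algebra_at_0 M d r) \<le> CARD('N) - card U"
    and "\<And>b. b \<notin> U \<Longrightarrow> f b \<in> orbit_ideal"
    and "\<And>b. b \<notin> U \<Longrightarrow> mfps_coeff (f b) (Poly_Mapping.single (Inl b) 1) = 1"
    and "\<And>b m. b \<notin> U \<Longrightarrow> mfps_coeff (f b) m \<noteq> 0 \<Longrightarrow> m = Poly_Mapping.single (Inl b) 1 \<or> Poly_Mapping.keys m \<subseteq> Inl ` U"
proof -
  define W where "W = {w :: complex^'N. \<exists>X\<in>H. \<forall>i. w $ i = mfps_const_coeff (X (Inl i))}"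
  have "vec.subspace W"
  proof (rule vec.subspaceI)
    show "0 \<in> W" unfolding W_def using H_zero by force
    fix x y assume "x \<in> W" "y \<in> W"
    then obtain X Y where "X \<in> H" "Y \<in> H" "\<And>i. x $ i = mfps_const_coeff (X (Inl i))" "\<And>i. y $ i = mfps_const_coeff (Y (Inl i))"
      by (auto simp: W_def)
    then show "x + y \<in> W" "c *s x \<in> W" for c
      using H_add[of X Y] H_scale[of X c] unfolding W_def by (force simp: mfps_coeff_const)+
  qed
  then obtain U b where b: "\<And>i. i \<in> U \<Longrightarrow> b i \<in> W"
    "\<And>i j. i \<in> U \<Longrightarrow> j \<in> U \<Longrightarrow> b i $ j = (if j = i then 1 else 0)"
    "\<And>w. w \<in> W \<Longrightarrow> w = (\<Sum>i\<in>U. w $ i *s b i)"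
    by (rule ex_coordinate_basis) metis
  from b(1) obtain E where E: "\<And>i. i \<in> U \<Longrightarrow> E i \<in> H" "\<And>i j. i \<in> U \<Longrightarrow> mfps_const_coeff (E i (Inl j)) = b i $ j"
    unfolding W_def by (simp, metis)
  obtain V X where X: "\<And>i. i \<in> V \<Longrightarrow> X i \<in> H" "\<And>i s. i \<in> V \<Longrightarrow> s \<notin> range Inr \<Longrightarrow> X i s = 0"
    "\<And>i j. i \<in> V \<Longrightarrow> j \<in> V \<Longrightarrow> mfps_const_coeff (X i (Inr j)) = (if j = i then 1 else 0)"
    and V: "CARD('N) \<le> d + card V"
    by (rule ex_leaf_fields[of Inr]) auto
  have X_Inl: "X i (Inl j) = 0" if "i \<in> V" for i j
    by (rule X(2)[OF that]) auto
  have "card U + card V \<le> vec.dim (cr_lie_algebra_at_0 M d r)"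
    by (rule card_le_dim_graph[where E = "\<lambda>i. \<chi> s. mfps_const_coeff (E i s)" and F = "\<lambda>i. \<chi> s. mfps_const_coeff (X i s)"])
       (use E X(1,3) X_Inl b(2) H_value_in_cr in auto)
  with V have dim: "2 * CARD('N) - d - vec.dim (cr_lie_algebra_at_0 M d r) \<le> CARD('N) - card U" by linarith
  \<comment> \<open>The locale indexes fields by indeterminates. The \<open>Inr\<close> branch is a
    filler; the index set is the image of \<open>U\<close> under \<open>Inl\<close>.\<close>
  define E' where "E' s = E (case s of Inl i \<Rightarrow> i | Inr i \<Rightarrow> i)" for s :: "'N + 'N"
  have E'_Inl [simp]: "E' (Inl i) = E i" for i by (simp add: E'_def)
  have H_sum: "(\<lambda>s. \<Sum>i\<in>I. mfps_const (c i) * E i s) \<in> H" if "I \<subseteq> U" for I c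
    using finite[of I] that
  proof (induction I rule: finite_induct)
    case empty
    then show ?case by (simp add: H_zero)
  next
    case (insert i I)
    then have "(\<lambda>s. mfps_const (c i) * E i s + (\<Sum>i\<in>I. mfps_const (c i) * E i s)) \<in> H"
      by (intro H_add H_scale E) auto
    then show ?case using insert.hyps by simp
  qed
  interpret graded_lie_algebra H "range Inl" "Inl ` U" E'
  proof
    fix X assume X: "X \<in> H"
    define w :: "complex^'N" where "w = (\<chi> i. mfps_const_coeff (X (Inl i)))"
    have "w \<in> W" unfolding W_def w_def using X by auto
    note w = b(3)[OF this]
    \<comment> \<open>\<open>S\<close> lifts the Z-part of the value of \<open>X\<close>, so the
      difference \<open>Y\<close> has a value with zero Z-part at the origin. As \<open>Y\<close>
      annihilates the \<open>\<rho> k\<close>, this value is a (0,1) tangent vector, which a (0,1)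
      field \<open>K\<close> of \<open>H\<close> matches; what remains vanishes at the
      origin.\<close>
    define S where "S s = (\<Sum>i\<in>U. mfps_const (w $ i) * E i s)" for s
    have S: "S \<in> H" unfolding S_def[abs_def] by (rule H_sum) simp
    have Y: "(\<lambda>s. X s + mfps_const (-1) * S s) \<in> H" by (intro H_add H_scale X S)
    define Y where "Y s = X s + mfps_const (-1) * S s" for s
    have Y_Inl: "mfps_const_coeff (Y (Inl i)) = 0" for i
    proof -
      have "w $ i = (\<Sum>j\<in>U. w $ j * b j $ i)" by (subst w) simp
      then show ?thesis by (simp add: Y_def S_def E mfps_coeff_const w_def)
    qed
    have "Y \<in> H" using Y by (simp add: Y_def[abs_def])
    define v :: "complex^'N" where "v = (\<chi> i. mfps_const_coeff (Y (Inr i)))"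
    have "dot (covector Inr k 0) v = 0" if k: "k < d" for k
    proof -
      have "mfps_const_coeff (formal_apply Y (\<rho> k)) = 0" using H_annihilates[OF \<open>Y \<in> H\<close> k] by simp
      then have "(\<Sum>s\<in>UNIV. mfps_const_coeff (Y s) * wirtinger s (rc k) 0) = 0"
        by (simp add: formal_apply_def const_coeff_pderiv \<rho>_linear_coeff[OF k, unfolded One_nat_def])
      also have "(\<Sum>s\<in>UNIV. mfps_const_coeff (Y s) * wirtinger s (rc k) 0)
          = (\<Sum>s\<in>range Inr. mfps_const_coeff (Y s) * wirtinger s (rc k) 0)"
      proof (rule sum.mono_neutral_right)
        show "\<forall>s\<in>UNIV - range Inr. mfps_const_coeff (Y s) * wirtinger s (rc k) 0 = 0"
        proof
          fix s :: "'N + 'N" assume "s \<in> UNIV - range Inr"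
          then show "mfps_const_coeff (Y s) * wirtinger s (rc k) 0 = 0" by (cases s) (auto simp: Y_Inl)
        qed
      qed auto
      also have "\<dots> = dot (covector Inr k 0) v"
        by (subst sum.reindex) (auto simp: dot_def covector_def v_def mult.commute)
      finally show ?thesis .
    qed
    then obtain K where K: "K \<in> H" "\<And>i. mfps_const_coeff (K (Inr i)) = v $ i" "\<And>s. s \<notin> range Inr \<Longrightarrow> K s = 0"
      using ex_H_field[of Inr v] by auto
    have K_Inl: "K (Inl i) = 0" for i by (rule K(3)) auto
    define X0 where "X0 s = Y s + mfps_const (-1) * K s" for s
    have "X0 \<in> H" unfolding X0_def[abs_def] by (intro H_add H_scale \<open>Y \<in> H\<close> K)
    moreover have "mfps_const_coeff (X0 s) = 0" for s
      using K(2) K_Inl Y_Inl by (cases s) (auto simp: X0_def v_def mfps_coeff_const)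
    moreover have "X s = X0 s + (\<Sum>i\<in>Inl ` U. mfps_const (case_sum (($) w) (\<lambda>_. 0) i) * E' i s) + K s" for s
      by (rule mfps_eqI) (simp add: X0_def Y_def S_def sum.reindex)
    ultimately show "\<exists>c X0 K. X0 \<in> H \<and> (\<forall>s. mfps_const_coeff (X0 s) = 0) \<and>
        K \<in> H \<and> (\<forall>s\<in>range Inl. K s = 0) \<and> X = (\<lambda>s. X0 s + (\<Sum>i\<in>Inl ` U. mfps_const (c i) * E' i s) + K s)"
      using K by (intro exI[of _ "case_sum (($) w) (\<lambda>_. 0)"] exI[of _ X0] exI[of _ K]) (auto simp: K_Inl)
  qed (use E b(2) in \<open>auto simp: E split: if_splits\<close>)
  have "\<exists>f\<in>orbit_ideal. mfps_coeff f (Poly_Mapping.single (Inl b) 1) = 1 \<and>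
    (\<forall>m. mfps_coeff f m \<noteq> 0 \<longrightarrow> m = Poly_Mapping.single (Inl b) 1 \<or> Poly_Mapping.keys m \<subseteq> Inl ` U)" if "b \<notin> U" for b
    by (rule ex_orbit_ideal_element) (use that in auto)
  then obtain f where "\<And>b. b \<notin> U \<Longrightarrow> f b \<in> orbit_ideal \<and> mfps_coeff (f b) (Poly_Mapping.single (Inl b) 1) = 1 \<and>
    (\<forall>m. mfps_coeff (f b) m \<noteq> 0 \<longrightarrow> m = Poly_Mapping.single (Inl b) 1 \<or> Poly_Mapping.keys m \<subseteq> Inl ` U)"
    by metis
  then show ?thesis using dim by (intro that[of U f]) blast+
qed

end

section \<open>Iterated Segre mappings\<close>

locale segre_mapping = generic_manifold +
  fixes \<gamma>
  assumes segre: "segre_variety_mapping d r \<gamma>"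
begin

abbreviation v :: "nat \<Rightarrow> 'a \<Rightarrow> (nat \<times> nat, complex) mfps" where
  "v \<equiv> iterated_segre \<gamma>"

abbreviation gvars :: "('a + nat) set" where
  "gvars \<equiv> UNIV <+> {..<CARD('a) - d}"

lemma \<gamma>_vars: "mfps_vars_in gvars (\<gamma> k)" and \<gamma>_const: "mfps_const_coeff (\<gamma> k) = 0"
  and \<gamma>_leaf: "j < d \<Longrightarrow> mfps_subst (\<rho> j) (case_sum \<gamma> (\<lambda>k. mfps_var (Inl k))) = 0"
  using segre by (auto simp: segre_variety_mapping_def Let_def \<rho>_def rc_def[abs_def])

lemma v_const: "mfps_const_coeff (v j k) = 0"
proof (induction j arbitrary: k)
  case (Suc j)
  have "mfps_const_coeff (case_sum (\<lambda>i. mfps_cnj (v j i)) (\<lambda>l. mfps_var (Suc j, l)) s) = 0" for s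
    using Suc by (cases s) auto
  then show ?case
    by (simp add: mfps_const_coeff_subst[OF _ \<gamma>_vars] \<gamma>_const)
qed simp

lemma segre_point_const:
  "mfps_const_coeff (case_sum (v i) (\<lambda>k. mfps_cnj (v j k)) s) = 0"
  by (cases s) (auto simp: v_const)

text \<open>Conjugated v^j is substituted for \<zeta>, and the fresh block of indeterminates for t,
  in the defining identity of \<open>\<gamma>\<close>; \<open>gvars\<close> is the finite set
  required to compose the substitutions.\<close>

lemma segre_point: "k < d \<Longrightarrow> mfps_subst (\<rho> k) (case_sum (v (Suc j)) (\<lambda>k. mfps_cnj (v j k))) = 0"
proof -
  assume k: "k < d"
  define g where "g = case_sum \<gamma> (\<lambda>k. mfps_var (Inl k))"
  define h where "h = case_sum (\<lambda>i. mfps_cnj (v j i)) (\<lambda>l. mfps_var (Suc j, l))"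
  have "mfps_subst (mfps_subst (\<rho> k) g) h = mfps_subst (\<rho> k) (\<lambda>s. mfps_subst (g s) h)"
  proof (rule mfps_subst_subst)
    show "finite gvars" by simp
    show "mfps_vars_in gvars (g s)" for s
      using \<gamma>_vars by (cases s) (auto simp: g_def mfps_vars_in_def mfps_coeff_var split: if_splits)
    show "mfps_const_coeff (g s) = 0" for s
      using \<gamma>_const by (cases s) (auto simp: g_def)
    show "mfps_const_coeff (h s) = 0" for s
      using v_const by (cases s) (auto simp: h_def)
  qed
  moreover have "mfps_subst (\<rho> k) g = 0" using \<gamma>_leaf[OF k] by (simp add: g_def)
  moreover have "mfps_subst 0 h = 0" using mfps_subst_const[of 0 h] by simp
  moreover have "(\<lambda>s. mfps_subst (g s) h) = case_sum (v (Suc j)) (\<lambda>k. mfps_cnj (v j k))"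
  proof
    fix s
    show "mfps_subst (g s) h = case_sum (v (Suc j)) (\<lambda>k. mfps_cnj (v j k)) s"
      by (cases s) (auto simp: g_def h_def)
  qed
  ultimately show ?thesis by simp
qed

text \<open>The conjugate of \<open>segre_point\<close>, with the two arguments interchanged by the
  reality of \<open>r k\<close>.\<close>

lemma segre_point_conj: "k < d \<Longrightarrow> mfps_subst (\<rho> k) (case_sum (v j) (\<lambda>k. mfps_cnj (v (Suc j) k))) = 0"
proof -
  assume k: "k < d"
  define g where "g = case_sum (v (Suc j)) (\<lambda>k. mfps_cnj (v j k))"
  have g: "mfps_const_coeff (g s) = 0" for s unfolding g_def by (rule segre_point_const)
  have "mfps_subst (\<rho> k) g = 0" using segre_point[OF k] by (simp only: g_def)
  then have "mfps_cnj (mfps_subst (\<rho> k) g) = 0" by simp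
  then have "mfps_subst (mfps_cnj (\<rho> k)) (\<lambda>i. mfps_cnj (g i)) = 0"
    by (simp add: mfps_cnj_subst[of UNIV] g)
  also have "mfps_subst (mfps_cnj (\<rho> k)) (\<lambda>i. mfps_cnj (g i)) = mfps_subst (\<rho> k) (\<lambda>s. mfps_cnj (g (sum_swap s)))"
    using taylor0_real[of "r k"] rc_smooth[OF k] by (intro mfps_subst_swap) (auto simp: g \<rho>_def rc_def[abs_def])
  also have "(\<lambda>s. mfps_cnj (g (sum_swap s))) = case_sum (v j) (\<lambda>k. mfps_cnj (v (Suc j) k))"
  proof
    fix s show "mfps_cnj (g (sum_swap s)) = case_sum (v j) (\<lambda>k. mfps_cnj (v (Suc j) k)) s"
      by (cases s) (simp_all add: g_def sum_swap_def del: iterated_segre.simps)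
  qed
  finally show ?thesis .
qed

text \<open>The points \<open>(v\<^sup>j\<^sup>+\<^sup>2, conj v\<^sup>j\<^sup>+\<^sup>1)\<close> and \<open>(v\<^sup>j, conj v\<^sup>j\<^sup>+\<^sup>1)\<close> lie on the same Segre leaf, and likewise for their
  conjugates; the chain starts at the origin.\<close>

lemma orbit_ideal_vanishes_on_segre_points:
  "(\<forall>h\<in>orbit_ideal. mfps_subst h (case_sum (v (Suc j)) (\<lambda>k. mfps_cnj (v j k))) = 0) \<and>
   (\<forall>h\<in>orbit_ideal. mfps_subst h (case_sum (v j) (\<lambda>k. mfps_cnj (v (Suc j) k))) = 0)"
proof (induction j)
  case 0
  \<comment> \<open>Evaluation at 0, that is, the origin as a formal point. As \<open>v 0\<close> is
    0, it has the same \<zeta> as the first Segre point and the same Z as its conjugate.\<close>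
  let ?P = "\<lambda>h. mfps_const (mfps_const_coeff h) :: (nat \<times> nat, complex) mfps"
  have P: "approx_hom K ?P" for K
    by (simp add: approx_hom_def mfps_const_add mfps_const_mult mfps_coeff_const)
  have PJ: "?P h = 0" if "h \<in> orbit_ideal" for h
  proof -
    have "\<forall>Xs. set Xs \<subseteq> H \<longrightarrow> formal_word Xs h = 0" using that by (simp add: orbit_ideal_def)
    from spec[OF this, of "[]"] have "formal_word [] h = 0" by simp
    then show ?thesis by (simp add: formal_word_def)
  qed
  show ?case
  proof (intro conjI ballI)
    fix h assume h: "h \<in> orbit_ideal"
    show "mfps_subst h (case_sum (v (Suc 0)) (\<lambda>k. mfps_cnj (v 0 k))) = 0"
    proof (rule kills_along_Segre_leaf[where L = Inl and P = ?P, OF _ P PJ approx_hom_subst[OF segre_point_const] segre_point _ h])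
      show "?P (mfps_var s) = mfps_subst (mfps_var s) (case_sum (v (Suc 0)) (\<lambda>k. mfps_cnj (v 0 k)))" if "s \<notin> range Inl" for s
        using that by (cases s) auto
    qed auto
    show "mfps_subst h (case_sum (v 0) (\<lambda>k. mfps_cnj (v (Suc 0) k))) = 0"
    proof (rule kills_along_Segre_leaf[where L = Inr and P = ?P, OF _ P PJ approx_hom_subst[OF segre_point_const] segre_point_conj _ h])
      show "?P (mfps_var s) = mfps_subst (mfps_var s) (case_sum (v 0) (\<lambda>k. mfps_cnj (v (Suc 0) k)))" if "s \<notin> range Inr" for s
        using that by (cases s) auto
    qed auto
  qed
next
  case (Suc j)
  then have IH1: "\<And>h. h \<in> orbit_ideal \<Longrightarrow> mfps_subst h (case_sum (v (Suc j)) (\<lambda>k. mfps_cnj (v j k))) = 0"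
    and IH2: "\<And>h. h \<in> orbit_ideal \<Longrightarrow> mfps_subst h (case_sum (v j) (\<lambda>k. mfps_cnj (v (Suc j) k))) = 0"
    by blast+
  note hom = approx_hom_subst[OF segre_point_const]
  show ?case
  proof (intro conjI ballI)
    fix h assume h: "h \<in> orbit_ideal"
    show "mfps_subst h (case_sum (v (Suc (Suc j))) (\<lambda>k. mfps_cnj (v (Suc j) k))) = 0"
    proof (rule kills_along_Segre_leaf[where L = Inl, OF _ hom IH2 hom segre_point _ h])
      fix s :: "'a + 'a" assume "s \<notin> range Inl"
      then show "mfps_subst (mfps_var s) (case_sum (v j) (\<lambda>k. mfps_cnj (v (Suc j) k)))
          = mfps_subst (mfps_var s) (case_sum (v (Suc (Suc j))) (\<lambda>k. mfps_cnj (v (Suc j) k)))"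
        by (cases s) auto
    qed auto
    show "mfps_subst h (case_sum (v (Suc j)) (\<lambda>k. mfps_cnj (v (Suc (Suc j)) k))) = 0"
    proof (rule kills_along_Segre_leaf[where L = Inr, OF _ hom IH1 hom segre_point_conj _ h])
      fix s :: "'a + 'a" assume "s \<notin> range Inr"
      then show "mfps_subst (mfps_var s) (case_sum (v (Suc j)) (\<lambda>k. mfps_cnj (v j k)))
          = mfps_subst (mfps_var s) (case_sum (v (Suc j)) (\<lambda>k. mfps_cnj (v (Suc (Suc j)) k)))"
        by (cases s) auto
    qed auto
  qed
qed

end

theorem theorem1p3:
  fixes M :: "(complex^'N::finite) set"
    and d e :: nat
    and r :: "nat \<Rightarrow> complex^'N \<Rightarrow> real"
    and \<gamma> :: "'N \<Rightarrow> ('N + nat, complex) mfps"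
  assumes "0 \<in> M"
    and "defining_functions_near_0 M d r"
    and "generic_at_0 d r"
    and "segre_variety_mapping d r \<gamma>"
    and "e = 2 * CARD('N) - d - vec.dim (cr_lie_algebra_at_0 M d r)"
  shows "\<exists>f :: nat \<Rightarrow> ('N, complex) mfps.
           independent_family ({..<e} <+> {..<d})
             (case_sum (\<lambda>k. formal_differential (f k)) (\<lambda>k. differential (r k) 0)) \<and>
           (\<forall>k<e. \<forall>j\<ge>1. mfps_subst (f k) (iterated_segre \<gamma> j) = 0)"
proof -
  interpret segre_mapping M d r \<gamma> by unfold_locales fact+
  obtain U F where dim: "e \<le> CARD('N) - card U"
    and FJ: "\<And>b. b \<notin> U \<Longrightarrow> F b \<in> orbit_ideal"
    and F1: "\<And>b. b \<notin> U \<Longrightarrow> mfps_coeff (F b) (Poly_Mapping.single (Inl b) 1) = 1"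
    and Fm: "\<And>b m. b \<notin> U \<Longrightarrow> mfps_coeff (F b) m \<noteq> 0 \<Longrightarrow> m = Poly_Mapping.single (Inl b) 1 \<or> Poly_Mapping.keys m \<subseteq> Inl ` U"
    unfolding assms(5) by (rule ex_formal_equations) blast
  have "card {..<e} \<le> card (UNIV - U)" using dim by (simp add: card_Diff_subset)
  then obtain \<beta> where \<beta>: "\<beta> ` {..<e} \<subseteq> UNIV - U" "inj_on \<beta> {..<e}"
    using card_le_inj[of "{..<e}" "UNIV - U"] by auto
  have \<beta>_U: "\<beta> k \<notin> U" if "k < e" for k using \<beta>(1) that by auto
  define f where "f k = Abs_mfps (\<lambda>m. mfps_coeff (F (\<beta> k)) (exponent_Inl m :: 'N + 'N \<Rightarrow>\<^sub>0 nat))" for k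
  have single: "exponent_Inl (Poly_Mapping.single i 1) = (Poly_Mapping.single (Inl i) 1 :: 'N + 'N \<Rightarrow>\<^sub>0 nat)" for i :: 'N
  proof (rule poly_mapping_eqI)
    fix s :: "'N + 'N"
    show "Poly_Mapping.lookup (exponent_Inl (Poly_Mapping.single i 1)) s = Poly_Mapping.lookup (Poly_Mapping.single (Inl i) 1) s"
      by (cases s) (auto simp: lookup_single when_def)
  qed
  \<comment> \<open>On the selected coordinates the differentials form the identity matrix, as all
    other terms of \<open>F (\<beta> k)\<close> involve only coordinates in
    \<open>U\<close>.\<close>
  have f_diff: "formal_differential (f k) $ Inl (\<beta> l) = (if l = k then 1 else 0)" if "k < e" "l < e" for k l
  proof -
    have "formal_differential (f k) $ Inl (\<beta> l) = mfps_coeff (F (\<beta> k)) (Poly_Mapping.single (Inl (\<beta> l)) 1)"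
      unfolding formal_differential_def by (simp only: vec_lambda_beta sum.case const_coeff_pderiv) (simp only: f_def mfps_coeff_Abs single)
    also have "\<dots> = (if l = k then 1 else 0)"
    proof (cases "l = k")
      case False
      then have "\<beta> l \<noteq> \<beta> k" using inj_onD[OF \<beta>(2), of l k] that by auto
      have "mfps_coeff (F (\<beta> k)) (Poly_Mapping.single (Inl (\<beta> l)) 1) = 0"
      proof (rule ccontr)
        assume "mfps_coeff (F (\<beta> k)) (Poly_Mapping.single (Inl (\<beta> l)) 1) \<noteq> 0"
        from Fm[OF \<beta>_U[OF that(1)] this] have "\<beta> l = \<beta> k \<or> \<beta> l \<in> U"
        proof
          assume "Poly_Mapping.single (Inl (\<beta> l)) 1 = (Poly_Mapping.single (Inl (\<beta> k)) 1 :: 'N + 'N \<Rightarrow>\<^sub>0 nat)"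
          from arg_cong[OF this, of Poly_Mapping.keys] show ?thesis by simp
        qed auto
        then show False using \<open>\<beta> l \<noteq> \<beta> k\<close> \<beta>_U[OF that(2)] by auto
      qed
      with False show ?thesis by simp
    qed (use F1 \<beta>_U that in auto)
    finally show ?thesis .
  qed
  let ?w = "case_sum (\<lambda>k. formal_differential (f k)) (\<lambda>k. differential (r k) 0)"
  have "independent_family ({..<e} <+> {..<d}) ?w"
  proof (subst independent_family_iff, simp, intro allI impI)
    fix c assume "(\<Sum>s\<in>{..<e} <+> {..<d}. c s *s ?w s) = 0"
    then have sum: "(\<Sum>k<e. c (Inl k) *s formal_differential (f k)) + (\<Sum>k<d. c (Inr k) *s differential (r k) 0) = 0"
      by (simp add: sum.Plus)
    have "(\<Sum>k<d. c (Inr k) *s covector Inr k 0) $ i = 0" for i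
      using arg_cong[OF sum, of "\<lambda>x. x $ Inr i"] by (simp add: formal_differential_def covector_def differential_eq)
    then have "(\<Sum>k<d. c (Inr k) *s covector Inr k 0) = 0" by (simp add: vec_eq_iff)
    then have r0: "c (Inr k) = 0" if "k < d" for k
      using covector_Inr_eq_0[of "\<lambda>k. c (Inr k)"] that by blast
    then have f0: "(\<Sum>k<e. c (Inl k) *s formal_differential (f k)) = 0" using sum by simp
    have "c (Inl l) = 0" if l: "l < e" for l
    proof -
      have "(\<Sum>k<e. c (Inl k) * formal_differential (f k) $ Inl (\<beta> l)) = 0"
        using arg_cong[OF f0, of "\<lambda>x. x $ Inl (\<beta> l)"] by simp
      also have "(\<Sum>k<e. c (Inl k) * formal_differential (f k) $ Inl (\<beta> l)) = (\<Sum>k<e. if k = l then c (Inl k) else 0)"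
        by (intro sum.cong refl) (auto simp: f_diff l)
      also have "\<dots> = c (Inl l)" using l by simp
      finally show ?thesis .
    qed
    with r0 show "\<forall>i\<in>{..<e} <+> {..<d}. c i = 0" by auto
  qed
  moreover have "mfps_subst (f k) (v j) = 0" if k: "k < e" and j: "1 \<le> j" for k j
  proof -
    obtain j' where j': "j = Suc j'" using j by (cases j) auto
    have "mfps_vars_in (range Inl) (F (\<beta> k))"
      unfolding mfps_vars_in_def
    proof (intro allI impI)
      fix m assume "mfps_coeff (F (\<beta> k)) m \<noteq> 0"
      from Fm[OF \<beta>_U[OF k] this] show "Poly_Mapping.keys m \<subseteq> range Inl" by auto
    qed
    \<comment> \<open>The second component is free to choose; the conjugate of \<open>v j'\<close>
      completes \<open>v j\<close> to a Segre point, where the orbit ideal is known to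
      vanish.\<close>
    then have "mfps_subst (f k) (v j) = mfps_subst (F (\<beta> k)) (case_sum (v j) (\<lambda>k. mfps_cnj (v j' k)))"
      unfolding f_def by (rule mfps_subst_restrict_Inl) (auto simp: v_const)
    also have "\<dots> = 0"
      using orbit_ideal_vanishes_on_segre_points[of j'] FJ[OF \<beta>_U[OF k]] unfolding j' by blast
    finally show ?thesis .
  qed
  ultimately show ?thesis by blast
qed

end
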